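(* Let $m\in\mathbb Z_{\ge0}$. Each word $w\in\mathbf W=\mathbf W_{\mathcal N(m)}$ is $\mathfrak{gl}_{\mathcal N(m)}$-equivalent to a unique semistandard tableau of shape $(\lambda,\alpha)\in\mathcal C(m)$ (that is, to a unique element of $\bigsqcup_{(\lambda,\alpha)\in\mathcal C(m)}\mathbf B(\lambda,\alpha)$).
   Context: $\mathcal N(m)=\{-m<\cdots<-1<\frac12<1<\frac32<2<\cdots\}$; integers are even, elements of $\frac12+\mathbb Z_{\ge0}$ are odd. $P=\bigoplus_{b\in\mathcal N(m)}\mathbb Z\epsilon_b$ with $(\epsilon_a,\epsilon_b)=(-1)^{|a|}\delta_{ab}$. Simple roots: $\alpha_i=\epsilon_{i-1}-\epsilon_i$ for $-m+1\le i\le-1$ (non-isotropic), and, isotropic, $\alpha_0=\epsilon_{-1}-\epsilon_{1/2}$ (if $m\ge1$) and $\alpha_r=\epsilon_r-\epsilon_{r+\frac12}$ for $r\in\frac12\mathbb Z_{>0}$; $I(m)$ is the index set. A $\mathfrak{gl}_{\mathcal N(m)}$-crystal is a set $B$ with maps $\mathrm{wt}:B\to P$, $\varepsilon_i,\varphi_i:B\to\mathbb Z_{\ge0}$, $e_i,f_i:B\to B\cup\{\mathbf 0\}$ ($i\in I(m)$, $\mathbf 0$ a formal symbol) such that: (1) for $\alpha_i$ isotropic, $\varphi_i(b)+\varepsilon_i(b)$ is $1$ if $(\mathrm{wt}(b),\alpha_i)\ne0$ and $0$ otherwise; (2) for $\alpha_i$ non-isotropic, $\varphi_i(b)-\varepsilon_i(b)=(\mathrm{wt}(b),\alpha_i)$;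 (3) if $e_ib\in B$ then $\varepsilon_i,\varphi_i,\mathrm{wt}$ change by $-1,+1,+\alpha_i$; (4) if $f_ib\in B$ then they change by $+1,-1,-\alpha_i$; (5) $f_ib=b'$ iff $b=e_ib'$. It is viewed as a colored oriented graph ($b\xrightarrow{i}b'$ iff $b'=f_ib$); isomorphisms are graph isomorphisms preserving colors, $\mathrm{wt},\varepsilon_i,\varphi_i$. $b_1\in B_1$ and $b_2\in B_2$ are $\mathfrak{gl}_{\mathcal N(m)}$-equivalent if there is a crystal isomorphism between their connected components sending $b_1$ to $b_2$. $\mathcal N(m)$ is a crystal: $\mathrm{wt}(b)=\epsilon_b$, and $f_i b=b'$ iff $\alpha_i=\epsilon_b-\epsilon_{b'}$; $\varepsilon_i(b)$ (resp. $\varphi_i(b)$) is $1$ if $e_ib\ne\mathbf 0$ (resp. $f_ib\neq\mathbf 0$), else $0$. Tensor product $B_1\otimes B_2$: $\mathrm{wt}$ is additive. For $i\in\mathbb Z_{\ge0}$: $e_i,f_i$ act on $b_1$ if $(\alpha_i,\mathrm{wt}(b_1))\ne0$, otherwise on $b_2$. For $i\in\frac12+\mathbb Z_{\ge0}$: they act on $b_2$ if $(\alpha_i,\mathrm{wt}(b_2))\neq0$, otherwise on $b_1$. In both cases $\varepsilon_i,\varphi_i$ are those of the factor acted on. For $i\le-1$: $e_i(b_1\otimes b_2)=e_ib_1\otimes b_2$ if $\varphi_i(b_1)\ge\varepsilon_i(b_2)$, else $b_1\otimes e_ib_2$; $f_i(b_1\otimes b_2)=f_ib_1\otimes b_2$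 if $\varphi_i(b_1)>\varepsilon_i(b_2)$, else $b_1\otimes f_ib_2$; $\varepsilon_i(b_1\otimes b_2)=\max\{\varepsilon_i(b_1),\varepsilon_i(b_2)-(\alpha_i,\mathrm{wt}(b_1))\}$, $\varphi_i(b_1\otimes b_2)=\max\{\varphi_i(b_1)+(\alpha_i,\mathrm{wt}(b_2)),\varphi_i(b_2)\}$. The set $\mathbf W$ of finite words in $\mathcal N(m)$ is a crystal via $w_1\cdots w_r=w_1\otimes\cdots\otimes w_r$ (the empty word being a trivial crystal). $\mathcal C(m)$ is the set of pairs $(\lambda,\alpha)$ with $\lambda=(\lambda_1,\dots,\lambda_m)$ a partition of length at most $m$ and $\alpha$ a (possibly empty) composition that is non-empty only if $\lambda_m\neq0$; $\mathcal C(0)$ is the set of compositions (including the empty one). A composition is identified with its ribbon diagram (rows of lengths $\alpha_1,\alpha_2,\dots$ from top to bottom, the leftmost node of row $i+1$ directly below the rightmost node of row $i$). $(\lambda,\alpha)$ is identified with the diagram obtained by placing the first (northwest) node of $\alpha$ directly below the leftmost node in the $m$-th row of the Young diagram $\lambda$; $\lambda$ is the body, $\alpha$ the tail, and the first node of the tail is the joint. A semistandard tableau of shape $(\lambda,\alpha)$, i.e. an element of $\mathbf B(\lambda,\alpha)$, is a filling $T$ of this diagram with entries in $\mathcal N(m)$ such that (1) entries weakly increase along rows (left to right) and columns (top to bottom), even entries strictly increase in columns, odd entries strictly increase in rows; (2) if the joint entry $b$ is in $\mathbb Z_{>0}$, all entries in the body are $<b$; (3) if the joint entry $b$ is in $\frac12+\mathbb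 Z_{\ge0}$, all entries in the body are $\le b$. $\mathbf B(\lambda,\alpha)$ is a crystal by identifying $T$ with the word in $\mathbf W$ obtained by reading rows top to bottom, each row right to left. *)

theory Defs
  imports Complex_Main "HOL-Library.Poly_Mapping" "HOL-Library.FuncSet"
begin

section \<open>Letters, weight lattice and simple roots\<close>

text \<open>The members of the linearly ordered set $\mathcal N(m)$ are rational numbers; the even ones
  are the integers.\<close>

definition pos_half_odds :: "rat set" where
  "pos_half_odds = {1/2 + of_nat k | k. True}"

definition letters :: "nat \<Rightarrow> rat set" where
  "letters m = {- of_nat k | k. 1 \<le> k \<and> k \<le> m} \<union> {of_nat k | k. 1 \<le> k} \<union> pos_half_odds"

definition index_set :: "nat \<Rightarrow> rat set" where
  "index_set m = {of_int i | i. - int m + 1 \<le> i \<and> i \<le> -1}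
     \<union> (if m \<ge> 1 then {0} else {}) \<union> {of_nat k / 2 | k. k \<ge> 1}"

type_synonym weight = "rat \<Rightarrow>\<^sub>0 int"

definition weight_lattice :: "nat \<Rightarrow> weight set" where
  "weight_lattice m = {\<mu>. Poly_Mapping.keys \<mu> \<subseteq> letters m}"

definition epsilon :: "rat \<Rightarrow> weight" where
  "epsilon b = Poly_Mapping.single b 1"

definition parity_sign :: "rat \<Rightarrow> int" where
  "parity_sign b = (if b \<in> \<int> then 1 else -1)"

text \<open>The bilinear form with $(\epsilon_a,\epsilon_b)=(-1)^{|a|}\delta_{ab}$.\<close>

definition form :: "weight \<Rightarrow> weight \<Rightarrow> int" where
  "form \<mu> \<nu> = (\<Sum>b\<in>Poly_Mapping.keys \<mu>.
     parity_sign b * Poly_Mapping.lookup \<mu> b * Poly_Mapping.lookup \<nu> b)"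

definition simple_root :: "rat \<Rightarrow> weight" where
  "simple_root i =
     (if i < 0 then epsilon (i - 1) - epsilon i
      else if i = 0 then epsilon (-1) - epsilon (1/2)
      else epsilon i - epsilon (i + 1/2))"

definition isotropic :: "rat \<Rightarrow> bool" where
  "isotropic i \<longleftrightarrow> form (simple_root i) (simple_root i) = 0"


section \<open>Crystals\<close>

text \<open>The formal symbol $\mathbf 0$ is \<open>None\<close>.\<close>

record 'b crystal =
  elts :: "'b set"
  wt :: "'b \<Rightarrow> weight"
  eps :: "rat \<Rightarrow> 'b \<Rightarrow> nat"
  phi :: "rat \<Rightarrow> 'b \<Rightarrow> nat"
  e_op :: "rat \<Rightarrow> 'b \<Rightarrow> 'b option"
  f_op :: "rat \<Rightarrow> 'b \<Rightarrow> 'b option"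

definition is_crystal :: "nat \<Rightarrow> 'b crystal \<Rightarrow> bool" where
  "is_crystal m B \<longleftrightarrow>
     (\<forall>b\<in>elts B. wt B b \<in> weight_lattice m) \<and>
     (\<forall>i\<in>index_set m. \<forall>b\<in>elts B.
        (isotropic i \<longrightarrow>
           phi B i b + eps B i b = (if form (wt B b) (simple_root i) \<noteq> 0 then 1 else 0)) \<and>
        (\<not> isotropic i \<longrightarrow>
           int (phi B i b) - int (eps B i b) = form (wt B b) (simple_root i)) \<and>
        (\<forall>b'. e_op B i b = Some b' \<longrightarrow> b' \<in> elts B \<and>
           int (eps B i b') = int (eps B i b) - 1 \<and> phi B i b' = phi B i b + 1 \<and>
           wt B b' = wt B b + simple_root i) \<and>
        (\<forall>b'. f_op B i b = Some b' \<longrightarrow> b' \<in> elts B \<and>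
           eps B i b' = eps B i b + 1 \<and> int (phi B i b') = int (phi B i b) - 1 \<and>
           wt B b' = wt B b - simple_root i) \<and>
        (\<forall>b'\<in>elts B. f_op B i b = Some b' \<longleftrightarrow> e_op B i b' = Some b))"

definition arrows :: "nat \<Rightarrow> 'b crystal \<Rightarrow> ('b \<times> 'b) set" where
  "arrows m B = {(x, y). x \<in> elts B \<and> y \<in> elts B \<and> (\<exists>i\<in>index_set m. f_op B i x = Some y)}"

definition component :: "nat \<Rightarrow> 'b crystal \<Rightarrow> 'b \<Rightarrow> 'b set" where
  "component m B b = {b'. (b, b') \<in> (arrows m B \<union> (arrows m B)\<inverse>)\<^sup>*}"

text \<open>\<open>crystal_iso m B C B' C' \<psi>\<close>: \<open>\<psi>\<close> is an isomorphism from the full subgraph of \<open>B\<close> on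
  \<open>C\<close> onto the full subgraph of \<open>B'\<close> on \<open>C'\<close>.\<close>

definition crystal_iso ::
  "nat \<Rightarrow> 'b crystal \<Rightarrow> 'b set \<Rightarrow> 'c crystal \<Rightarrow> 'c set \<Rightarrow> ('b \<Rightarrow> 'c) \<Rightarrow> bool" where
  "crystal_iso m B C B' C' \<psi> \<longleftrightarrow>
     bij_betw \<psi> C C' \<and>
     (\<forall>b\<in>C. wt B' (\<psi> b) = wt B b) \<and>
     (\<forall>i\<in>index_set m. \<forall>b\<in>C. eps B' i (\<psi> b) = eps B i b \<and> phi B' i (\<psi> b) = phi B i b) \<and>
     (\<forall>i\<in>index_set m. \<forall>b\<in>C. \<forall>b'\<in>C.
        f_op B i b = Some b' \<longleftrightarrow> f_op B' i (\<psi> b) = Some (\<psi> b'))"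

definition crystal_equiv :: "nat \<Rightarrow> 'b crystal \<Rightarrow> 'b \<Rightarrow> 'c crystal \<Rightarrow> 'c \<Rightarrow> bool" where
  "crystal_equiv m B b B' b' \<longleftrightarrow>
     b \<in> elts B \<and> b' \<in> elts B' \<and>
     (\<exists>\<psi>. crystal_iso m B (component m B b) B' (component m B' b') \<psi> \<and> \<psi> b = b')"


section \<open>The crystal of letters, tensor products, the crystal of words\<close>

definition letter_f :: "nat \<Rightarrow> rat \<Rightarrow> rat \<Rightarrow> rat option" where
  "letter_f m i b =
     (if \<exists>b'\<in>letters m. simple_root i = epsilon b - epsilon b'
      then Some (THE b'. b' \<in> letters m \<and> simple_root i = epsilon b - epsilon b') else None)"

definition letter_e :: "nat \<Rightarrow> rat \<Rightarrow> rat \<Rightarrow> rat option" where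
  "letter_e m i b' =
     (if \<exists>b\<in>letters m. simple_root i = epsilon b - epsilon b'
      then Some (THE b. b \<in> letters m \<and> simple_root i = epsilon b - epsilon b') else None)"

definition letter_crystal :: "nat \<Rightarrow> rat crystal" where
  "letter_crystal m =
     \<lparr> elts = letters m,
       wt = epsilon,
       eps = (\<lambda>i b. if letter_e m i b \<noteq> None then 1 else 0),
       phi = (\<lambda>i b. if letter_f m i b \<noteq> None then 1 else 0),
       e_op = letter_e m,
       f_op = letter_f m \<rparr>"

text \<open>For \<open>i \<ge> 0\<close>, the factor of $b_1\otimes b_2$ acted on, given the weights of $b_1$ and $b_2$.\<close>

definition acts_on_first :: "rat \<Rightarrow> weight \<Rightarrow> weight \<Rightarrow> bool" where
  "acts_on_first i \<mu>1 \<mu>2 \<longleftrightarrow>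
     (if i \<in> \<int> then form (simple_root i) \<mu>1 \<noteq> 0 else form (simple_root i) \<mu>2 = 0)"

definition tensor :: "'b crystal \<Rightarrow> 'c crystal \<Rightarrow> ('b \<times> 'c) crystal" where
  "tensor B1 B2 =
     \<lparr> elts = elts B1 \<times> elts B2,
       wt = (\<lambda>(b1, b2). wt B1 b1 + wt B2 b2),
       eps = (\<lambda>i (b1, b2).
         if i < 0 then nat (max (int (eps B1 i b1))
                                (int (eps B2 i b2) - form (simple_root i) (wt B1 b1)))
         else if acts_on_first i (wt B1 b1) (wt B2 b2) then eps B1 i b1 else eps B2 i b2),
       phi = (\<lambda>i (b1, b2).
         if i < 0 then nat (max (int (phi B1 i b1) + form (simple_root i) (wt B2 b2))
                                (int (phi B2 i b2)))
         else if acts_on_first i (wt B1 b1) (wt B2 b2) then phi B1 i b1 else phi B2 i b2),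
       e_op = (\<lambda>i (b1, b2).
         if (if i < 0 then phi B1 i b1 \<ge> eps B2 i b2
             else acts_on_first i (wt B1 b1) (wt B2 b2))
         then map_option (\<lambda>b. (b, b2)) (e_op B1 i b1)
         else map_option (\<lambda>b. (b1, b)) (e_op B2 i b2)),
       f_op = (\<lambda>i (b1, b2).
         if (if i < 0 then phi B1 i b1 > eps B2 i b2
             else acts_on_first i (wt B1 b1) (wt B2 b2))
         then map_option (\<lambda>b. (b, b2)) (f_op B1 i b1)
         else map_option (\<lambda>b. (b1, b)) (f_op B2 i b2)) \<rparr>"

text \<open>Words of length \<open>n\<close>, with $w_1\cdots w_n$ read as $w_1\otimes(w_2\otimes\cdots)$; the innermost
  factor is the trivial crystal on the empty word, which is a unit for the tensor product here.
  \<open>cons_crystal\<close> transports a structure on pairs along \<open>(a, v) \<mapsto> a # v\<close>.\<close>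

definition trivial_word_crystal :: "rat list crystal" where
  "trivial_word_crystal =
     \<lparr> elts = {[]}, wt = (\<lambda>_. 0), eps = (\<lambda>_ _. 0), phi = (\<lambda>_ _. 0),
       e_op = (\<lambda>_ _. None), f_op = (\<lambda>_ _. None) \<rparr>"

definition cons_crystal :: "(rat \<times> rat list) crystal \<Rightarrow> rat list crystal" where
  "cons_crystal B =
     \<lparr> elts = (\<lambda>(a, v). a # v) ` elts B,
       wt = (\<lambda>w. wt B (hd w, tl w)),
       eps = (\<lambda>i w. eps B i (hd w, tl w)),
       phi = (\<lambda>i w. phi B i (hd w, tl w)),
       e_op = (\<lambda>i w. map_option (\<lambda>(a, v). a # v) (e_op B i (hd w, tl w))),
       f_op = (\<lambda>i w. map_option (\<lambda>(a, v). a # v) (f_op B i (hd w, tl w))) \<rparr>"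

primrec words_of_length :: "nat \<Rightarrow> nat \<Rightarrow> rat list crystal" where
  "words_of_length m 0 = trivial_word_crystal"
| "words_of_length m (Suc n) = cons_crystal (tensor (letter_crystal m) (words_of_length m n))"

definition word_crystal :: "nat \<Rightarrow> rat list crystal" where
  "word_crystal m =
     \<lparr> elts = lists (letters m),
       wt = (\<lambda>w. wt (words_of_length m (length w)) w),
       eps = (\<lambda>i w. eps (words_of_length m (length w)) i w),
       phi = (\<lambda>i w. phi (words_of_length m (length w)) i w),
       e_op = (\<lambda>i w. e_op (words_of_length m (length w)) i w),
       f_op = (\<lambda>i w. f_op (words_of_length m (length w)) i w) \<rparr>"


section \<open>Shapes and semistandard tableaux\<close>

text \<open>A partition of length at most \<open>m\<close> is padded with zeros to a list of length exactly \<open>m\<close>.\<close>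

type_synonym shape = "nat list \<times> nat list"

definition shapes :: "nat \<Rightarrow> shape set" where
  "shapes m = {(lam, comp).
     length lam = m \<and> sorted_wrt (\<ge>) lam \<and> (\<forall>a\<in>set comp. a > 0) \<and>
     (comp \<noteq> [] \<and> m > 0 \<longrightarrow> lam ! (m - 1) \<noteq> 0)}"

text \<open>A node is a pair (row, column), both counted from \<open>0\<close>, rows from top to bottom. The rows of
  the body start in column \<open>0\<close>. So does the first row of the tail, which is row \<open>length lam\<close>; every
  further row of the tail starts in the last column of the row above it.\<close>

definition row_start :: "shape \<Rightarrow> nat \<Rightarrow> nat" where
  "row_start s r = (\<Sum>j < r - length (fst s). snd s ! j - 1)"

definition row_length :: "shape \<Rightarrow> nat \<Rightarrow> nat" where
  "row_length s r = (fst s @ snd s) ! r"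

definition num_rows :: "shape \<Rightarrow> nat" where
  "num_rows s = length (fst s) + length (snd s)"

definition diagram :: "shape \<Rightarrow> (nat \<times> nat) set" where
  "diagram s = {(r, c). r < num_rows s \<and> row_start s r \<le> c \<and> c < row_start s r + row_length s r}"

definition body :: "shape \<Rightarrow> (nat \<times> nat) set" where
  "body s = {(r, c) \<in> diagram s. r < length (fst s)}"

definition joint :: "shape \<Rightarrow> nat \<times> nat" where
  "joint s = (length (fst s), 0)"

definition tableaux :: "nat \<Rightarrow> shape \<Rightarrow> (nat \<times> nat \<Rightarrow> rat) set" where
  "tableaux m s = {T \<in> diagram s \<rightarrow>\<^sub>E letters m.
     (\<forall>r c c'. (r, c) \<in> diagram s \<and> (r, c') \<in> diagram s \<and> c < c' \<longrightarrow>
        T (r, c) \<le> T (r, c') \<and> (T (r, c) = T (r, c') \<longrightarrow> T (r, c) \<in> \<int>)) \<and>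
     (\<forall>r r' c. (r, c) \<in> diagram s \<and> (r', c) \<in> diagram s \<and> r < r' \<longrightarrow>
        T (r, c) \<le> T (r', c) \<and> (T (r, c) = T (r', c) \<longrightarrow> T (r, c) \<notin> \<int>)) \<and>
     (snd s \<noteq> [] \<and> T (joint s) \<in> \<int> \<and> T (joint s) > 0 \<longrightarrow>
        (\<forall>x\<in>body s. T x < T (joint s))) \<and>
     (snd s \<noteq> [] \<and> T (joint s) \<in> pos_half_odds \<longrightarrow>
        (\<forall>x\<in>body s. T x \<le> T (joint s)))}"

definition reading_word :: "shape \<Rightarrow> (nat \<times> nat \<Rightarrow> rat) \<Rightarrow> rat list" where
  "reading_word s T = concat (map
     (\<lambda>r. rev (map (\<lambda>c. T (r, c)) [row_start s r ..< row_start s r + row_length s r]))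
     [0 ..< num_rows s])"

text \<open>The crystal structure on \<open>tableaux m s\<close> obtained by identifying a tableau with its reading
  word. The reading words of a fixed shape are closed under the crystal operators of the words, so
  the last case below only arises when the operator gives \<open>None\<close>.\<close>

definition tableau_op ::
  "nat \<Rightarrow> shape \<Rightarrow> (rat list \<Rightarrow> rat list option) \<Rightarrow>
     (nat \<times> nat \<Rightarrow> rat) \<Rightarrow> (nat \<times> nat \<Rightarrow> rat) option" where
  "tableau_op m s op T =
     (if \<exists>T'\<in>tableaux m s. op (reading_word s T) = Some (reading_word s T')
      then Some (THE T'. T' \<in> tableaux m s \<and> op (reading_word s T) = Some (reading_word s T'))
      else None)"

definition tableau_crystal :: "nat \<Rightarrow> shape \<Rightarrow> (nat \<times> nat \<Rightarrow> rat) crystal" where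
  "tableau_crystal m s =
     \<lparr> elts = tableaux m s,
       wt = (\<lambda>T. wt (word_crystal m) (reading_word s T)),
       eps = (\<lambda>i T. eps (word_crystal m) i (reading_word s T)),
       phi = (\<lambda>i T. phi (word_crystal m) i (reading_word s T)),
       e_op = (\<lambda>i. tableau_op m s (e_op (word_crystal m) i)),
       f_op = (\<lambda>i. tableau_op m s (f_op (word_crystal m) i)) \<rparr>"


section \<open>Letters and words form crystals\<close>

lemma form_superset:
  assumes "finite S" "Poly_Mapping.keys \<mu> \<subseteq> S"
  shows "form \<mu> \<nu> =
    (\<Sum>b\<in>S. parity_sign b * Poly_Mapping.lookup \<mu> b * Poly_Mapping.lookup \<nu> b)"
  unfolding form_def
  by (rule sum.mono_neutral_left) (use assms in \<open>auto simp: in_keys_iff\<close>)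

lemma form_add_left: "form (\<mu> + \<mu>') \<nu> = form \<mu> \<nu> + form \<mu>' \<nu>"
  using form_superset[of "Poly_Mapping.keys \<mu> \<union> Poly_Mapping.keys \<mu>'" \<mu> \<nu>]
    form_superset[of "Poly_Mapping.keys \<mu> \<union> Poly_Mapping.keys \<mu>'" \<mu>' \<nu>]
    form_superset[of "Poly_Mapping.keys \<mu> \<union> Poly_Mapping.keys \<mu>'" "\<mu> + \<mu>'" \<nu>]
    Poly_Mapping.keys_add[of \<mu> \<mu>']
  by (simp add: lookup_add algebra_simps sum.distrib)

lemma form_commute: "form \<mu> \<nu> = form \<nu> \<mu>"
  using form_superset[of "Poly_Mapping.keys \<mu> \<union> Poly_Mapping.keys \<nu>" \<mu> \<nu>]
    form_superset[of "Poly_Mapping.keys \<mu> \<union> Poly_Mapping.keys \<nu>" \<nu> \<mu>]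
  by (simp add: mult.assoc mult.commute mult.left_commute)

lemma form_add_right: "form \<mu> (\<nu> + \<nu>') = form \<mu> \<nu> + form \<mu> \<nu>'"
  by (metis form_add_left form_commute)

lemma form_diff_left: "form (\<mu> - \<mu>') \<nu> = form \<mu> \<nu> - form \<mu>' \<nu>"
  using form_add_left[of "\<mu> - \<mu>'" \<mu>' \<nu>] by simp

lemma form_diff_right: "form \<mu> (\<nu> - \<nu>') = form \<mu> \<nu> - form \<mu> \<nu>'"
  by (metis form_diff_left form_commute)

lemma form_epsilon: "form (epsilon a) \<nu> = parity_sign a * Poly_Mapping.lookup \<nu> a"
  by (simp add: form_def epsilon_def)

lemma lookup_epsilon: "Poly_Mapping.lookup (epsilon a) b = (if a = b then 1 else 0)"
  by (simp add: epsilon_def lookup_single when_def)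

lemma epsilon_diff_eq_iff:
  assumes "a \<noteq> b"
  shows "epsilon a - epsilon b = epsilon c - epsilon d \<longleftrightarrow> c = a \<and> d = b"
proof
  assume *: "epsilon a - epsilon b = epsilon c - epsilon d"
  have "Poly_Mapping.lookup (epsilon a - epsilon b) x = Poly_Mapping.lookup (epsilon c - epsilon d) x" for x
    by (simp add: *)
  from this[of a] this[of b] show "c = a \<and> d = b"
    using assms by (auto simp: lookup_minus lookup_epsilon split: if_splits)
qed auto

lemma half_notin_Ints: "1/2 + of_int k \<notin> (\<int> :: rat set)"
proof
  assume "1/2 + of_int k \<in> (\<int> :: rat set)"
  then obtain j where "1/2 + of_int k = (of_int j :: rat)" by (auto elim: Ints_cases)
  then have "(1::rat) = of_int (2 * j - 2 * k)" by simp
  then have "1 = 2 * j - 2 * k" by (metis of_int_1 of_int_eq_iff)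
  then show False by presburger
qed

lemma half_shift: "x + 1/2 \<in> \<int> \<longleftrightarrow> x \<notin> \<int>" if "2 * x \<in> \<int>" for x :: rat
proof -
  from that obtain k where k: "2 * x = of_int k" by (auto elim: Ints_cases)
  show ?thesis
  proof (cases "even k")
    case True
    then obtain j where "k = 2 * j" by auto
    with k have "x = of_int j" by simp
    then show ?thesis using half_notin_Ints[of j] by (simp add: add.commute)
  next
    case False
    then obtain j where "k = 2 * j + 1" by (auto elim: oddE)
    with k have x: "x = 1/2 + of_int j" by simp
    then have "x + 1/2 = of_int (j + 1)" by simp
    then have "x + 1/2 \<in> \<int>" by (metis Ints_of_int)
    then show ?thesis using half_notin_Ints[of j] x by simp
  qed
qed

lemma of_nat_half_in_letters:
  assumes "k \<ge> 1" shows "of_nat k / 2 \<in> letters m"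
proof (cases "even k")
  case True
  then obtain j where "k = 2 * j" by auto
  then show ?thesis using assms unfolding letters_def by auto
next
  case False
  then obtain j where "k = 2 * j + 1" by (auto elim: oddE)
  then have "(of_nat k / 2 :: rat) = 1/2 + of_nat j" by (simp add: field_simps)
  then show ?thesis unfolding letters_def pos_half_odds_def by blast
qed

lemma simple_root_cases:
  assumes "i \<in> index_set m"
  obtains a b where "a \<in> letters m" "b \<in> letters m" "a \<noteq> b"
    "simple_root i = epsilon a - epsilon b"
    "i < 0 \<Longrightarrow> parity_sign a = 1 \<and> parity_sign b = 1"
    "i \<ge> 0 \<Longrightarrow> parity_sign b = - parity_sign a"
proof -
  consider (neg) k where "i = of_int k" "- int m + 1 \<le> k" "k \<le> -1"
    | (zero) "i = 0" "m \<ge> 1" | (pos) k where "i = of_nat k / 2" "k \<ge> (1::nat)"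
    using assms unfolding index_set_def by (auto split: if_splits)
  then show thesis
  proof cases
    case neg
    have "i - 1 = - of_nat (nat (1 - k))" "i = - of_nat (nat (- k))" using neg by simp_all
    moreover have "1 \<le> nat (1 - k)" "nat (1 - k) \<le> m" "1 \<le> nat (- k)" "nat (- k) \<le> m"
      using neg by linarith+
    ultimately have "i - 1 \<in> letters m" "i \<in> letters m" unfolding letters_def by blast+
    moreover have "i < 0" "i \<in> \<int>" "i - 1 \<in> \<int>" using neg by auto
    ultimately show ?thesis
      using that[of "i - 1" i] by (simp add: simple_root_def parity_sign_def)
  next
    case zero
    have "-1 \<in> letters m" using zero unfolding letters_def by force
    moreover have "1/2 \<in> letters m" using of_nat_half_in_letters[of 1] by simp
    moreover have "1/2 \<notin> (\<int> :: rat set)" using half_notin_Ints[of 0] by simp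
    ultimately show ?thesis using that[of "-1" "1/2"] zero
      by (simp add: simple_root_def parity_sign_def)
  next
    case pos
    have i: "i > 0" using pos by simp
    have "i \<in> letters m" unfolding pos by (rule of_nat_half_in_letters) (use pos in simp)
    moreover have "i + 1/2 = of_nat (k + 1) / 2" using pos by (simp add: field_simps)
    then have "i + 1/2 \<in> letters m" using of_nat_half_in_letters[of "k + 1" m] by (metis le_add2)
    moreover have "2 * i = of_nat k" using pos by simp
    then have "2 * i \<in> \<int>" by (metis Ints_of_nat)
    ultimately show ?thesis using that[of i "i + 1/2"] i half_shift[of i]
      by (simp add: simple_root_def parity_sign_def)
  qed
qed

lemma isotropic_iff:
  assumes "i \<in> index_set m" shows "isotropic i \<longleftrightarrow> i \<ge> 0"
proof -
  obtain a b where "a \<noteq> b" "simple_root i = epsilon a - epsilon b"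
    "i < 0 \<Longrightarrow> parity_sign a = 1 \<and> parity_sign b = 1"
    "i \<ge> 0 \<Longrightarrow> parity_sign b = - parity_sign a"
    using simple_root_cases[OF assms] by metis
  then show ?thesis
    by (cases "i < 0")
      (auto simp: isotropic_def form_diff_left form_epsilon lookup_minus lookup_epsilon)
qed

lemma form_simple_root_self:
  assumes "i \<in> index_set m"
  shows "form (simple_root i) (simple_root i) = (if i < 0 then 2 else 0)"
proof -
  obtain a b where "a \<noteq> b" "simple_root i = epsilon a - epsilon b"
    "i < 0 \<Longrightarrow> parity_sign a = 1 \<and> parity_sign b = 1"
    "i \<ge> 0 \<Longrightarrow> parity_sign b = - parity_sign a"
    using simple_root_cases[OF assms] by metis
  then show ?thesis
    by (cases "i < 0")
      (auto simp: form_diff_left form_epsilon lookup_minus lookup_epsilon)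
qed

lemma letter_ops:
  assumes "a \<in> letters m" "c \<in> letters m" "a \<noteq> c" "simple_root i = epsilon a - epsilon c"
  shows "letter_f m i x = (if x = a then Some c else None)"
    and "letter_e m i x = (if x = c then Some a else None)"
  using assms by (auto simp: letter_f_def letter_e_def epsilon_diff_eq_iff intro!: the_equality)

lemma is_crystal_letter_crystal: "is_crystal m (letter_crystal m)"
  unfolding is_crystal_def
proof (intro conjI ballI)
  fix i b assume i: "i \<in> index_set m" and b: "b \<in> elts (letter_crystal m)"
  obtain a c where ac: "a \<in> letters m" "c \<in> letters m" "a \<noteq> c"
    and r: "simple_root i = epsilon a - epsilon c"
    and p: "i < 0 \<Longrightarrow> parity_sign a = 1 \<and> parity_sign c = 1"
      "i \<ge> 0 \<Longrightarrow> parity_sign c = - parity_sign a"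
    using simple_root_cases[OF i] by metis
  note ops = letter_ops[OF ac r]
  have ps: "parity_sign x \<noteq> 0" for x by (auto simp: parity_sign_def)
  have w: "form (epsilon x) (simple_root i)
    = (if x = a then parity_sign a else if x = c then - parity_sign c else 0)" for x
    using ac by (auto simp: r form_epsilon lookup_minus lookup_epsilon)
  show "isotropic i \<longrightarrow> phi (letter_crystal m) i b + eps (letter_crystal m) i b =
      (if form (wt (letter_crystal m) b) (simple_root i) \<noteq> 0 then 1 else 0)"
    using ac by (simp add: letter_crystal_def ops w ps)
  show "\<not> isotropic i \<longrightarrow> int (phi (letter_crystal m) i b) - int (eps (letter_crystal m) i b) =
      form (wt (letter_crystal m) b) (simple_root i)"
    using ac p by (simp add: letter_crystal_def ops w ps isotropic_iff[OF i])
  show "\<forall>b'. e_op (letter_crystal m) i b = Some b' \<longrightarrow>  b' \<in> elts (letter_crystal m) \<and>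
      int (eps (letter_crystal m) i b') = int (eps (letter_crystal m) i b) - 1 \<and>
      phi (letter_crystal m) i b' = phi (letter_crystal m) i b + 1 \<and>
      wt (letter_crystal m) b' = wt (letter_crystal m) b + simple_root i"
    using ac by (simp add: letter_crystal_def ops r)
  show "\<forall>b'. f_op (letter_crystal m) i b = Some b' \<longrightarrow> b' \<in> elts (letter_crystal m) \<and>
      eps (letter_crystal m) i b' = eps (letter_crystal m) i b + 1 \<and>
      int (phi (letter_crystal m) i b') = int (phi (letter_crystal m) i b) - 1 \<and>
      wt (letter_crystal m) b' = wt (letter_crystal m) b - simple_root i"
    using ac by (simp add: letter_crystal_def ops r)
  fix b' assume "b' \<in> elts (letter_crystal m)"
  show "f_op (letter_crystal m) i b = Some b' \<longleftrightarrow> e_op (letter_crystal m) i b' = Some b"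
    using ac by (auto simp: letter_crystal_def ops split: if_splits)
qed (auto simp: letter_crystal_def weight_lattice_def epsilon_def)

lemma is_crystalD:
  assumes "is_crystal m B" "i \<in> index_set m" "x \<in> elts B"
  shows "i \<ge> 0 \<longrightarrow>
      phi B i x + eps B i x = (if form (simple_root i) (wt B x) \<noteq> 0 then 1 else 0)"
    and "i < 0 \<longrightarrow> int (phi B i x) - int (eps B i x) = form (simple_root i) (wt B x)"
    and "e_op B i x = Some y \<Longrightarrow> y \<in> elts B \<and>
      int (eps B i y) = int (eps B i x) - 1 \<and> phi B i y = phi B i x + 1 \<and>
      wt B y = wt B x + simple_root i"
    and "f_op B i x = Some y \<Longrightarrow> y \<in> elts B \<and>
      eps B i y = eps B i x + 1 \<and> int (phi B i y) = int (phi B i x) - 1 \<and>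
      wt B y = wt B x - simple_root i"
    and "y \<in> elts B \<Longrightarrow> f_op B i x = Some y \<longleftrightarrow> e_op B i y = Some x"
proof -
  note C = assms(1)[unfolded is_crystal_def, THEN conjunct2, THEN bspec, OF assms(2), THEN bspec, OF assms(3)]
  note C = C[unfolded isotropic_iff[OF assms(2)] form_commute[of _ "simple_root i"]]
  show "i \<ge> 0 \<longrightarrow>
      phi B i x + eps B i x = (if form (simple_root i) (wt B x) \<noteq> 0 then 1 else 0)"
    using C by blast
  show "i < 0 \<longrightarrow> int (phi B i x) - int (eps B i x) = form (simple_root i) (wt B x)"
    using C unfolding not_le by blast
  show "e_op B i x = Some y \<Longrightarrow> y \<in> elts B \<and>
      int (eps B i y) = int (eps B i x) - 1 \<and> phi B i y = phi B i x + 1 \<and>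
      wt B y = wt B x + simple_root i"
    using C by blast
  show "f_op B i x = Some y \<Longrightarrow> y \<in> elts B \<and>
      eps B i y = eps B i x + 1 \<and> int (phi B i y) = int (phi B i x) - 1 \<and>
      wt B y = wt B x - simple_root i"
    using C by blast
  show "y \<in> elts B \<Longrightarrow> f_op B i x = Some y \<longleftrightarrow> e_op B i y = Some x"
    using C by blast
qed

definition nonneg_weights :: "'b crystal \<Rightarrow> bool" where
  "nonneg_weights B \<longleftrightarrow> (\<forall>b\<in>elts B. \<forall>x. Poly_Mapping.lookup (wt B b) x \<ge> 0)"

lemma is_crystal_tensor:
  assumes B1: "is_crystal m B1" and B2: "is_crystal m B2"
    and n1: "nonneg_weights B1" and n2: "nonneg_weights B2"
  shows "is_crystal m (tensor B1 B2)"
  unfolding is_crystal_def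
proof (intro conjI ballI)
  fix b assume "b \<in> elts (tensor B1 B2)"
  then obtain b1 b2 where b: "b = (b1, b2)" "b1 \<in> elts B1" "b2 \<in> elts B2"
    by (auto simp: tensor_def)
  have "Poly_Mapping.keys (wt B1 b1) \<subseteq> letters m" "Poly_Mapping.keys (wt B2 b2) \<subseteq> letters m"
    using B1 B2 b unfolding is_crystal_def weight_lattice_def by blast+
  then have "Poly_Mapping.keys (wt B1 b1 + wt B2 b2) \<subseteq> letters m"
    using Poly_Mapping.keys_add[of "wt B1 b1" "wt B2 b2"] by blast
  then show "wt (tensor B1 B2) b \<in> weight_lattice m"
    by (simp add: b tensor_def weight_lattice_def)
next
  fix i b assume i: "i \<in> index_set m" and "b \<in> elts (tensor B1 B2)"
  then obtain b1 b2 where b: "b = (b1, b2)" "b1 \<in> elts B1" "b2 \<in> elts B2"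
    by (auto simp: tensor_def)
  have self: "form (simple_root i) (simple_root i) = (if i < 0 then 2 else 0)"
    by (rule form_simple_root_self[OF i])
  note C1 = is_crystalD[OF B1 i] and C2 = is_crystalD[OF B2 i]
  have pos: "form (simple_root i) (wt B1 x) + form (simple_root i) (wt B2 y) = 0 \<longleftrightarrow>
      form (simple_root i) (wt B1 x) = 0 \<and> form (simple_root i) (wt B2 y) = 0"
    if "i \<ge> 0" "x \<in> elts B1" "y \<in> elts B2" for x y
  proof -
    obtain a c where r: "simple_root i = epsilon a - epsilon c"
      and p: "parity_sign c = - parity_sign a"
      by (rule simple_root_cases[OF i]) (use \<open>i \<ge> 0\<close> in blast)
    have f: "form (simple_root i) \<mu> =
        parity_sign a * (Poly_Mapping.lookup \<mu> a + Poly_Mapping.lookup \<mu> c)" for \<mu>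
      using p by (simp add: r form_diff_left form_epsilon algebra_simps)
    have "Poly_Mapping.lookup (wt B1 x) a \<ge> 0" "Poly_Mapping.lookup (wt B1 x) c \<ge> 0"
      "Poly_Mapping.lookup (wt B2 y) a \<ge> 0" "Poly_Mapping.lookup (wt B2 y) c \<ge> 0"
      using n1 n2 that by (auto simp: nonneg_weights_def)
    then show ?thesis unfolding f by (auto simp: parity_sign_def)
  qed
  note C1b = C1[of b1] and C2b = C2[of b2]
  note fm = form_add_right form_diff_right self
  show "isotropic i \<longrightarrow> phi (tensor B1 B2) i b + eps (tensor B1 B2) i b =
      (if form (wt (tensor B1 B2) b) (simple_root i) \<noteq> 0 then 1 else 0)"
    unfolding isotropic_iff[OF i] form_commute[of _ "simple_root i"]
    using C1b(1) C2b(1) b pos[of b1 b2]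
    by (auto simp: tensor_def fm acts_on_first_def split: if_splits)
  show "\<not> isotropic i \<longrightarrow> int (phi (tensor B1 B2) i b) - int (eps (tensor B1 B2) i b) =
      form (wt (tensor B1 B2) b) (simple_root i)"
    unfolding isotropic_iff[OF i] form_commute[of _ "simple_root i"]
    using C1b(2) C2b(2) b by (auto simp: tensor_def fm)
  show "\<forall>b'. e_op (tensor B1 B2) i b = Some b' \<longrightarrow> b' \<in> elts (tensor B1 B2) \<and>
      int (eps (tensor B1 B2) i b') = int (eps (tensor B1 B2) i b) - 1 \<and>
      phi (tensor B1 B2) i b' = phi (tensor B1 B2) i b + 1 \<and>
      wt (tensor B1 B2) b' = wt (tensor B1 B2) b + simple_root i"
  proof (intro allI impI)
    fix b' assume *: "e_op (tensor B1 B2) i b = Some b'"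
    let ?first = "if i < 0 then phi B1 i b1 \<ge> eps B2 i b2
      else acts_on_first i (wt B1 b1) (wt B2 b2)"
    show "b' \<in> elts (tensor B1 B2) \<and>
      int (eps (tensor B1 B2) i b') = int (eps (tensor B1 B2) i b) - 1 \<and>
      phi (tensor B1 B2) i b' = phi (tensor B1 B2) i b + 1 \<and>
      wt (tensor B1 B2) b' = wt (tensor B1 B2) b + simple_root i"
    proof (cases ?first)
      case True
      have "(if ?first then map_option (\<lambda>b. (b, b2)) (e_op B1 i b1)
          else map_option (\<lambda>b. (b1, b)) (e_op B2 i b2)) = Some b'"
        using * by (simp only: b tensor_def crystal.simps prod.case)
      then have "map_option (\<lambda>b. (b, b2)) (e_op B1 i b1) = Some b'"
        unfolding if_P[OF True] .
      then obtain y where y: "e_op B1 i b1 = Some y" "b' = (y, b2)" by auto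
      note L = C1(3)[OF b(2) y(1)]
      have F: "form (simple_root i) (wt B1 y) = form (simple_root i) (wt B1 b1) + (if i < 0 then 2 else 0)"
        using L by (simp add: fm)
      show ?thesis
        using L F True C1b(2)[OF b(2)] C2b(2)[OF b(3)]
        by (cases "i < 0") (simp_all add: y b tensor_def acts_on_first_def nat_eq_iff split: if_splits)
    next
      case False
      have "(if ?first then map_option (\<lambda>b. (b, b2)) (e_op B1 i b1)
          else map_option (\<lambda>b. (b1, b)) (e_op B2 i b2)) = Some b'"
        using * by (simp only: b tensor_def crystal.simps prod.case)
      then have "map_option (\<lambda>b. (b1, b)) (e_op B2 i b2) = Some b'"
        unfolding if_not_P[OF False] .
      then obtain y where y: "e_op B2 i b2 = Some y" "b' = (b1, y)" by auto
      note L = C2(3)[OF b(3) y(1)]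
      have F: "form (simple_root i) (wt B2 y) = form (simple_root i) (wt B2 b2) + (if i < 0 then 2 else 0)"
        using L by (simp add: fm)
      show ?thesis
        using L F False C1b(2)[OF b(2)] C2b(2)[OF b(3)]
        by (cases "i < 0") (simp_all add: y b tensor_def acts_on_first_def nat_eq_iff split: if_splits)
    qed
  qed
  show "\<forall>b'. f_op (tensor B1 B2) i b = Some b' \<longrightarrow> b' \<in> elts (tensor B1 B2) \<and>
      eps (tensor B1 B2) i b' = eps (tensor B1 B2) i b + 1 \<and>
      int (phi (tensor B1 B2) i b') = int (phi (tensor B1 B2) i b) - 1 \<and>
      wt (tensor B1 B2) b' = wt (tensor B1 B2) b - simple_root i"
  proof (intro allI impI)
    fix b' assume *: "f_op (tensor B1 B2) i b = Some b'"
    let ?first = "if i < 0 then phi B1 i b1 > eps B2 i b2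
      else acts_on_first i (wt B1 b1) (wt B2 b2)"
    show "b' \<in> elts (tensor B1 B2) \<and>
      eps (tensor B1 B2) i b' = eps (tensor B1 B2) i b + 1 \<and>
      int (phi (tensor B1 B2) i b') = int (phi (tensor B1 B2) i b) - 1 \<and>
      wt (tensor B1 B2) b' = wt (tensor B1 B2) b - simple_root i"
    proof (cases ?first)
      case True
      have "(if ?first then map_option (\<lambda>b. (b, b2)) (f_op B1 i b1)
          else map_option (\<lambda>b. (b1, b)) (f_op B2 i b2)) = Some b'"
        using * by (simp only: b tensor_def crystal.simps prod.case)
      then have "map_option (\<lambda>b. (b, b2)) (f_op B1 i b1) = Some b'"
        unfolding if_P[OF True] .
      then obtain y where y: "f_op B1 i b1 = Some y" "b' = (y, b2)" by auto
      note L = C1(4)[OF b(2) y(1)]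
      have F: "form (simple_root i) (wt B1 y) = form (simple_root i) (wt B1 b1) - (if i < 0 then 2 else 0)"
        using L by (simp add: fm)
      show ?thesis
        using L F True C1b(2)[OF b(2)] C2b(2)[OF b(3)]
        by (cases "i < 0") (simp_all add: y b tensor_def acts_on_first_def nat_eq_iff split: if_splits)
    next
      case False
      have "(if ?first then map_option (\<lambda>b. (b, b2)) (f_op B1 i b1)
          else map_option (\<lambda>b. (b1, b)) (f_op B2 i b2)) = Some b'"
        using * by (simp only: b tensor_def crystal.simps prod.case)
      then have "map_option (\<lambda>b. (b1, b)) (f_op B2 i b2) = Some b'"
        unfolding if_not_P[OF False] .
      then obtain y where y: "f_op B2 i b2 = Some y" "b' = (b1, y)" by auto
      note L = C2(4)[OF b(3) y(1)]
      have F: "form (simple_root i) (wt B2 y) = form (simple_root i) (wt B2 b2) - (if i < 0 then 2 else 0)"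
        using L by (simp add: fm)
      show ?thesis
        using L F False C1b(2)[OF b(2)] C2b(2)[OF b(3)]
        by (cases "i < 0") (simp_all add: y b tensor_def acts_on_first_def nat_eq_iff split: if_splits)
    qed
  qed
  fix b' assume "b' \<in> elts (tensor B1 B2)"
  then obtain b1' b2' where b': "b' = (b1', b2')" "b1' \<in> elts B1" "b2' \<in> elts B2"
    by (auto simp: tensor_def)
  have D1: "f_op B1 i b1 = Some b1' \<longleftrightarrow> e_op B1 i b1' = Some b1"
    and D2: "f_op B2 i b2 = Some b2' \<longleftrightarrow> e_op B2 i b2' = Some b2"
    using C1(5) C2(5) b b' by auto
  show "f_op (tensor B1 B2) i b = Some b' \<longleftrightarrow> e_op (tensor B1 B2) i b' = Some b"
  proof (cases "i < 0")
    case True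
    have "f_op (tensor B1 B2) i b = Some b' \<longleftrightarrow>
        (if phi B1 i b1 > eps B2 i b2 then b2' = b2 \<and> f_op B1 i b1 = Some b1'
         else b1' = b1 \<and> f_op B2 i b2 = Some b2')"
      using True b b' by (auto simp: tensor_def)
    moreover have "e_op (tensor B1 B2) i b' = Some b \<longleftrightarrow>
        (if phi B1 i b1' \<ge> eps B2 i b2' then b2' = b2 \<and> e_op B1 i b1' = Some b1
         else b1' = b1 \<and> e_op B2 i b2' = Some b2)"
      using True b b' by (auto simp: tensor_def)
    ultimately show ?thesis
      using D1 D2 C1(4)[of b1 b1'] C2(4)[of b2 b2'] b b' by (auto split: if_splits)
  next
    case False
    have "f_op (tensor B1 B2) i b = Some b' \<longleftrightarrow>
        (if acts_on_first i (wt B1 b1) (wt B2 b2) then b2' = b2 \<and> f_op B1 i b1 = Some b1'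
         else b1' = b1 \<and> f_op B2 i b2 = Some b2')"
      using False b b' by (auto simp: tensor_def)
    moreover have "e_op (tensor B1 B2) i b' = Some b \<longleftrightarrow>
        (if acts_on_first i (wt B1 b1') (wt B2 b2') then b2' = b2 \<and> e_op B1 i b1' = Some b1
         else b1' = b1 \<and> e_op B2 i b2' = Some b2)"
      using False b b' by (auto simp: tensor_def)
    moreover have "form (simple_root i) (wt B1 b1') = form (simple_root i) (wt B1 b1)"
      if "f_op B1 i b1 = Some b1'"
      using that C1(4)[of b1 b1'] b False by (auto simp: fm)
    moreover have "form (simple_root i) (wt B2 b2') = form (simple_root i) (wt B2 b2)"
      if "f_op B2 i b2 = Some b2'"
      using that C2(4)[of b2 b2'] b False by (auto simp: fm)
    ultimately show ?thesis
      using D1 D2 unfolding acts_on_first_def by (auto split: if_splits)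
  qed
qed

lemma is_crystal_cons_crystal:
  assumes "is_crystal m B" shows "is_crystal m (cons_crystal B)"
  unfolding is_crystal_def
proof (intro conjI ballI)
  fix w assume "w \<in> elts (cons_crystal B)"
  then obtain a v where w: "w = a # v" "(a, v) \<in> elts B"
    by (auto simp: cons_crystal_def)
  then show "wt (cons_crystal B) w \<in> weight_lattice m"
    using assms by (simp add: cons_crystal_def is_crystal_def)
next
  fix i w assume i: "i \<in> index_set m" and "w \<in> elts (cons_crystal B)"
  then obtain a v where w: "w = a # v" "(a, v) \<in> elts B"
    by (auto simp: cons_crystal_def)
  note L = is_crystalD[OF assms i w(2)]
  have img: "x # y \<in> (\<lambda>(a, v). a # v) ` S \<longleftrightarrow> (x, y) \<in> S"
    for x y and S :: "(rat \<times> rat list) set" by force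
  show "isotropic i \<longrightarrow> phi (cons_crystal B) i w + eps (cons_crystal B) i w =
      (if form (wt (cons_crystal B) w) (simple_root i) \<noteq> 0 then 1 else 0)"
    using L(1) by (simp add: w cons_crystal_def isotropic_iff[OF i] form_commute[of _ "simple_root i"])
  show "\<not> isotropic i \<longrightarrow> int (phi (cons_crystal B) i w) - int (eps (cons_crystal B) i w) =
      form (wt (cons_crystal B) w) (simple_root i)"
    using L(2) by (simp add: w cons_crystal_def isotropic_iff[OF i] form_commute[of _ "simple_root i"])
  show "\<forall>w'. e_op (cons_crystal B) i w = Some w' \<longrightarrow> w' \<in> elts (cons_crystal B) \<and>
      int (eps (cons_crystal B) i w') = int (eps (cons_crystal B) i w) - 1 \<and>
      phi (cons_crystal B) i w' = phi (cons_crystal B) i w + 1 \<and>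
      wt (cons_crystal B) w' = wt (cons_crystal B) w + simple_root i"
    using L(3) by (auto simp: w cons_crystal_def img)
  show "\<forall>w'. f_op (cons_crystal B) i w = Some w' \<longrightarrow> w' \<in> elts (cons_crystal B) \<and>
      eps (cons_crystal B) i w' = eps (cons_crystal B) i w + 1 \<and>
      int (phi (cons_crystal B) i w') = int (phi (cons_crystal B) i w) - 1 \<and>
      wt (cons_crystal B) w' = wt (cons_crystal B) w - simple_root i"
    using L(4) by (auto simp: w cons_crystal_def img)
  fix w' assume "w' \<in> elts (cons_crystal B)"
  then obtain a' v' where w': "w' = a' # v'" "(a', v') \<in> elts B"
    by (auto simp: cons_crystal_def)
  show "f_op (cons_crystal B) i w = Some w' \<longleftrightarrow> e_op (cons_crystal B) i w' = Some w"
    using L(5)[OF w'(2)] by (auto simp: w w' cons_crystal_def)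
qed

lemma words_of_length:
  "elts (words_of_length m n) = {w \<in> lists (letters m). length w = n} \<and>
   is_crystal m (words_of_length m n) \<and> nonneg_weights (words_of_length m n)"
proof (induction n)
  case 0
  show ?case
    by (auto simp: trivial_word_crystal_def is_crystal_def nonneg_weights_def weight_lattice_def
        form_def)
next
  case (Suc n)
  let ?W = "words_of_length m n"
  have l: "nonneg_weights (letter_crystal m)"
    by (simp add: nonneg_weights_def letter_crystal_def lookup_epsilon)
  have "elts (words_of_length m (Suc n)) = {w \<in> lists (letters m). length w = Suc n}"
    using Suc by (auto simp: cons_crystal_def tensor_def letter_crystal_def length_Suc_conv
        image_iff)
  moreover have "is_crystal m (words_of_length m (Suc n))"
    using Suc l is_crystal_letter_crystal by (simp add: is_crystal_cons_crystal is_crystal_tensor)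
  moreover have "nonneg_weights (words_of_length m (Suc n))"
    using Suc l by (auto simp: cons_crystal_def tensor_def nonneg_weights_def lookup_add)
  ultimately show ?case by blast
qed

theorem is_crystal_word_crystal: "is_crystal m (word_crystal m)"
proof -
  have el: "w \<in> elts (words_of_length m (length w))" if "w \<in> lists (letters m)" for w
    using words_of_length[of m "length w"] that by auto
  have W: "is_crystal m (words_of_length m n)" and
    E: "elts (words_of_length m n) = {w \<in> lists (letters m). length w = n}" for n
    using words_of_length by blast+
  have e: "w' \<in> lists (letters m) \<and> length w' = length w"
    if "w \<in> lists (letters m)" "i \<in> index_set m"
      "e_op (words_of_length m (length w)) i w = Some w'" for i w w'
    using W[of "length w"] el that E unfolding is_crystal_def by blast
  have f: "w' \<in> lists (letters m) \<and> length w' = length w"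
    if "w \<in> lists (letters m)" "i \<in> index_set m"
      "f_op (words_of_length m (length w)) i w = Some w'" for i w w'
    using W[of "length w"] el that E unfolding is_crystal_def by blast
  have *: "w \<in> lists (letters m) \<and> length w = n \<Longrightarrow> w \<in> elts (words_of_length m n)" for w n
    using E by auto
  show ?thesis
    unfolding is_crystal_def
  proof (intro conjI ballI)
    fix w assume "w \<in> elts (word_crystal m)"
    then show "wt (word_crystal m) w \<in> weight_lattice m"
      using W[of "length w"] el by (simp add: word_crystal_def is_crystal_def)
  next
    fix i w assume i: "i \<in> index_set m" and w': "w \<in> elts (word_crystal m)"
    then have w: "w \<in> lists (letters m)" by (simp add: word_crystal_def)
    note L = is_crystalD[OF W[of "length w"] i el[OF w]]
    show "isotropic i \<longrightarrow> phi (word_crystal m) i w + eps (word_crystal m) i w =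
        (if form (wt (word_crystal m) w) (simple_root i) \<noteq> 0 then 1 else 0)"
      using L(1,2) by (simp add: word_crystal_def isotropic_iff[OF i] form_commute[of _ "simple_root i"])
    show "\<not> isotropic i \<longrightarrow> int (phi (word_crystal m) i w) - int (eps (word_crystal m) i w) =
        form (wt (word_crystal m) w) (simple_root i)"
      using L(1,2) by (simp add: word_crystal_def isotropic_iff[OF i] form_commute[of _ "simple_root i"])
    show "\<forall>w'. e_op (word_crystal m) i w = Some w' \<longrightarrow> w' \<in> elts (word_crystal m) \<and>
        int (eps (word_crystal m) i w') = int (eps (word_crystal m) i w) - 1 \<and>
        phi (word_crystal m) i w' = phi (word_crystal m) i w + 1 \<and>
        wt (word_crystal m) w' = wt (word_crystal m) w + simple_root i"
      using L(3) e[OF w i] by (auto simp: word_crystal_def)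
    show "\<forall>w'. f_op (word_crystal m) i w = Some w' \<longrightarrow> w' \<in> elts (word_crystal m) \<and>
        eps (word_crystal m) i w' = eps (word_crystal m) i w + 1 \<and>
        int (phi (word_crystal m) i w') = int (phi (word_crystal m) i w) - 1 \<and>
        wt (word_crystal m) w' = wt (word_crystal m) w - simple_root i"
      using L(4) f[OF w i] by (auto simp: word_crystal_def)
    fix v assume "v \<in> elts (word_crystal m)"
    then have v: "v \<in> lists (letters m)" by (simp add: word_crystal_def)
    show "f_op (word_crystal m) i w = Some v \<longleftrightarrow> e_op (word_crystal m) i v = Some w"
    proof (cases "length v = length w")
      case True
      then show ?thesis using L(5) *[of v "length w"] v by (auto simp: word_crystal_def)
    next
      case False
      then show ?thesis using e[OF v i, of w] f[OF w i, of v] by (auto simp: word_crystal_def)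
    qed
  qed
qed

end

theory Submission
  imports Defs "HOL-Library.Multiset"
begin

text \<open>Standardize a word so that equal even letters increase from right to left and equal odd letters
  from left to right. The isotropic operators preserve the standardization, and the others are the
  usual $\mathfrak{gl}_m$-operators on the negative letters. Hence Knuth moves are crystal
  isomorphisms, and row insertion makes every word equivalent to the reading word of a semistandard
  tableau of partition shape. If this tableau has more than $m$ rows, take the entries from its
  first entry in row $m+1$ onwards, in the order of the standardization. The isotropic operators see
  of their positions only whether consecutive entries ascend or descend, so these entries can be
  moved to a ribbon, which becomes the tail.

  For uniqueness, apply raising operators as long as possible. In the resulting tableau row $r$ of
  the body is constant and each row of the tail is an odd letter followed by even ones; since the
  tail is sorted along the ribbon, the weight determines the shape and the tableau.\<close>

section \<open>Letters and simple roots\<close>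

text \<open>The tail can start in row \<open>m\<close>, counted from 0, because m strictly
  increasing entries of a column exhaust the m negative letters: from that row on all entries are
  positive and the operators with \<open>i < 0\<close> never reach them. These operators are also
  the obstacle. They do not preserve the standardization, only the comparisons that a tableau
  demands; hence cells are compared by one order \<open>rk\<close>, which the isotropic operators
  keep on all pairs and the others on linked pairs. The components themselves are never described.
  Equivalence comes from one-to-one relations that are closed under all operators
  (\<open>bisim\<close>): these compose, are compatible with concatenation, and can be written down
  explicitly, as the graph of a Knuth move or of a fixed permutation of cells. For uniqueness it
  matters that a word has no image under \<open>e_op\<close> exactly when its \<open>eps\<close> is
  0. The axioms do not give this; through it the function \<open>eps\<close>, which isomorphisms
  preserve, detects highest weight elements.\<close>

text \<open>The operator $f_i$ turns a letter \<open>src i\<close> into \<open>tgt i\<close>.\<close>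

definition src :: "rat \<Rightarrow> rat" where
  "src i = (if i < 0 then i - 1 else if i = 0 then -1 else i)"

definition tgt :: "rat \<Rightarrow> rat" where
  "tgt i = (if i < 0 then i else i + 1/2)"

text \<open>Integer parameters k and k + 1/2 replace the three families over the natural numbers, so
  that comparisons of letters reduce to integers through \<open>int_gap\<close>.\<close>

lemma letters_iff:
  "x \<in> letters m \<longleftrightarrow>
    (\<exists>k::int. x = of_int k \<and> k \<noteq> 0 \<and> k \<ge> - int m) \<or> (\<exists>k::int. x = of_int k + 1/2 \<and> k \<ge> 0)"
proof
  assume "x \<in> letters m"
  then consider k where "x = - of_nat k" "1 \<le> k" "k \<le> m" | k where "x = of_nat k" "1 \<le> k"
    | k where "x = 1/2 + of_nat k"
    unfolding letters_def pos_half_odds_def by auto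
  then show "(\<exists>k::int. x = of_int k \<and> k \<noteq> 0 \<and> k \<ge> - int m) \<or> (\<exists>k::int. x = of_int k + 1/2 \<and> k \<ge> 0)"
  proof cases
    case (1 k) then show ?thesis by (intro disjI1 exI[of _ "- int k"]) auto
  next
    case (2 k) then show ?thesis by (intro disjI1 exI[of _ "int k"]) auto
  next
    case (3 k) then show ?thesis by (intro disjI2 exI[of _ "int k"]) auto
  qed
next
  assume "(\<exists>k::int. x = of_int k \<and> k \<noteq> 0 \<and> k \<ge> - int m) \<or> (\<exists>k::int. x = of_int k + 1/2 \<and> k \<ge> 0)"
  then consider k::int where "x = of_int k" "k < 0" "k \<ge> - int m" | k::int where "x = of_int k" "k > 0"
    | k::int where "x = of_int k + 1/2" "k \<ge> 0"
    by (metis linorder_neqE_linordered_idom)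
  then show "x \<in> letters m"
  proof cases
    case (1 k)
    then have "x = - of_nat (nat (- k))" "1 \<le> nat (- k)" "nat (- k) \<le> m" by auto
    then show ?thesis unfolding letters_def by blast
  next
    case (2 k)
    then have "x = of_nat (nat k)" "1 \<le> nat k" by auto
    then show ?thesis unfolding letters_def by blast
  next
    case (3 k)
    then have "x = 1/2 + of_nat (nat k)" by auto
    then show ?thesis unfolding letters_def pos_half_odds_def by blast
  qed
qed

lemma index_set_iff:
  "i \<in> index_set m \<longleftrightarrow>
    (\<exists>k::int. i = of_int k \<and> k \<ge> 1 - int m) \<or> (\<exists>k::int. i = of_int k + 1/2 \<and> k \<ge> 0)"
proof
  assume "i \<in> index_set m"
  then consider k where "i = of_int k" "- int m + 1 \<le> k" "k \<le> -1"
    | "i = 0" "m \<ge> 1" | k where "i = of_nat k / 2" "k \<ge> (1::nat)"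
    unfolding index_set_def by (auto split: if_splits)
  then show "(\<exists>k::int. i = of_int k \<and> k \<ge> 1 - int m) \<or> (\<exists>k::int. i = of_int k + 1/2 \<and> k \<ge> 0)"
  proof cases
    case (1 k) then show ?thesis by (intro disjI1 exI[of _ k]) auto
  next
    case 2 then show ?thesis by (intro disjI1 exI[of _ 0]) auto
  next
    case (3 k)
    show ?thesis
    proof (cases "even k")
      case True
      then obtain j where "k = 2 * j" by auto
      then show ?thesis using 3 by (intro disjI1 exI[of _ "int j"]) auto
    next
      case False
      then obtain j where "k = 2 * j + 1" by (auto elim: oddE)
      then show ?thesis using 3 by (intro disjI2 exI[of _ "int j"]) (auto simp: field_simps)
    qed
  qed
next
  assume "(\<exists>k::int. i = of_int k \<and> k \<ge> 1 - int m) \<or> (\<exists>k::int. i = of_int k + 1/2 \<and> k \<ge> 0)"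
  then consider k::int where "i = of_int k" "k \<ge> 1 - int m" "k < 0"
    | "i = 0" "m \<ge> 1" | k::int where "i = of_int k" "k > 0"
    | k::int where "i = of_int k + 1/2" "k \<ge> 0"
    by (metis linorder_neqE_linordered_idom of_int_0 diff_le_eq add_0 of_nat_1 of_nat_le_iff)
  then show "i \<in> index_set m"
  proof cases
    case (1 k)
    then have "- int m + 1 \<le> k" "k \<le> -1" by auto
    then show ?thesis using 1 unfolding index_set_def by blast
  next
    case 2 then show ?thesis unfolding index_set_def by auto
  next
    case (3 k)
    then have "i = of_nat (nat (2 * k)) / 2" "nat (2 * k) \<ge> 1" by auto
    then show ?thesis unfolding index_set_def by blast
  next
    case (4 k)
    then have "i = of_nat (nat (2 * k + 1)) / 2" "nat (2 * k + 1) \<ge> 1" by (auto simp: field_simps)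
    then show ?thesis unfolding index_set_def by blast
  qed
qed

lemma letter_half: "x \<in> letters m \<Longrightarrow> x \<notin> \<int> \<Longrightarrow> x > 0"
  unfolding letters_iff by auto

lemma half_letter_pred: "x \<in> letters m \<Longrightarrow> x - 1/2 \<in> \<int> \<longleftrightarrow> x \<notin> \<int>"
proof -
  assume "x \<in> letters m"
  then have "2 * (x - 1/2) \<in> \<int>" unfolding letters_iff
    by (auto simp: algebra_simps)
  from half_shift[OF this] show ?thesis unfolding diff_add_cancel by blast
qed

lemma int_gap:
  fixes j k :: int
  shows "(of_int j :: rat) < of_int k + 1/2 \<longleftrightarrow> j \<le> k"
    and "of_int k + 1/2 < (of_int j :: rat) \<longleftrightarrow> k < j"
    and "(of_int j :: rat) \<le> of_int k + 1/2 \<longleftrightarrow> j \<le> k"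
    and "of_int k + 1/2 \<le> (of_int j :: rat) \<longleftrightarrow> k < j"
    and "(of_int j :: rat) = of_int k + 1/2 \<longleftrightarrow> False"
proof -
  have A: "(of_int j :: rat) < of_int k + 1/2" if "j \<le> k"
    using that of_int_le_iff[of j k, where 'a=rat] by linarith
  have B: "of_int k + 1/2 < (of_int j :: rat)" if "k < j"
    using that of_int_le_iff[of "k+1" j, where 'a=rat] by simp
  show "(of_int j :: rat) < of_int k + 1/2 \<longleftrightarrow> j \<le> k"
    "of_int k + 1/2 < (of_int j :: rat) \<longleftrightarrow> k < j"
    "(of_int j :: rat) \<le> of_int k + 1/2 \<longleftrightarrow> j \<le> k"
    "of_int k + 1/2 \<le> (of_int j :: rat) \<longleftrightarrow> k < j"
    "(of_int j :: rat) = of_int k + 1/2 \<longleftrightarrow> False"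
    using A B by (cases "j \<le> k"; force)+
qed

lemma int_letter: "of_int k \<in> letters m \<longleftrightarrow> k \<noteq> 0 \<and> k \<ge> - int m"
  unfolding letters_iff by (simp add: int_gap)

lemma half_letter: "of_int k + 1/2 \<in> letters m \<longleftrightarrow> k \<ge> 0"
  unfolding letters_iff by (metis (no_types) add_right_cancel int_gap(5) of_int_eq_iff)

text \<open>By \<open>letter_gap\<close> the two letters are neighbours among all letters, so
  exchanging one for the other affects only comparisons with entries equal to one of them. For
  \<open>i < 0\<close> both are even; for \<open>i \<ge> 0\<close> exactly one is, and which one
  depends on whether i is an integer.\<close>

lemma src_tgt:
  assumes "i \<in> index_set m"
  shows src_letter: "src i \<in> letters m" and tgt_letter: "tgt i \<in> letters m"
    and src_less_tgt: "src i < tgt i"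
    and simple_root_src_tgt: "simple_root i = epsilon (src i) - epsilon (tgt i)"
    and letter_gap: "\<And>x. x \<in> letters m \<Longrightarrow> x \<le> src i \<or> tgt i \<le> x"
    and src_parity: "src i \<in> \<int> \<longleftrightarrow> i \<in> \<int>"
    and tgt_parity: "tgt i \<in> \<int> \<longleftrightarrow> i < 0 \<or> i \<notin> \<int>"
    and neg_index_Ints: "i < 0 \<Longrightarrow> i \<in> \<int>"
proof -
  note ii = assms[unfolded index_set_iff]
  have hi: "2 * i \<in> \<int>" using ii by (auto simp: algebra_simps)
  show "src i \<in> \<int> \<longleftrightarrow> i \<in> \<int>" using ii by (auto simp: src_def)
  show "tgt i \<in> \<int> \<longleftrightarrow> i < 0 \<or> i \<notin> \<int>"
    using half_shift[OF hi] ii by (auto simp: tgt_def)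
  show "i < 0 \<Longrightarrow> i \<in> \<int>" using ii by auto
  show "src i < tgt i" by (auto simp: src_def tgt_def)
  show "simple_root i = epsilon (src i) - epsilon (tgt i)"
    by (simp add: simple_root_def src_def tgt_def)
  consider (neg) k where "i = of_int k" "k \<ge> 1 - int m" "k < 0" | (zero) "i = 0" "m \<ge> 1"
    | (pos) k where "i = of_int k" "k > 0" | (half) k where "i = of_int k + 1/2" "k \<ge> 0"
    using ii by (metis linorder_neqE_linordered_idom of_int_0 diff_le_eq add_0 of_nat_1 of_nat_le_iff)
  then have "src i \<in> letters m \<and> tgt i \<in> letters m \<and> (\<forall>x\<in>letters m. x \<le> src i \<or> tgt i \<le> x)"
  proof cases
    case (neg k)
    have s: "src i = of_int (k - 1)" "tgt i = of_int k" using neg by (auto simp: src_def tgt_def)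
    have "x \<le> src i \<or> tgt i \<le> x" if "x \<in> letters m" for x
      using that neg unfolding letters_iff s by (auto simp: int_gap simp del: of_int_diff)
    moreover have "src i \<in> letters m" "tgt i \<in> letters m"
      using neg unfolding s half_letter int_letter by simp+
    ultimately show ?thesis by blast
  next
    case zero
    have s: "src i = of_int (-1)" "tgt i = of_int 0 + 1/2" using zero by (auto simp: src_def tgt_def)
    have "x \<le> src i \<or> tgt i \<le> x" if "x \<in> letters m" for x
      using that zero unfolding letters_iff s by (auto simp: int_gap simp del: of_int_minus of_int_0 of_int_1)
    moreover have "src i \<in> letters m"
      using zero unfolding s half_letter int_letter by simp
    moreover have "tgt i \<in> letters m"
      using zero unfolding s half_letter int_letter by simp
    ultimately show ?thesis by blast
  next
    case (pos k)
    have s: "src i = of_int k" "tgt i = of_int k + 1/2" using pos by (auto simp: src_def tgt_def)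
    have "x \<le> src i \<or> tgt i \<le> x" if "x \<in> letters m" for x
      using that pos unfolding letters_iff s by (auto simp: int_gap)
    moreover have "src i \<in> letters m"
      using pos unfolding s half_letter int_letter by simp
    moreover have "tgt i \<in> letters m"
      using pos unfolding s half_letter int_letter by simp
    ultimately show ?thesis by blast
  next
    case (half k)
    have s: "src i = of_int k + 1/2" "tgt i = of_int (k+1)" using half by (auto simp: src_def tgt_def)
    have "x \<le> src i \<or> tgt i \<le> x" if "x \<in> letters m" for x
      using that half unfolding letters_iff s by (auto simp: int_gap simp del: of_int_add)
    moreover have "src i \<in> letters m"
      using half unfolding s half_letter int_letter by simp
    moreover have "tgt i \<in> letters m"
      using half unfolding s half_letter int_letter by simp
    ultimately show ?thesis by blast
  qed
  then show "src i \<in> letters m" "tgt i \<in> letters m"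
    "\<And>x. x \<in> letters m \<Longrightarrow> x \<le> src i \<or> tgt i \<le> x" by auto
qed

text \<open>The letter 1/2 is excepted because it is the target of index 0, whose source -1 is a
  letter only for \<open>m \<ge> 1\<close>. Every other positive letter is reached from the one half
  a unit below.\<close>

lemma letter_ge_one:
  assumes "x \<in> letters m" "x > 0" "x \<noteq> 1/2"
  shows "x - 1/2 \<in> index_set m" "src (x - 1/2) = x - 1/2" "tgt (x - 1/2) = x"
    "x - 1/2 > 0" "x - 1/2 \<in> letters m"
proof -
  have "(\<exists>k::int. x = of_int k \<and> k > 0) \<or> (\<exists>k::int. x = of_int k + 1/2 \<and> k > 0)"
    using assms unfolding letters_iff by force
  then have x: "x > 1/2 \<and> x - 1/2 \<in> index_set m \<and> x - 1/2 \<in> letters m"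
  proof (elim disjE exE conjE)
    fix k :: int assume k: "x = of_int k" "k > 0"
    then have "x - 1/2 = of_int (k - 1) + 1/2" "k - 1 \<ge> 0" by auto
    then have "x - 1/2 \<in> index_set m \<and> x - 1/2 \<in> letters m" unfolding index_set_iff letters_iff by blast
    moreover have "x > 1/2" using k of_int_le_iff[of 1 k, where 'a=rat] by simp
    ultimately show ?thesis by blast
  next
    fix k :: int assume k: "x = of_int k + 1/2" "k > 0"
    then have "x - 1/2 = of_int k" "k \<noteq> 0" "k \<ge> - int m" "k \<ge> 1 - int m" by auto
    then have "x - 1/2 \<in> index_set m \<and> x - 1/2 \<in> letters m" unfolding index_set_iff letters_iff by blast
    moreover have "x > 1/2" using k by simp
    ultimately show ?thesis by blast
  qed
  then show "x - 1/2 \<in> index_set m" "x - 1/2 \<in> letters m" by auto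
  show "src (x - 1/2) = x - 1/2" "tgt (x - 1/2) = x" "x - 1/2 > 0"
    using x by (auto simp: src_def tgt_def)
qed

lemma neg_letter_index:
  assumes "x \<in> letters m" "x < 0" "x \<noteq> - of_nat m"
  shows "x \<in> index_set m" "src x = x - 1" "tgt x = x"
proof -
  obtain k :: int where k: "x = of_int k" "k \<ge> - int m"
    using assms unfolding letters_iff by auto
  then have "k \<noteq> - int m" using assms by auto
  then have "k \<ge> 1 - int m" using k by linarith
  then show "x \<in> index_set m" using k unfolding index_set_iff by blast
  show "src x = x - 1" "tgt x = x" using assms by (auto simp: src_def tgt_def)
qed


section \<open>Operators on words\<close>

lemma word_Nil [simp]:
  "wt (word_crystal m) [] = 0" "eps (word_crystal m) i [] = 0" "phi (word_crystal m) i [] = 0"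
  "e_op (word_crystal m) i [] = None" "f_op (word_crystal m) i [] = None"
  by (simp_all add: word_crystal_def trivial_word_crystal_def)

lemma wt_Cons [simp]: "wt (word_crystal m) (x # v) = epsilon x + wt (word_crystal m) v"
  by (simp add: word_crystal_def cons_crystal_def tensor_def letter_crystal_def)

lemma elts_word [simp]: "elts (word_crystal m) = lists (letters m)"
  by (simp add: word_crystal_def)

lemma lookup_wt: "Poly_Mapping.lookup (wt (word_crystal m) w) x = int (count_list w x)"
  by (induction w) (auto simp: lookup_add lookup_epsilon)

lemma count_list_wt: "wt (word_crystal m) v = wt (word_crystal m) w \<longleftrightarrow> mset v = mset w"
  by (auto simp: poly_mapping_eq_iff fun_eq_iff lookup_wt multiset_eq_iff count_mset)

lemma form_root:
  assumes "i \<in> index_set m"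
  shows "form (simple_root i) \<mu> =
    (if i < 0 then Poly_Mapping.lookup \<mu> (src i) - Poly_Mapping.lookup \<mu> (tgt i)
     else parity_sign (src i) * (Poly_Mapping.lookup \<mu> (src i) + Poly_Mapping.lookup \<mu> (tgt i)))"
  using src_parity[OF assms] tgt_parity[OF assms] neg_index_Ints[OF assms]
  by (auto simp: simple_root_src_tgt[OF assms] form_diff_left form_epsilon parity_sign_def algebra_simps)

text \<open>For \<open>i \<ge> 0\<close> the two letters have opposite parity, so they pair with the
  simple root with the same sign. Multiplicities in a word are nonnegative, hence nothing cancels,
  and the pairing of the weight with the root is nonzero exactly for these words
  (\<open>form_root_word\<close>).\<close>

definition touches :: "rat \<Rightarrow> rat list \<Rightarrow> bool" where
  "touches i w \<longleftrightarrow> src i \<in> set w \<or> tgt i \<in> set w"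

lemma touches_simps [simp]:
  "\<not> touches i []" "touches i (x # v) \<longleftrightarrow> x = src i \<or> x = tgt i \<or> touches i v"
  "touches i (u @ v) \<longleftrightarrow> touches i u \<or> touches i v"
  by (auto simp: touches_def)

lemma form_root_word:
  assumes "i \<in> index_set m" "i \<ge> 0"
  shows "form (simple_root i) (wt (word_crystal m) w) \<noteq> 0 \<longleftrightarrow> touches i w"
  using assms by (auto simp: form_root lookup_wt parity_sign_def touches_def count_list_0_iff add_nonneg_eq_0_iff)

context
  fixes i m assumes i: "i \<in> index_set m"
begin

lemma letter_ops_src_tgt: "letter_f m i x = (if x = src i then Some (tgt i) else None)"
  "letter_e m i x = (if x = tgt i then Some (src i) else None)"
  using letter_ops[OF src_letter[OF i] tgt_letter[OF i] _ simple_root_src_tgt[OF i]]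
    src_less_tgt[OF i] by auto

lemma form_root_letter:
  "form (simple_root i) (epsilon x) = (if x = src i then parity_sign (src i) else
      if x = tgt i then (if i < 0 then - 1 else parity_sign (src i)) else 0)"
  using src_less_tgt[OF i] src_parity[OF i] neg_index_Ints[OF i]
  by (auto simp: form_root[OF i] lookup_epsilon parity_sign_def)

lemma acts_on_first_word:
  assumes "i \<ge> 0"
  shows "acts_on_first i (epsilon x) (wt (word_crystal m) v) \<longleftrightarrow>
    (if i \<in> \<int> then x = src i \<or> x = tgt i else \<not> touches i v)"
  using form_root_word[OF i assms, of v] assms
  by (auto simp: acts_on_first_def form_root_letter parity_sign_def)

lemmas word_op_defs = word_crystal_def cons_crystal_def tensor_def letter_crystal_def letter_ops_src_tgt

text \<open>This is the bracket rule: with \<open>src i\<close> as opening and \<open>tgt i\<close>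
  as closing bracket, \<open>eps\<close> counts the unmatched closing and \<open>phi\<close> the
  unmatched opening ones. A new \<open>src i\<close> on the left cancels one unmatched
  \<open>tgt i\<close>; the subtraction of natural numbers covers the case that there is
  none.\<close>

lemma eps_Cons_neg:
  assumes "i < 0"
  shows "eps (word_crystal m) i (x # v) =
    (if x = src i then eps (word_crystal m) i v - 1
     else if x = tgt i then eps (word_crystal m) i v + 1 else eps (word_crystal m) i v)"
  using assms src_less_tgt[OF i] src_parity[OF i] neg_index_Ints[OF i]
  by (auto simp: word_op_defs form_root_letter parity_sign_def)

lemma phi_Cons_neg_raw:
  assumes "i < 0"
  shows "phi (word_crystal m) i (x # v) =
    nat (max ((if x = src i then 1 else 0) + int (count_list v (src i)) - int (count_list v (tgt i)))
      (int (phi (word_crystal m) i v)))"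
proof -
  have "phi (word_crystal m) i (x # v) = nat (max
      (int (if letter_f m i x \<noteq> None then 1 else 0) + form (simple_root i) (wt (word_crystal m) v))
      (int (phi (word_crystal m) i v)))"
    using assms by (simp add: word_crystal_def cons_crystal_def tensor_def letter_crystal_def)
  then show ?thesis using assms by (simp add: form_root[OF i] lookup_wt letter_ops_src_tgt algebra_simps)
qed

lemma phi_minus_eps:
  assumes "i < 0"
  shows "int (phi (word_crystal m) i w) - int (eps (word_crystal m) i w) =
    int (count_list w (src i)) - int (count_list w (tgt i))"
  using src_less_tgt[OF i]
  by (induction w) (auto simp: eps_Cons_neg[OF assms] phi_Cons_neg_raw[OF assms])

text \<open>By \<open>phi_minus_eps\<close> the first argument of the maximum in the tensor rule
  exceeds the second only if the new letter is \<open>src i\<close> and no unmatched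
  \<open>tgt i\<close> is left to cancel it.\<close>

lemma phi_Cons_neg:
  assumes "i < 0"
  shows "phi (word_crystal m) i (x # v) =
    (if x = src i \<and> eps (word_crystal m) i v = 0 then phi (word_crystal m) i v + 1
     else phi (word_crystal m) i v)"
  using phi_minus_eps[OF assms, of v] by (auto simp: phi_Cons_neg_raw[OF assms])

lemma f_Cons_neg:
  assumes "i < 0"
  shows "f_op (word_crystal m) i (x # v) =
    (if x = src i \<and> eps (word_crystal m) i v = 0 then Some (tgt i # v)
     else map_option ((#) x) (f_op (word_crystal m) i v))"
  using assms by (auto simp: word_op_defs option.map_comp o_def)

lemma e_Cons_neg:
  assumes "i < 0"
  shows "e_op (word_crystal m) i (x # v) =
    (if eps (word_crystal m) i v = 0 \<or> x = src i \<and> eps (word_crystal m) i v = 1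
     then if x = tgt i then Some (src i # v) else None
     else map_option ((#) x) (e_op (word_crystal m) i v))"
  using assms src_less_tgt[OF i] by (auto simp: word_op_defs option.map_comp o_def)

text \<open>A single letter is decisive: among the occurrences of \<open>src i\<close> and
  \<open>tgt i\<close> it is the leftmost one if i is an integer and the rightmost one otherwise. In
  particular \<open>eps\<close> and \<open>phi\<close> are at most 1.\<close>

lemma ops_Cons_nonneg:
  assumes "i \<ge> 0"
  shows "f_op (word_crystal m) i (x # v) =
      (if (if i \<in> \<int> then x = src i \<or> x = tgt i else \<not> touches i v)
       then if x = src i then Some (tgt i # v) else None
       else map_option ((#) x) (f_op (word_crystal m) i v))" (is ?f)
    and "e_op (word_crystal m) i (x # v) =
      (if (if i \<in> \<int> then x = src i \<or> x = tgt i else \<not> touches i v)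
       then if x = tgt i then Some (src i # v) else None
       else map_option ((#) x) (e_op (word_crystal m) i v))" (is ?e)
    and "phi (word_crystal m) i (x # v) =
      (if (if i \<in> \<int> then x = src i \<or> x = tgt i else \<not> touches i v)
       then if x = src i then 1 else 0 else phi (word_crystal m) i v)" (is ?phi)
    and "eps (word_crystal m) i (x # v) =
      (if (if i \<in> \<int> then x = src i \<or> x = tgt i else \<not> touches i v)
       then if x = tgt i then 1 else 0 else eps (word_crystal m) i v)" (is ?eps)
proof -
  let ?A = "acts_on_first i (epsilon x) (wt (word_crystal m) v)"
  have "f_op (word_crystal m) i (x # v) = (if ?A then map_option (\<lambda>b. b # v) (letter_f m i x)
      else map_option ((#) x) (f_op (word_crystal m) i v))"
    "e_op (word_crystal m) i (x # v) = (if ?A then map_option (\<lambda>b. b # v) (letter_e m i x)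
      else map_option ((#) x) (e_op (word_crystal m) i v))"
    "phi (word_crystal m) i (x # v) = (if ?A then if letter_f m i x \<noteq> None then 1 else 0
      else phi (word_crystal m) i v)"
    "eps (word_crystal m) i (x # v) = (if ?A then if letter_e m i x \<noteq> None then 1 else 0
      else eps (word_crystal m) i v)"
    using assms by (simp_all add: word_crystal_def cons_crystal_def tensor_def letter_crystal_def
        option.map_comp o_def)
  then show ?f ?e ?phi ?eps
    by (simp_all add: acts_on_first_word[OF assms] letter_ops_src_tgt)
qed

end

section \<open>Operators on concatenations and consequences of the crystal axioms\<close>

lemma map_option_append:
  "map_option ((@) []) z = z" "map_option ((@) (x # u)) z = map_option (\<lambda>y. x # u @ y) z"
  by (cases z; simp)+

context
  fixes i m assumes i: "i \<in> index_set m"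
begin

text \<open>The axioms only say that a defined \<open>e_op\<close> forces a positive
  \<open>eps\<close>. The converse is special to words and lets \<open>eps\<close> recognize the
  words that cannot be raised.\<close>

lemma eps_eq_0_iff: "eps (word_crystal m) i w = 0 \<longleftrightarrow> e_op (word_crystal m) i w = None"
proof (cases "i < 0")
  case True
  then show ?thesis using src_less_tgt[OF i]
    by (induction w) (auto simp: e_Cons_neg[OF i] eps_Cons_neg[OF i])
next
  case False
  then show ?thesis using src_less_tgt[OF i] by (induction w) (auto simp: ops_Cons_nonneg[OF i])
qed

lemma phi_eq_0_iff: "phi (word_crystal m) i w = 0 \<longleftrightarrow> f_op (word_crystal m) i w = None"
proof (cases "i < 0")
  case True
  then show ?thesis using src_less_tgt[OF i]
    by (induction w) (auto simp: f_Cons_neg[OF i] phi_Cons_neg[OF i])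
next
  case False
  then show ?thesis using src_less_tgt[OF i] by (induction w) (auto simp: ops_Cons_nonneg[OF i])
qed

text \<open>At the junction the unmatched opening brackets of \<open>u\<close> cancel against the
  unmatched closing brackets of \<open>v\<close>; the truncated difference is what survives on the
  right.\<close>

lemma eps_append_neg:
  assumes "i < 0"
  shows "eps (word_crystal m) i (u @ v) =
    eps (word_crystal m) i u + (eps (word_crystal m) i v - phi (word_crystal m) i u)"
  using src_less_tgt[OF i]
  by (induction u) (auto simp: eps_Cons_neg[OF i assms] phi_Cons_neg[OF i assms])

lemma phi_append_neg:
  assumes "i < 0"
  shows "phi (word_crystal m) i (u @ v) =
    phi (word_crystal m) i v + (phi (word_crystal m) i u - eps (word_crystal m) i v)"
  by (induction u) (auto simp: phi_Cons_neg[OF i assms] eps_append_neg[OF assms])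

lemma f_append_neg:
  assumes "i < 0"
  shows "f_op (word_crystal m) i (u @ v) =
    (if phi (word_crystal m) i u > eps (word_crystal m) i v
     then map_option (\<lambda>x. x @ v) (f_op (word_crystal m) i u)
     else map_option ((@) u) (f_op (word_crystal m) i v))"
  by (induction u) (auto simp: f_Cons_neg[OF i assms] phi_Cons_neg[OF i assms] eps_append_neg[OF assms]
      eps_eq_0_iff option.map_comp map_option_append o_def)

lemma e_append_neg:
  assumes "i < 0"
  shows "e_op (word_crystal m) i (u @ v) =
    (if phi (word_crystal m) i u \<ge> eps (word_crystal m) i v
     then map_option (\<lambda>x. x @ v) (e_op (word_crystal m) i u)
     else map_option ((@) u) (e_op (word_crystal m) i v))"
proof (induction u)
  case Nil
  show ?case using eps_eq_0_iff[of v] by (auto simp: map_option_append)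
next
  case (Cons x u)
  have "src i \<noteq> tgt i" using src_less_tgt[OF i] by simp
  then show ?case using Cons eps_eq_0_iff[of u] eps_eq_0_iff[of v]
    by (cases "e_op (word_crystal m) i u"; cases "e_op (word_crystal m) i v")
      (auto simp: e_Cons_neg[OF i assms] phi_Cons_neg[OF i assms] eps_append_neg[OF assms]
      option.map_comp map_option_append o_def)
qed

lemma ops_append_nonneg:
  assumes "i \<ge> 0"
  defines "A \<equiv> (\<lambda>u v. if i \<in> \<int> then touches i u else \<not> touches i v)"
  shows "f_op (word_crystal m) i (u @ v) =
      (if A u v then map_option (\<lambda>x. x @ v) (f_op (word_crystal m) i u)
       else map_option ((@) u) (f_op (word_crystal m) i v))"
    and "e_op (word_crystal m) i (u @ v) =
      (if A u v then map_option (\<lambda>x. x @ v) (e_op (word_crystal m) i u)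
       else map_option ((@) u) (e_op (word_crystal m) i v))"
    and "phi (word_crystal m) i (u @ v) =
      (if A u v then phi (word_crystal m) i u else phi (word_crystal m) i v)"
    and "eps (word_crystal m) i (u @ v) =
      (if A u v then eps (word_crystal m) i u else eps (word_crystal m) i v)"
proof -
  have *: "\<not> touches i v \<Longrightarrow> f_op (word_crystal m) i v = None \<and> e_op (word_crystal m) i v = None \<and>
      phi (word_crystal m) i v = 0 \<and> eps (word_crystal m) i v = 0" for v
    by (induction v) (auto simp: ops_Cons_nonneg[OF i assms(1)])
  show "f_op (word_crystal m) i (u @ v) =
      (if A u v then map_option (\<lambda>x. x @ v) (f_op (word_crystal m) i u)
       else map_option ((@) u) (f_op (word_crystal m) i v))"
    using * by (induction u) (auto simp: A_def ops_Cons_nonneg[OF i assms(1)] option.map_comp map_option_append o_def)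
  show "e_op (word_crystal m) i (u @ v) =
      (if A u v then map_option (\<lambda>x. x @ v) (e_op (word_crystal m) i u)
       else map_option ((@) u) (e_op (word_crystal m) i v))"
    using * by (induction u) (auto simp: A_def ops_Cons_nonneg[OF i assms(1)] option.map_comp map_option_append o_def)
  show "phi (word_crystal m) i (u @ v) =
      (if A u v then phi (word_crystal m) i u else phi (word_crystal m) i v)"
    using * by (induction u) (auto simp: A_def ops_Cons_nonneg[OF i assms(1)])
  show "eps (word_crystal m) i (u @ v) =
      (if A u v then eps (word_crystal m) i u else eps (word_crystal m) i v)"
    using * by (induction u) (auto simp: A_def ops_Cons_nonneg[OF i assms(1)])
qed

lemma e_iff_f:
  assumes "v \<in> lists (letters m)" "w \<in> lists (letters m)"
  shows "e_op (word_crystal m) i w = Some v \<longleftrightarrow> f_op (word_crystal m) i v = Some w"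
  using is_crystalD(5)[OF is_crystal_word_crystal i, of v w] assms by auto

lemma op_letters:
  assumes "w \<in> lists (letters m)"
  shows "f_op (word_crystal m) i w = Some v \<Longrightarrow> v \<in> lists (letters m)"
    and "e_op (word_crystal m) i w = Some v \<Longrightarrow> v \<in> lists (letters m)"
    and "f_op (word_crystal m) i w = Some v \<Longrightarrow> wt (word_crystal m) v = wt (word_crystal m) w - simple_root i"
    and "e_op (word_crystal m) i w = Some v \<Longrightarrow> wt (word_crystal m) v = wt (word_crystal m) w + simple_root i"
    and "e_op (word_crystal m) i w = Some v \<Longrightarrow> eps (word_crystal m) i w = eps (word_crystal m) i v + 1"
  using is_crystalD(3,4)[OF is_crystal_word_crystal i, of w v] assms by auto

lemma phi_eps_wt:
  assumes "w \<in> lists (letters m)" "w' \<in> lists (letters m)"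
    "wt (word_crystal m) w = wt (word_crystal m) w'"
  shows "i < 0 \<Longrightarrow> int (phi (word_crystal m) i w) - int (eps (word_crystal m) i w)
      = int (phi (word_crystal m) i w') - int (eps (word_crystal m) i w')"
    and "i \<ge> 0 \<Longrightarrow> phi (word_crystal m) i w + eps (word_crystal m) i w
      = phi (word_crystal m) i w' + eps (word_crystal m) i w'"
  using is_crystalD(1,2)[OF is_crystal_word_crystal i, of w] assms
    is_crystalD(1,2)[OF is_crystal_word_crystal i, of w'] by auto

end

text \<open>Together with \<open>clear_right\<close> this describes the surroundings of a letter on
  which the operators of index i act. The same surroundings serve $f_i$ and $e_i$; the letter itself
  decides which of them is defined. For \<open>i \<ge> 0\<close> one of the two conditions is
  vacuous, according to the parity of i.\<close>

definition clear_left :: "nat \<Rightarrow> rat \<Rightarrow> rat list \<Rightarrow> bool" where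
  "clear_left m i u \<longleftrightarrow>
    (if i < 0 then phi (word_crystal m) i u = 0 else i \<in> \<int> \<longrightarrow> \<not> touches i u)"

definition clear_right :: "nat \<Rightarrow> rat \<Rightarrow> rat list \<Rightarrow> bool" where
  "clear_right m i v \<longleftrightarrow>
    (if i < 0 then eps (word_crystal m) i v = 0 else i \<notin> \<int> \<longrightarrow> \<not> touches i v)"

context
  fixes i m assumes i: "i \<in> index_set m"
begin

text \<open>For \<open>i < 0\<close> the vanishing of \<open>eps\<close> on the right says that the
  chosen \<open>src i\<close> is unmatched, and that of \<open>phi\<close> on the left says that no
  earlier one is. This symmetric form avoids the recursion over the word in all later
  arguments.\<close>

lemma f_split:
  "f_op (word_crystal m) i w = Some w' \<longleftrightarrow>
    (\<exists>u v. w = u @ src i # v \<and> w' = u @ tgt i # v \<and> clear_left m i u \<and> clear_right m i v)"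
  (is "_ \<longleftrightarrow> (\<exists>u v. ?S w w' u v)")
proof
  show "f_op (word_crystal m) i w = Some w' \<Longrightarrow> \<exists>u v. ?S w w' u v"
  proof (induction w arbitrary: w')
    case (Cons x w)
    consider "?S (x # w) w' [] w"
      | w'' where "f_op (word_crystal m) i w = Some w''" "w' = x # w''"
        "i < 0 \<Longrightarrow> \<not> (x = src i \<and> eps (word_crystal m) i w = 0)"
        "i \<ge> 0 \<Longrightarrow> i \<in> \<int> \<Longrightarrow> x \<noteq> src i \<and> x \<noteq> tgt i"
      using Cons.prems
      by (cases "i < 0") (auto simp: f_Cons_neg[OF i] ops_Cons_nonneg[OF i] clear_left_def clear_right_def
          split: if_splits)
    then show ?case
    proof cases
      case 1 then show ?thesis by blast
    next
      case (2 w'')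
      from Cons.IH[OF 2(1)] obtain u v where uv: "?S w w'' u v" by blast
      then have "?S (x # w) w' (x # u) v" using 2(2-)
        by (auto simp: clear_left_def clear_right_def phi_Cons_neg[OF i] eps_append_neg[OF i] eps_Cons_neg[OF i])
      then show ?thesis by blast
    qed
  qed simp
next
  assume "\<exists>u v. ?S w w' u v"
  then obtain u v where uv: "w = u @ src i # v" "w' = u @ tgt i # v" "clear_left m i u" "clear_right m i v"
    by blast
  show "f_op (word_crystal m) i w = Some w'"
  proof (cases "i < 0")
    case True
    then show ?thesis using uv
      by (simp add: f_append_neg[OF i] f_Cons_neg[OF i] clear_left_def clear_right_def)
  next
    case False
    then show ?thesis using uv
      by (auto simp: ops_append_nonneg[OF i] ops_Cons_nonneg[OF i] clear_left_def clear_right_def)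
  qed
qed

lemma e_split:
  assumes w: "w \<in> lists (letters m)"
  shows "e_op (word_crystal m) i w = Some w' \<longleftrightarrow>
    (\<exists>u v. w = u @ tgt i # v \<and> w' = u @ src i # v \<and> clear_left m i u \<and> clear_right m i v)"
proof -
  have "e_op (word_crystal m) i w = Some w' \<longleftrightarrow>
    w' \<in> lists (letters m) \<and> f_op (word_crystal m) i w' = Some w"
    using e_iff_f[OF i _ w] op_letters(2)[OF i w] by blast
  then show ?thesis using w src_letter[OF i] unfolding f_split by auto
qed

lemma filter_neg:
  assumes "i < 0"
  shows "eps (word_crystal m) i (filter (\<lambda>x. x = src i \<or> x = tgt i) w) = eps (word_crystal m) i w"
    and "phi (word_crystal m) i (filter (\<lambda>x. x = src i \<or> x = tgt i) w) = phi (word_crystal m) i w"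
  by (induction w) (auto simp: eps_Cons_neg[OF i assms] phi_Cons_neg[OF i assms])

text \<open>Appending letters on the right never lowers \<open>eps\<close>, so it vanishes on each
  prefix: this is the ballot condition.\<close>

lemma eps_0_prefix:
  assumes "i < 0" "eps (word_crystal m) i (u @ v) = 0"
  shows "count_list u (tgt i) \<le> count_list u (src i)"
  using assms phi_minus_eps[OF i assms(1), of u] by (simp add: eps_append_neg[OF i])

lemma phi_0_suffix:
  assumes "i < 0" "phi (word_crystal m) i (u @ v) = 0"
  shows "count_list v (src i) \<le> count_list v (tgt i)"
  using assms phi_minus_eps[OF i assms(1), of v] by (simp add: phi_append_neg[OF i])

text \<open>For \<open>i < 0\<close> the ballot condition is applied to the prefix that ends with
  the given \<open>tgt i\<close>. For \<open>i \<ge> 0\<close> the decisive occurrence, the first or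
  the last one, must be \<open>src i\<close>, since otherwise $e_i$ would act on it.\<close>

lemma e_None_src:
  assumes w: "w \<in> lists (letters m)" "e_op (word_crystal m) i w = None" "w = u @ tgt i # v"
  shows "if i \<in> \<int> then src i \<in> set u else src i \<in> set v"
proof (cases "i < 0")
  case True
  then have "count_list (u @ [tgt i]) (tgt i) \<le> count_list (u @ [tgt i]) (src i)"
    using w eps_eq_0_iff[OF i, of w] by (intro eps_0_prefix[of _ v]) auto
  then have "count_list u (src i) \<noteq> 0" using src_less_tgt[OF i] by auto
  then show ?thesis using neg_index_Ints[OF i True] by (simp add: count_list_0_iff)
next
  case False
  let ?P = "\<lambda>x. x = src i \<or> x = tgt i"
  have ex: "\<exists>x\<in>set w. ?P x" using w by auto
  have no: "\<not> (w = u' @ tgt i # v' \<and> clear_left m i u' \<and> clear_right m i v')" for u' v'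
    using e_split[OF w(1)] w(2) by (metis option.distinct(1))
  show ?thesis
  proof (cases "i \<in> \<int>")
    case True
    from split_list_first_prop[OF ex] obtain u' x v' where s: "w = u' @ x # v'" "?P x" "\<forall>y\<in>set u'. \<not> ?P y"
      by blast
    then have x: "x = src i" using no[of u' v'] True False by (auto simp: clear_left_def clear_right_def touches_def)
    have "u @ tgt i # v = u' @ src i # v'" using w s x by simp
    then have "src i \<in> set u" using s(3) src_less_tgt[OF i]
      by (auto simp: append_eq_append_conv2 append_eq_Cons_conv Cons_eq_append_conv)
    then show ?thesis using True by simp
  next
    case iF: False
    from split_list_last_prop[OF ex] obtain u' x v' where s: "w = u' @ x # v'" "?P x" "\<forall>y\<in>set v'. \<not> ?P y"
      by blast
    then have x: "x = src i" using no[of u' v'] iF False by (auto simp: clear_left_def clear_right_def touches_def)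
    have "u @ tgt i # v = u' @ src i # v'" using w s x by simp
    then have "src i \<in> set v" using s(3) src_less_tgt[OF i]
      by (auto simp: append_eq_append_conv2 append_eq_Cons_conv Cons_eq_append_conv)
    then show ?thesis using iF by simp
  qed
qed

end

section \<open>Crystal equivalence from bisimulations\<close>

text \<open>A one-to-one relation that is closed under the operators restricts to an isomorphism
  between the components of any two related elements (\<open>bisim_crystal_equiv\<close>). It may
  relate elements of many components at once, so no component has to be determined.\<close>

definition bisim :: "nat \<Rightarrow> 'b crystal \<Rightarrow> 'c crystal \<Rightarrow> ('b \<times> 'c) set \<Rightarrow> bool" where
  "bisim m B B' R \<longleftrightarrow> R \<subseteq> elts B \<times> elts B' \<and>
     (\<forall>x y x' y'. (x, y) \<in> R \<longrightarrow> (x', y') \<in> R \<longrightarrow> (x = x' \<longleftrightarrow> y = y')) \<and>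
     (\<forall>x y. (x, y) \<in> R \<longrightarrow> wt B x = wt B' y \<and> (\<forall>i\<in>index_set m.
        eps B i x = eps B' i y \<and> phi B i x = phi B' i y \<and>
        (\<forall>x'. f_op B i x = Some x' \<longrightarrow> (\<exists>y'. f_op B' i y = Some y' \<and> (x', y') \<in> R)) \<and>
        (\<forall>y'. f_op B' i y = Some y' \<longrightarrow> (\<exists>x'. f_op B i x = Some x' \<and> (x', y') \<in> R)) \<and>
        (\<forall>x'. e_op B i x = Some x' \<longrightarrow> (\<exists>y'. e_op B' i y = Some y' \<and> (x', y') \<in> R)) \<and>
        (\<forall>y'. e_op B' i y = Some y' \<longrightarrow> (\<exists>x'. e_op B i x = Some x' \<and> (x', y') \<in> R))))"

text \<open>This isolates the axiom by which an arrow followed backwards is a step of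
  \<open>e_op\<close>, as happens on paths inside a component. For the tableau crystal it is then
  the only axiom to be verified.\<close>

definition ef_inverse :: "nat \<Rightarrow> 'b crystal \<Rightarrow> bool" where
  "ef_inverse m B \<longleftrightarrow> (\<forall>i\<in>index_set m. \<forall>b\<in>elts B. \<forall>b'\<in>elts B.
     f_op B i b = Some b' \<longleftrightarrow> e_op B i b' = Some b)"

lemma bisimD:
  assumes "bisim m B B' R" "(x, y) \<in> R"
  shows "x \<in> elts B" "y \<in> elts B'" "wt B x = wt B' y"
    and "(x', y') \<in> R \<Longrightarrow> x = x' \<longleftrightarrow> y = y'"
    and "i \<in> index_set m \<Longrightarrow> eps B i x = eps B' i y"
    and "i \<in> index_set m \<Longrightarrow> phi B i x = phi B' i y"
    and "i \<in> index_set m \<Longrightarrow> f_op B i x = Some x' \<Longrightarrow> \<exists>y'. f_op B' i y = Some y' \<and> (x', y') \<in> R"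
    and "i \<in> index_set m \<Longrightarrow> f_op B' i y = Some y' \<Longrightarrow> \<exists>x'. f_op B i x = Some x' \<and> (x', y') \<in> R"
    and "i \<in> index_set m \<Longrightarrow> e_op B i x = Some x' \<Longrightarrow> \<exists>y'. e_op B' i y = Some y' \<and> (x', y') \<in> R"
    and "i \<in> index_set m \<Longrightarrow> e_op B' i y = Some y' \<Longrightarrow> \<exists>x'. e_op B i x = Some x' \<and> (x', y') \<in> R"
proof -
  note L = assms(1)[unfolded bisim_def]
  note P = L[THEN conjunct2, THEN conjunct2, rule_format, OF assms(2)]
  show "x \<in> elts B" "y \<in> elts B'" using L assms(2) by auto
  show "wt B x = wt B' y" using P by blast
  show "(x', y') \<in> R \<Longrightarrow> x = x' \<longleftrightarrow> y = y'" using L assms(2) by blast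
  show "i \<in> index_set m \<Longrightarrow> eps B i x = eps B' i y"
    "i \<in> index_set m \<Longrightarrow> phi B i x = phi B' i y" using P by blast+
  show "i \<in> index_set m \<Longrightarrow> f_op B i x = Some x' \<Longrightarrow> \<exists>y'. f_op B' i y = Some y' \<and> (x', y') \<in> R"
    "i \<in> index_set m \<Longrightarrow> f_op B' i y = Some y' \<Longrightarrow> \<exists>x'. f_op B i x = Some x' \<and> (x', y') \<in> R"
    "i \<in> index_set m \<Longrightarrow> e_op B i x = Some x' \<Longrightarrow> \<exists>y'. e_op B' i y = Some y' \<and> (x', y') \<in> R"
    "i \<in> index_set m \<Longrightarrow> e_op B' i y = Some y' \<Longrightarrow> \<exists>x'. e_op B i x = Some x' \<and> (x', y') \<in> R"
    using P by blast+
qed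

lemma bisim_converse:
  assumes "bisim m B B' R" shows "bisim m B' B (R\<inverse>)"
  unfolding bisim_def[of _ _ _ "R\<inverse>"]
proof (intro conjI allI impI ballI)
  show "R\<inverse> \<subseteq> elts B' \<times> elts B" using bisimD(1,2)[OF assms] by auto
  show "x = x' \<longleftrightarrow> y = y'" if "(x, y) \<in> R\<inverse>" "(x', y') \<in> R\<inverse>" for x y x' y'
    using that bisimD(4)[OF assms] by blast
next
  fix x y assume "(x, y) \<in> R\<inverse>"
  then have r: "(y, x) \<in> R" by simp
  note D = bisimD[OF assms r]
  show "wt B' x = wt B y" using D(3) by simp
  fix i assume i: "i \<in> index_set m"
  show "eps B' i x = eps B i y" "phi B' i x = phi B i y" using D(5,6)[OF i] by simp_all
qed (use bisimD(7-10)[OF assms] in \<open>simp; blast\<close>)+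

lemma bisim_comp:
  assumes R: "bisim m B B' R" and S: "bisim m B' B'' S"
  shows "bisim m B B'' (R O S)"
  unfolding bisim_def[of _ _ _ "R O S"]
proof (intro conjI allI impI ballI)
  show "R O S \<subseteq> elts B \<times> elts B''" using bisimD(1,2)[OF R] bisimD(1,2)[OF S] by auto
  show "x = x' \<longleftrightarrow> y = y'" if "(x, y) \<in> R O S" "(x', y') \<in> R O S" for x y x' y'
    using that bisimD(4)[OF R] bisimD(4)[OF S] by (elim relcompE) (metis prod.inject)
next
  fix x y assume "(x, y) \<in> R O S"
  then obtain z where z: "(x, z) \<in> R" "(z, y) \<in> S" by blast
  note r = bisimD[OF R z(1)] and s = bisimD[OF S z(2)]
  show "wt B x = wt B'' y" using r(3) s(3) by simp
  fix i assume i: "i \<in> index_set m"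
  show "eps B i x = eps B'' i y" "phi B i x = phi B'' i y" using r(5,6)[OF i] s(5,6)[OF i] by simp_all
  show "\<exists>y'. f_op B'' i y = Some y' \<and> (x', y') \<in> R O S" if "f_op B i x = Some x'" for x'
    using r(7)[OF i that] s(7)[OF i] by blast
  show "\<exists>x'. f_op B i x = Some x' \<and> (x', y') \<in> R O S" if "f_op B'' i y = Some y'" for y'
    using s(8)[OF i that] r(8)[OF i] by blast
  show "\<exists>y'. e_op B'' i y = Some y' \<and> (x', y') \<in> R O S" if "e_op B i x = Some x'" for x'
    using r(9)[OF i that] s(9)[OF i] by blast
  show "\<exists>x'. e_op B i x = Some x' \<and> (x', y') \<in> R O S" if "e_op B'' i y = Some y'" for y'
    using s(10)[OF i that] r(10)[OF i] by blast
qed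

lemma component_elts: "b \<in> elts B \<Longrightarrow> component m B b \<subseteq> elts B"
proof
  fix x assume "b \<in> elts B" "x \<in> component m B b"
  then have "(b, x) \<in> (arrows m B \<union> (arrows m B)\<inverse>)\<^sup>*" by (simp add: component_def)
  then show "x \<in> elts B" using \<open>b \<in> elts B\<close> by (cases rule: rtranclE) (auto simp: arrows_def)
qed

lemma component_eq: "c \<in> component m B b \<Longrightarrow> component m B c = component m B b"
proof -
  let ?E = "arrows m B \<union> (arrows m B)\<inverse>"
  assume "c \<in> component m B b"
  then have a: "(b, c) \<in> ?E\<^sup>*" by (simp add: component_def)
  have "sym (?E\<^sup>*)" by (intro sym_rtrancl) (auto simp: sym_def)
  then have "(c, b) \<in> ?E\<^sup>*" using a by (meson symD)
  then show ?thesis using a unfolding component_def by (auto intro: rtrancl_trans)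
qed

lemma bisim_component:
  assumes R: "bisim m B B' R" and B: "ef_inverse m B" and B': "ef_inverse m B'"
    and b: "(b, b') \<in> R" and x: "x \<in> component m B b"
  shows "\<exists>y\<in>component m B' b'. (x, y) \<in> R"
proof -
  have "(b, x) \<in> (arrows m B \<union> (arrows m B)\<inverse>)\<^sup>*" using x by (simp add: component_def)
  then show ?thesis
  proof (induction rule: rtrancl_induct)
    case base then show ?case using b by (auto simp: component_def)
  next
    case (step x z)
    then obtain y where y: "y \<in> component m B' b'" "(x, y) \<in> R" by blast
    note xy = bisimD[OF R y(2)]
    have "\<exists>y'. (z, y') \<in> R \<and> (y, y') \<in> arrows m B' \<union> (arrows m B')\<inverse>"
      using step(2)
    proof
      assume "(x, z) \<in> arrows m B"
      then obtain i where "i \<in> index_set m" "f_op B i x = Some z" by (auto simp: arrows_def)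
      then obtain y' where "f_op B' i y = Some y'" "(z, y') \<in> R" using xy(7) by blast
      then show ?thesis using xy(2) bisimD(2)[OF R] \<open>i \<in> index_set m\<close> unfolding arrows_def by blast
    next
      assume "(x, z) \<in> (arrows m B)\<inverse>"
      then obtain i where i: "i \<in> index_set m" "f_op B i z = Some x" "z \<in> elts B" by (auto simp: arrows_def)
      then have "e_op B i x = Some z" using B xy(1) unfolding ef_inverse_def by blast
      then obtain y' where y': "e_op B' i y = Some y'" "(z, y') \<in> R" using xy(9) i by blast
      then have "f_op B' i y' = Some y" using B' xy(2) bisimD(2)[OF R] i unfolding ef_inverse_def by blast
      then show ?thesis using xy(2) bisimD(2)[OF R] i(1) y'(2) unfolding arrows_def by blast
    qed
    then show ?case using y(1) unfolding component_def by (auto intro: rtrancl_into_rtrancl)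
  qed
qed

lemma bisim_crystal_equiv:
  assumes R: "bisim m B B' R" and B: "ef_inverse m B" and B': "ef_inverse m B'"
    and b: "(b, b') \<in> R"
  shows "crystal_equiv m B b B' b'"
proof -
  define \<psi> where "\<psi> x = (THE y. (x, y) \<in> R)" for x
  have psi: "\<psi> x = y" if "(x, y) \<in> R" for x y
    unfolding \<psi>_def using that bisimD(4)[OF R] by (blast intro: the_equality)
  let ?C = "component m B b" and ?C' = "component m B' b'"
  have fw: "(x, \<psi> x) \<in> R \<and> \<psi> x \<in> ?C'" if "x \<in> ?C" for x
    using bisim_component[OF R B B' b that] psi by auto
  have bw: "\<exists>x\<in>?C. \<psi> x = y" if "y \<in> ?C'" for y
    using bisim_component[OF bisim_converse[OF R] B' B _ that, of b] b psi by auto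
  have inj: "inj_on \<psi> ?C" using fw bisimD(4)[OF R] by (metis inj_onI)
  have "crystal_iso m B ?C B' ?C' \<psi>" unfolding crystal_iso_def
  proof (intro conjI ballI)
    show "bij_betw \<psi> ?C ?C'" using inj fw bw by (auto simp: bij_betw_def)
  next
    fix x assume x: "x \<in> ?C"
    note D = bisimD[OF R fw[OF x, THEN conjunct1]]
    show "wt B' (\<psi> x) = wt B x" using D by simp
    fix i assume i: "i \<in> index_set m"
    show "eps B' i (\<psi> x) = eps B i x" "phi B' i (\<psi> x) = phi B i x" using D i by simp_all
    fix x' assume x': "x' \<in> ?C"
    show "f_op B i x = Some x' \<longleftrightarrow> f_op B' i (\<psi> x) = Some (\<psi> x')"
    proof
      assume "f_op B i x = Some x'"
      then show "f_op B' i (\<psi> x) = Some (\<psi> x')" using D(7)[OF i] psi by blast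
    next
      assume "f_op B' i (\<psi> x) = Some (\<psi> x')"
      then obtain z where "f_op B i x = Some z" "(z, \<psi> x') \<in> R" using D(8)[OF i] by blast
      then show "f_op B i x = Some x'" using bisimD(4)[OF R] fw[OF x'] by blast
    qed
  qed
  then show ?thesis using bisimD(1,2)[OF R b] psi[OF b] unfolding crystal_equiv_def by blast
qed

text \<open>The new partner is described by \<open>f_op\<close> because that determines
  \<open>b'\<close> from \<open>c'\<close>; uniqueness of the raised tableau thereby returns to the
  original one.\<close>

lemma crystal_equiv_e_op:
  assumes eq: "crystal_equiv m B b B' b'" and B: "ef_inverse m B"
    and i: "i \<in> index_set m" and c: "e_op B i b = Some c" "c \<in> elts B"
  shows "\<exists>c'\<in>elts B'. f_op B' i c' = Some b' \<and> crystal_equiv m B c B' c'"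
proof -
  obtain \<psi> where \<psi>: "crystal_iso m B (component m B b) B' (component m B' b') \<psi>" "\<psi> b = b'"
    and b: "b \<in> elts B" "b' \<in> elts B'"
    using eq unfolding crystal_equiv_def by blast
  have f: "f_op B i c = Some b" using B b c i unfolding ef_inverse_def by blast
  then have "(b, c) \<in> (arrows m B)\<inverse>" using b c i unfolding arrows_def by blast
  then have cC: "c \<in> component m B b" unfolding component_def by blast
  have bC: "b \<in> component m B b" by (simp add: component_def)
  have psiC: "\<psi> c \<in> component m B' b'" using \<psi>(1) cC unfolding crystal_iso_def bij_betw_def by blast
  have "f_op B' i (\<psi> c) = Some b'" using \<psi> f cC bC i unfolding crystal_iso_def by blast
  moreover have "\<psi> c \<in> elts B'" using component_elts[OF b(2)] psiC by blast
  ultimately show ?thesis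
    using \<psi>(1) c(2) component_eq[OF cC] component_eq[OF psiC] unfolding crystal_equiv_def by metis
qed

lemma crystal_equivD:
  assumes "crystal_equiv m B b B' b'"
  shows "b \<in> elts B" "b' \<in> elts B'" "wt B' b' = wt B b" "i \<in> index_set m \<Longrightarrow> eps B' i b' = eps B i b"
proof -
  obtain \<psi> where \<psi>: "crystal_iso m B (component m B b) B' (component m B' b') \<psi>" "\<psi> b = b'"
    and b: "b \<in> elts B" "b' \<in> elts B'"
    using assms unfolding crystal_equiv_def by blast
  have "b \<in> component m B b" by (simp add: component_def)
  then show "b \<in> elts B" "b' \<in> elts B'" "wt B' b' = wt B b" "i \<in> index_set m \<Longrightarrow> eps B' i b' = eps B i b"
    using \<psi> b unfolding crystal_iso_def by blast+
qed

lemma ef_inverse_word: "ef_inverse m (word_crystal m)"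
  unfolding ef_inverse_def using e_iff_f by auto

text \<open>The sum $\varepsilon_i+\varphi_i$ (for $i\ge 0$) or difference (for $i<0$) is read off the weight,
  which yields the backward conditions.\<close>

lemma word_bisimI:
  assumes W: "\<And>x y. (x, y) \<in> R \<Longrightarrow> x \<in> lists (letters m) \<and> y \<in> lists (letters m) \<and> mset x = mset y"
    and one: "\<And>x y x' y'. (x, y) \<in> R \<Longrightarrow> (x', y') \<in> R \<Longrightarrow> x = x' \<longleftrightarrow> y = y'"
    and neg: "\<And>x y i. (x, y) \<in> R \<Longrightarrow> i \<in> index_set m \<Longrightarrow> i < 0 \<Longrightarrow>
      eps (word_crystal m) i x = eps (word_crystal m) i y"
    and f: "\<And>x y i x'. (x, y) \<in> R \<Longrightarrow> i \<in> index_set m \<Longrightarrow> f_op (word_crystal m) i x = Some x' \<Longrightarrow>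
      \<exists>y'. f_op (word_crystal m) i y = Some y' \<and> (x', y') \<in> R"
    and e: "\<And>x y i x'. (x, y) \<in> R \<Longrightarrow> i \<in> index_set m \<Longrightarrow> e_op (word_crystal m) i x = Some x' \<Longrightarrow>
      \<exists>y'. e_op (word_crystal m) i y = Some y' \<and> (x', y') \<in> R"
  shows "bisim m (word_crystal m) (word_crystal m) R"
proof -
  let ?W = "word_crystal m"
  have wt: "wt ?W x = wt ?W y" if "(x, y) \<in> R" for x y using W[OF that] count_list_wt by blast
  have ep: "eps ?W i x = eps ?W i y \<and> phi ?W i x = phi ?W i y"
    if r: "(x, y) \<in> R" and i: "i \<in> index_set m" for x y i
  proof (cases "i < 0")
    case True
    then show ?thesis using neg[OF r i] phi_eps_wt(1)[OF i _ _ wt[OF r]] W[OF r] by simp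
  next
    case False
    have "f_op ?W i x \<noteq> None \<Longrightarrow> f_op ?W i y \<noteq> None" "e_op ?W i x \<noteq> None \<Longrightarrow> e_op ?W i y \<noteq> None"
      using f[OF r i] e[OF r i] by auto
    then have "phi ?W i x \<noteq> 0 \<Longrightarrow> phi ?W i y \<noteq> 0" "eps ?W i x \<noteq> 0 \<Longrightarrow> eps ?W i y \<noteq> 0"
      using phi_eq_0_iff[OF i] eps_eq_0_iff[OF i] by simp_all
    moreover have "phi ?W i x + eps ?W i x = phi ?W i y + eps ?W i y"
      using phi_eps_wt(2)[OF i _ _ wt[OF r]] W[OF r] False by simp
    moreover have "phi ?W i y + eps ?W i y \<le> 1"
      using is_crystalD(1)[OF is_crystal_word_crystal i, of y] W[OF r] False by auto
    ultimately show ?thesis by linarith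
  qed
  show ?thesis unfolding bisim_def
  proof (intro conjI allI impI ballI)
    show "R \<subseteq> elts ?W \<times> elts ?W" using W by auto
  next
    fix x y i y' assume r: "(x, y) \<in> R" and i: "i \<in> index_set m"
    note ep = ep[OF r i]
    show "\<exists>x'. f_op ?W i x = Some x' \<and> (x', y') \<in> R" if "f_op ?W i y = Some y'"
      using that f[OF r i] ep phi_eq_0_iff[OF i, of x] phi_eq_0_iff[OF i, of y] by (cases "f_op ?W i x") auto
    show "\<exists>x'. e_op ?W i x = Some x' \<and> (x', y') \<in> R" if "e_op ?W i y = Some y'"
      using that e[OF r i] ep eps_eq_0_iff[OF i, of x] eps_eq_0_iff[OF i, of y] by (cases "e_op ?W i x") auto
  qed (use wt ep one f e in blast)+
qed

text \<open>Stated through relations instead of isomorphisms of components, since relations can be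
  inverted, composed and concatenated directly. The passage to \<open>crystal_equiv\<close> is made
  only at the end, in \<open>word_equiv_tableau\<close>.\<close>

definition word_equiv :: "nat \<Rightarrow> rat list \<Rightarrow> rat list \<Rightarrow> bool" where
  "word_equiv m v w \<longleftrightarrow> (\<exists>R. bisim m (word_crystal m) (word_crystal m) R \<and> (v, w) \<in> R)"

lemma word_equiv_refl: "w \<in> lists (letters m) \<Longrightarrow> word_equiv m w w"
proof -
  assume w: "w \<in> lists (letters m)"
  have "bisim m (word_crystal m) (word_crystal m) {(x, x) |x. x \<in> lists (letters m)}"
  proof (rule word_bisimI)
    fix x y i x' assume "(x, y) \<in> {(x, x) |x. x \<in> lists (letters m)}" and i: "i \<in> index_set m"
    then have x: "x = y" "x \<in> lists (letters m)" by blast+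
    show "\<exists>y'. f_op (word_crystal m) i y = Some y' \<and> (x', y') \<in> {(x, x) |x. x \<in> lists (letters m)}"
      if "f_op (word_crystal m) i x = Some x'" using that x op_letters(1)[OF i x(2)] by blast
    show "\<exists>y'. e_op (word_crystal m) i y = Some y' \<and> (x', y') \<in> {(x, x) |x. x \<in> lists (letters m)}"
      if "e_op (word_crystal m) i x = Some x'" using that x op_letters(2)[OF i x(2)] by blast
  qed blast+
  then show ?thesis using w unfolding word_equiv_def by blast
qed

lemma word_equiv_sym: "word_equiv m v w \<Longrightarrow> word_equiv m w v"
  unfolding word_equiv_def using bisim_converse by blast

lemma word_equiv_trans [trans]: "word_equiv m u v \<Longrightarrow> word_equiv m v w \<Longrightarrow> word_equiv m u w"
  unfolding word_equiv_def using bisim_comp by blast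

lemma word_equiv_letters: "word_equiv m v w \<Longrightarrow> v \<in> lists (letters m) \<and> w \<in> lists (letters m)"
  unfolding word_equiv_def using bisimD(1,2) by fastforce

lemma op_length:
  assumes "i \<in> index_set m" "w \<in> lists (letters m)"
  shows "f_op (word_crystal m) i w = Some v \<Longrightarrow> length v = length w"
    and "e_op (word_crystal m) i w = Some v \<Longrightarrow> length v = length w"
  unfolding f_split[OF assms(1)] e_split[OF assms] by auto

lemma touches_mset: "mset v = mset w \<Longrightarrow> touches i v = touches i w"
  unfolding touches_def by (metis set_mset_mset)

text \<open>Which factor an operator acts on depends only on \<open>eps\<close>, \<open>phi\<close>
  and the letters that occur, and related words agree in all of these. So the operators act on
  corresponding factors.\<close>

lemma word_equiv_append:
  assumes "word_equiv m u u'" "word_equiv m v v'"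
  shows "word_equiv m (u @ v) (u' @ v')"
proof -
  let ?W = "word_crystal m"
  obtain R S where R: "bisim m ?W ?W R" "(u, u') \<in> R" and S: "bisim m ?W ?W S" "(v, v') \<in> S"
    using assms unfolding word_equiv_def by blast
  \<comment> \<open>Fixing the lengths of the first factors makes the splitting of a concatenation
    unique, hence \<open>Q\<close> one-to-one; the operators preserve lengths, so \<open>Q\<close>
    stays closed.\<close>
  define Q where "Q = {(x @ y, x' @ y') | x y x' y'. (x, x') \<in> R \<and> (y, y') \<in> S \<and>
    length x = length u \<and> length x' = length u'}"
  have QI: "(x @ y, x' @ y') \<in> Q" if "(x, x') \<in> R" "(y, y') \<in> S" "length x = length u" "length x' = length u'"
    for x y x' y' using that unfolding Q_def by blast
  have mR: "mset x = mset x'" if "(x, x') \<in> R" for x x'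
    using bisimD(3)[OF R(1) that] count_list_wt by blast
  have mS: "mset x = mset x'" if "(x, x') \<in> S" for x x'
    using bisimD(3)[OF S(1) that] count_list_wt by blast
  have "bisim m ?W ?W Q"
  proof (rule word_bisimI)
    show "w \<in> lists (letters m) \<and> z \<in> lists (letters m) \<and> mset w = mset z" if "(w, z) \<in> Q" for w z
    proof -
      from that obtain x y x' y' where *: "w = x @ y" "z = x' @ y'" "(x, x') \<in> R" "(y, y') \<in> S"
        unfolding Q_def by force
      show ?thesis using bisimD(1,2)[OF R(1) *(3)] bisimD(1,2)[OF S(1) *(4)] mR[OF *(3)] mS[OF *(4)]
        unfolding *(1,2) by simp
    qed
    show "w = w2 \<longleftrightarrow> z = z2" if "(w, z) \<in> Q" "(w2, z2) \<in> Q" for w z w2 z2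
    proof -
      from that obtain x y x' y' a b a' b' where *: "w = x @ y" "z = x' @ y'" "(x, x') \<in> R" "(y, y') \<in> S"
        "w2 = a @ b" "z2 = a' @ b'" "(a, a') \<in> R" "(b, b') \<in> S"
        "length x = length a" "length x' = length a'" unfolding Q_def by force
      show ?thesis using bisimD(4)[OF R(1) *(3) *(7)] bisimD(4)[OF S(1) *(4) *(8)] *(9,10)
        unfolding *(1,2,5,6) by simp
    qed
  next
    fix w z i assume q: "(w, z) \<in> Q" and i: "i \<in> index_set m"
    then obtain x y x' y' where Q: "w = x @ y" "z = x' @ y'" "(x, x') \<in> R" "(y, y') \<in> S"
      "length x = length u" "length x' = length u'" unfolding Q_def by blast
    note r = bisimD[OF R(1) Q(3)] and s = bisimD[OF S(1) Q(4)]
    have t: "touches i x' = touches i x" "touches i y' = touches i y"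
      using touches_mset mR[OF Q(3)] mS[OF Q(4)] by metis+
    show "eps ?W i w = eps ?W i z" if "i < 0"
      using r(5,6)[OF i] s(5,6)[OF i] by (simp add: Q(1,2) eps_append_neg[OF i that])
    have len: "length x2 = length x" if "f_op ?W i x = Some x2 \<or> e_op ?W i x = Some x2" for x2
      using op_length[OF i] r(1) that by auto
    have len': "length x2 = length x'" if "f_op ?W i x' = Some x2 \<or> e_op ?W i x' = Some x2" for x2
      using op_length[OF i] r(2) that by auto
    define A where "A = (if i < 0 then phi ?W i x > eps ?W i y
      else if i \<in> \<int> then touches i x else \<not> touches i y)"
    define A' where "A' = (if i < 0 then phi ?W i x \<ge> eps ?W i y
      else if i \<in> \<int> then touches i x else \<not> touches i y)"
    have F: "f_op ?W i w = (if A then map_option (\<lambda>x. x @ y) (f_op ?W i x) else map_option ((@) x) (f_op ?W i y))"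
      "f_op ?W i z = (if A then map_option (\<lambda>x. x @ y') (f_op ?W i x') else map_option ((@) x') (f_op ?W i y'))"
      using r(5,6)[OF i] s(5,6)[OF i] t
      by (cases "i < 0"; simp add: A_def Q(1,2) f_append_neg[OF i] ops_append_nonneg(1)[OF i])+
    have E: "e_op ?W i w = (if A' then map_option (\<lambda>x. x @ y) (e_op ?W i x) else map_option ((@) x) (e_op ?W i y))"
      "e_op ?W i z = (if A' then map_option (\<lambda>x. x @ y') (e_op ?W i x') else map_option ((@) x') (e_op ?W i y'))"
      using r(5,6)[OF i] s(5,6)[OF i] t
      by (cases "i < 0"; simp add: A'_def Q(1,2) e_append_neg[OF i] ops_append_nonneg(2)[OF i])+
    show "\<exists>z'. f_op ?W i z = Some z' \<and> (w', z') \<in> Q" if st: "f_op ?W i w = Some w'" for w'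
    proof (cases A)
      case True
      then obtain x2 where x2: "f_op ?W i x = Some x2" "w' = x2 @ y" using st F by auto
      then obtain x3 where x3: "f_op ?W i x' = Some x3" "(x2, x3) \<in> R" using r(7)[OF i] by blast
      have "(w', x3 @ y') \<in> Q" unfolding x2(2)
        using QI[OF x3(2) Q(4)] len[of x2] len'[of x3] x2 x3 Q(5,6) by simp
      then show ?thesis using x3 F True by simp
    next
      case False
      then obtain x2 where x2: "f_op ?W i y = Some x2" "w' = x @ x2" using st F by auto
      then obtain x3 where x3: "f_op ?W i y' = Some x3" "(x2, x3) \<in> S" using s(7)[OF i] by blast
      have "(w', x' @ x3) \<in> Q" unfolding x2(2) using QI[OF Q(3) x3(2) Q(5,6)] .
      then show ?thesis using x3 F False by simp
    qed
    show "\<exists>z'. e_op ?W i z = Some z' \<and> (w', z') \<in> Q" if st: "e_op ?W i w = Some w'" for w'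
    proof (cases A')
      case True
      then obtain x2 where x2: "e_op ?W i x = Some x2" "w' = x2 @ y" using st E by auto
      then obtain x3 where x3: "e_op ?W i x' = Some x3" "(x2, x3) \<in> R" using r(9)[OF i] by blast
      have "(w', x3 @ y') \<in> Q" unfolding x2(2)
        using QI[OF x3(2) Q(4)] len[of x2] len'[of x3] x2 x3 Q(5,6) by simp
      then show ?thesis using x3 E True by simp
    next
      case False
      then obtain x2 where x2: "e_op ?W i y = Some x2" "w' = x @ x2" using st E by auto
      then obtain x3 where x3: "e_op ?W i y' = Some x3" "(x2, x3) \<in> S" using s(9)[OF i] by blast
      have "(w', x' @ x3) \<in> Q" unfolding x2(2) using QI[OF Q(3) x3(2) Q(5,6)] .
      then show ?thesis using x3 E False by simp
    qed
  qed
  moreover have "(u @ v, u' @ v') \<in> Q" using R(2) S(2) unfolding Q_def by blast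
  ultimately show ?thesis unfolding word_equiv_def by blast
qed

section \<open>Knuth relations\<close>

text \<open>In the standardization of a word, equal even letters increase from right to left and equal odd
  letters from left to right.\<close>

definition asc :: "rat \<Rightarrow> rat \<Rightarrow> bool" where
  "asc x y \<longleftrightarrow> x < y \<or> x = y \<and> x \<notin> \<int>"

text \<open>On the words of length 3 with a descent followed by an ascent, the two Knuth relations combine
  to one injective map.\<close>

fun knuth3 :: "rat list \<Rightarrow> rat list" where
  "knuth3 [x, y, z] = (if asc x z then [x, z, y] else [y, x, z])"
| "knuth3 w = w"

fun desc_asc :: "rat list \<Rightarrow> bool" where
  "desc_asc [x, y, z] \<longleftrightarrow> \<not> asc x y \<and> asc y z"
| "desc_asc w \<longleftrightarrow> False"

context
  fixes i m assumes i: "i \<in> index_set m"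
begin

text \<open>Since no letter lies between \<open>src i\<close> and \<open>tgt i\<close>, any other
  letter compares with both in the same way. Three letters thus give finitely many configurations,
  on which the Knuth moves can be tested by simplification.\<close>

lemma letter_asc_cases: "x = src i \<or> x = tgt i \<or>
    x \<noteq> src i \<and> x \<noteq> tgt i \<and> asc x (src i) \<and> asc x (tgt i) \<and> \<not> asc (src i) x \<and> \<not> asc (tgt i) x \<or>
    x \<noteq> src i \<and> x \<noteq> tgt i \<and> \<not> asc x (src i) \<and> \<not> asc x (tgt i) \<and> asc (src i) x \<and> asc (tgt i) x"
  if x: "x \<in> letters m"
proof -
  consider "x = src i" | "x = tgt i" | "x < src i" "x < tgt i" | "src i < x" "tgt i < x"
    using letter_gap[OF i x] src_less_tgt[OF i] by fastforce
  then show ?thesis by cases (simp_all add: asc_def)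
qed

lemma asc_src_tgt: "asc (src i) (tgt i)" "\<not> asc (tgt i) (src i)" "src i \<noteq> tgt i" "tgt i \<noteq> src i"
  using src_less_tgt[OF i] by (auto simp: asc_def)

lemma knuth3_eps:
  assumes "x \<in> letters m" "y \<in> letters m" "z \<in> letters m" "i < 0" "\<not> asc x y" "asc y z"
  shows "eps (word_crystal m) i [x, y, z] = eps (word_crystal m) i (knuth3 [x, y, z])"
proof -
  note l = letter_asc_cases[OF assms(1)] letter_asc_cases[OF assms(2)] letter_asc_cases[OF assms(3)]
  note q = asc_src_tgt
  have "src i \<in> \<int>" "tgt i \<in> \<int>"
    using assms(4) src_parity[OF i] tgt_parity[OF i] neg_index_Ints[OF i] by auto
  then have p: "\<not> asc (src i) (src i)" "\<not> asc (tgt i) (tgt i)" by (simp_all add: asc_def)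
  from l(1) l(2) l(3) show ?thesis
    by (elim disjE; insert assms(5-6) p q; simp add: eps_Cons_neg[OF i assms(4)])
qed

text \<open>Besides commuting with \<open>knuth3\<close>, the operator must keep the pattern
  \<open>desc_asc\<close>; otherwise the graph of the map on this pattern would not be closed. The
  three kinds of index are separated because the parities of \<open>src i\<close> and
  \<open>tgt i\<close>, and with them \<open>asc\<close> on equal letters, differ.\<close>

lemma knuth3_f:
  assumes "x \<in> letters m" "y \<in> letters m" "z \<in> letters m" "\<not> asc x y" "asc y z"
    "f_op (word_crystal m) i [x, y, z] = Some w"
  shows "desc_asc w \<and> f_op (word_crystal m) i (knuth3 [x, y, z]) = Some (knuth3 w)"
proof -
  note l = letter_asc_cases[OF assms(1)] letter_asc_cases[OF assms(2)] letter_asc_cases[OF assms(3)]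
  note q = asc_src_tgt
  consider "i < 0" | "\<not> i < 0" "i \<ge> 0" "i \<in> \<int>" | "\<not> i < 0" "i \<ge> 0" "i \<notin> \<int>" by fastforce
  then show ?thesis
  proof cases
    case 1
    then have "src i \<in> \<int>" "tgt i \<in> \<int>"
      using src_parity[OF i] tgt_parity[OF i] neg_index_Ints[OF i] by auto
    then have p: "asc (src i) (src i) \<longleftrightarrow> src i \<notin> \<int>" "asc (tgt i) (tgt i) \<longleftrightarrow> tgt i \<notin> \<int>" "src i \<in> \<int>" "tgt i \<in> \<int>"
      by (simp_all add: asc_def)
    from l(1) l(2) l(3) show ?thesis
      by (elim disjE; insert assms(4-6) p q 1; auto simp: f_Cons_neg[OF i] eps_Cons_neg[OF i] split: if_split_asm)
  next
    case 2
    then have "src i \<in> \<int>" "tgt i \<notin> \<int>"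
      using src_parity[OF i] tgt_parity[OF i] neg_index_Ints[OF i] by auto
    then have p: "asc (src i) (src i) \<longleftrightarrow> src i \<notin> \<int>" "asc (tgt i) (tgt i) \<longleftrightarrow> tgt i \<notin> \<int>" "src i \<in> \<int>" "tgt i \<notin> \<int>"
      by (simp_all add: asc_def)
    from l(1) l(2) l(3) show ?thesis
      by (elim disjE; insert assms(4-6) p q 2; auto simp: ops_Cons_nonneg(1)[OF i] split: if_split_asm)
  next
    case 3
    then have "src i \<notin> \<int>" "tgt i \<in> \<int>"
      using src_parity[OF i] tgt_parity[OF i] neg_index_Ints[OF i] by auto
    then have p: "asc (src i) (src i) \<longleftrightarrow> src i \<notin> \<int>" "asc (tgt i) (tgt i) \<longleftrightarrow> tgt i \<notin> \<int>" "src i \<notin> \<int>" "tgt i \<in> \<int>"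
      by (simp_all add: asc_def)
    from l(1) l(2) l(3) show ?thesis
      by (elim disjE; insert assms(4-6) p q 3; auto simp: ops_Cons_nonneg(1)[OF i] split: if_split_asm)
  qed
qed

lemma knuth3_e:
  assumes "x \<in> letters m" "y \<in> letters m" "z \<in> letters m" "\<not> asc x y" "asc y z"
    "e_op (word_crystal m) i [x, y, z] = Some w"
  shows "desc_asc w \<and> e_op (word_crystal m) i (knuth3 [x, y, z]) = Some (knuth3 w)"
proof -
  note l = letter_asc_cases[OF assms(1)] letter_asc_cases[OF assms(2)] letter_asc_cases[OF assms(3)]
  note q = asc_src_tgt
  consider "i < 0" | "\<not> i < 0" "i \<ge> 0" "i \<in> \<int>" | "\<not> i < 0" "i \<ge> 0" "i \<notin> \<int>" by fastforce
  then show ?thesis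
  proof cases
    case 1
    then have "src i \<in> \<int>" "tgt i \<in> \<int>"
      using src_parity[OF i] tgt_parity[OF i] neg_index_Ints[OF i] by auto
    then have p: "asc (src i) (src i) \<longleftrightarrow> src i \<notin> \<int>" "asc (tgt i) (tgt i) \<longleftrightarrow> tgt i \<notin> \<int>" "src i \<in> \<int>" "tgt i \<in> \<int>"
      by (simp_all add: asc_def)
    from l(1) l(2) l(3) show ?thesis
      by (elim disjE; insert assms(4-6) p q 1; auto simp: e_Cons_neg[OF i] eps_Cons_neg[OF i] split: if_split_asm)
  next
    case 2
    then have "src i \<in> \<int>" "tgt i \<notin> \<int>"
      using src_parity[OF i] tgt_parity[OF i] neg_index_Ints[OF i] by auto
    then have p: "asc (src i) (src i) \<longleftrightarrow> src i \<notin> \<int>" "asc (tgt i) (tgt i) \<longleftrightarrow> tgt i \<notin> \<int>" "src i \<in> \<int>" "tgt i \<notin> \<int>"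
      by (simp_all add: asc_def)
    from l(1) l(2) l(3) show ?thesis
      by (elim disjE; insert assms(4-6) p q 2; auto simp: ops_Cons_nonneg(2)[OF i] split: if_split_asm)
  next
    case 3
    then have "src i \<notin> \<int>" "tgt i \<in> \<int>"
      using src_parity[OF i] tgt_parity[OF i] neg_index_Ints[OF i] by auto
    then have p: "asc (src i) (src i) \<longleftrightarrow> src i \<notin> \<int>" "asc (tgt i) (tgt i) \<longleftrightarrow> tgt i \<notin> \<int>" "src i \<notin> \<int>" "tgt i \<in> \<int>"
      by (simp_all add: asc_def)
    from l(1) l(2) l(3) show ?thesis
      by (elim disjE; insert assms(4-6) p q 3; auto simp: ops_Cons_nonneg(2)[OF i] split: if_split_asm)
  qed
qed

end

lemma rev_in_lists [simp]: "rev xs \<in> lists A \<longleftrightarrow> xs \<in> lists A"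
  by (simp add: in_lists_conv_set)

lemma desc_asc_cases: "desc_asc w \<Longrightarrow> \<exists>x y z. w = [x, y, z] \<and> \<not> asc x y \<and> asc y z"
  by (cases w rule: desc_asc.cases) simp_all

lemma word_equiv_knuth3:
  assumes "x \<in> letters m" "y \<in> letters m" "z \<in> letters m" "\<not> asc x y" "asc y z"
  shows "word_equiv m [x, y, z] (knuth3 [x, y, z])"
proof -
  define R where "R = {(w, knuth3 w) | w. w \<in> lists (letters m) \<and> desc_asc w}"
  have RE: "\<exists>x y z. v = [x, y, z] \<and> w = knuth3 [x, y, z] \<and> \<not> asc x y \<and> asc y z \<and>
    x \<in> letters m \<and> y \<in> letters m \<and> z \<in> letters m" if r: "(v, w) \<in> R" for v w
  proof -
    have v: "w = knuth3 v" "v \<in> lists (letters m)" "desc_asc v" using r by (auto simp: R_def)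
    obtain x y z where *: "v = [x, y, z]" "\<not> asc x y" "asc y z" using desc_asc_cases[OF v(3)] by blast
    show ?thesis using v(1,2) * by (intro exI[of _ x] exI[of _ y] exI[of _ z]) simp
  qed
  have "bisim m (word_crystal m) (word_crystal m) R"
  proof (rule word_bisimI)
    fix v w assume "(v, w) \<in> R"
    from RE[OF this] show "v \<in> lists (letters m) \<and> w \<in> lists (letters m) \<and> mset v = mset w"
      by (auto split: if_splits)
  next
    fix v w v' w' assume r: "(v, w) \<in> R" "(v', w') \<in> R"
    obtain x y z where v: "v = [x, y, z]" "w = knuth3 [x, y, z]" "\<not> asc x y" "asc y z" using RE[OF r(1)] by blast
    obtain x' y' z' where v': "v' = [x', y', z']" "w' = knuth3 [x', y', z']" "\<not> asc x' y'" "asc y' z'" using RE[OF r(2)] by blast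
    show "v = v' \<longleftrightarrow> w = w'" unfolding v v' using v(3,4) v'(3,4) by (cases "asc x z"; cases "asc x' z'") auto
  next
    fix v w i assume r: "(v, w) \<in> R" and i: "i \<in> index_set m"
    obtain x y z where R: "v = [x, y, z]" "w = knuth3 [x, y, z]"
      "x \<in> letters m" "y \<in> letters m" "z \<in> letters m" "\<not> asc x y" "asc y z" using RE[OF r] by blast
    show "eps (word_crystal m) i v = eps (word_crystal m) i w" if "i < 0"
      using knuth3_eps[OF i R(3-5) that R(6,7)] R(1,2) by simp
    have v: "v \<in> lists (letters m)" using R by simp
    show "\<exists>w'. f_op (word_crystal m) i w = Some w' \<and> (v', w') \<in> R" if "f_op (word_crystal m) i v = Some v'" for v'
      using knuth3_f[OF i R(3-7)] that op_letters(1)[OF i v that] unfolding R(1,2) R_def by blast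
    show "\<exists>w'. e_op (word_crystal m) i w = Some w' \<and> (v', w') \<in> R" if "e_op (word_crystal m) i v = Some v'" for v'
      using knuth3_e[OF i R(3-7)] that op_letters(2)[OF i v that] unfolding R(1,2) R_def by blast
  qed
  moreover have "([x, y, z], knuth3 [x, y, z]) \<in> R"
    unfolding R_def using assms by (intro CollectI exI[of _ "[x, y, z]"]) simp
  ultimately show ?thesis unfolding word_equiv_def by blast
qed

section \<open>Row insertion\<close>

lemma asc_trans: "asc x y \<Longrightarrow> asc y z \<Longrightarrow> asc x z"
  by (auto simp: asc_def)

lemma asc_mixed: "asc x y \<Longrightarrow> \<not> asc z y \<Longrightarrow> asc x z" "\<not> asc y x \<Longrightarrow> asc y z \<Longrightarrow> asc x z"
  by (auto simp: asc_def)

abbreviation rowsorted :: "rat list \<Rightarrow> bool" where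
  "rowsorted \<equiv> sorted_wrt (\<lambda>x y. \<not> asc y x)"

text \<open>The column condition for a row \<open>s\<close> below a row \<open>r\<close>: through
  \<open>asc\<close>, equal odd letters may stand above each other and equal even ones may
  not.\<close>

definition dominates :: "rat list \<Rightarrow> rat list \<Rightarrow> bool" where
  "dominates r s \<longleftrightarrow> length s \<le> length r \<and> (\<forall>j<length s. asc (r ! j) (s ! j))"

lemma transp_dominates: "transp dominates"
  unfolding transp_def dominates_def using asc_trans by (meson order_less_le_trans order_trans)

text \<open>An equal even entry is passed over and an equal odd entry is displaced, in accordance
  with the fact that only even letters may repeat in a row.\<close>

definition bump :: "rat \<Rightarrow> rat list \<Rightarrow> nat" where
  "bump x r = length (takeWhile (\<lambda>y. \<not> asc x y) r)"

definition row_insert :: "rat \<Rightarrow> rat list \<Rightarrow> rat list" where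
  "row_insert x r = (if bump x r < length r then r[bump x r := x] else r @ [x])"

primrec insert_rows :: "rat \<Rightarrow> rat list list \<Rightarrow> rat list list" where
  "insert_rows x [] = [[x]]"
| "insert_rows x (r # rs) = row_insert x r #
     (if bump x r < length r then insert_rows (r ! bump x r) rs else rs)"

lemma bump_le: "bump x r \<le> length r"
  by (simp add: bump_def length_takeWhile_le)

lemma asc_bump: "bump x r < length r \<Longrightarrow> asc x (r ! bump x r)"
  using nth_length_takeWhile[of "\<lambda>y. \<not> asc x y" r] by (simp add: bump_def)

lemma not_asc_before_bump: "k < bump x r \<Longrightarrow> \<not> asc x (r ! k)"
  unfolding bump_def by (metis (mono_tags, lifting) nth_mem set_takeWhileD takeWhile_nth)

lemma asc_after_bump:
  assumes "rowsorted r" "bump x r \<le> k" "k < length r" shows "asc x (r ! k)"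
proof (cases "k = bump x r")
  case False
  then have "\<not> asc (r ! k) (r ! bump x r)" using assms by (auto simp: sorted_wrt_iff_nth_less)
  then show ?thesis using asc_mixed(1)[OF asc_bump[of x r]] assms by simp
qed (use asc_bump[of x r] assms in auto)

lemma rowsorted_row_insert:
  assumes "rowsorted r" shows "rowsorted (row_insert x r)"
proof (cases "bump x r < length r")
  case True
  have "\<not> asc (r[bump x r := x] ! l) (r[bump x r := x] ! k)" if "k < l" "l < length r" for k l
  proof -
    consider "k = bump x r" | "l = bump x r" | "k \<noteq> bump x r" "l \<noteq> bump x r" by blast
    then show ?thesis
    proof cases
      case 1
      then have "asc x (r ! l)" using asc_after_bump[OF assms, of x l] that by simp
      \<comment> \<open>An odd letter equal to \<open>x\<close> cannot stand further right: the
        displaced entry \<open>y\<close> to its left satisfies \<open>asc x y\<close>, against the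
        order of the row.\<close>
      moreover have "r ! l \<noteq> x \<or> x \<in> \<int>" 
      proof (rule ccontr)
        assume c: "\<not> (r ! l \<noteq> x \<or> x \<in> \<int>)"
        have "asc x (r ! k)" using asc_bump[OF True] 1 by simp
        moreover have "\<not> asc (r ! l) (r ! k)" using assms that by (auto simp: sorted_wrt_iff_nth_less)
        ultimately show False using c by simp
      qed
      ultimately show ?thesis using 1 that by (auto simp: asc_def)
    next
      case 2 then show ?thesis using not_asc_before_bump[of k x r] that by simp
    next
      case 3 then show ?thesis using assms that by (auto simp: sorted_wrt_iff_nth_less)
    qed
  qed
  then show ?thesis using True by (auto simp: row_insert_def sorted_wrt_iff_nth_less)
next
  case False
  then have "bump x r = length r" using bump_le[of x r] by simp
  then have "\<forall>y\<in>set r. \<not> asc x y" using not_asc_before_bump[of _ x r] by (metis in_set_conv_nth)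
  then show ?thesis using assms False by (auto simp: row_insert_def sorted_wrt_append)
qed

text \<open>The displaced entry enters the next row weakly to the left of its old column, because
  the entry below it, if any, is larger in the sense of \<open>asc\<close>. The entry now above it
  is \<open>x\<close> or stands further left in the row, and both are smaller.\<close>

lemma dominates_row_insert:
  assumes d: "dominates r s" and r: "rowsorted r" and b: "bump x r < length r"
  shows "dominates (row_insert x r) (row_insert (r ! bump x r) s)"
proof -
  let ?j = "bump x r" let ?y = "r ! ?j" let ?k = "bump ?y s"
  have xy: "asc x ?y" using asc_bump[OF b] .
  have kj: "?k \<le> ?j"
  proof (rule ccontr)
    assume "\<not> ?k \<le> ?j"
    then have "\<not> asc ?y (s ! ?j)" "?j < length s" using not_asc_before_bump[of ?j ?y s] bump_le[of ?y s] by auto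
    then show False using d unfolding dominates_def by blast
  qed
  have k: "asc (r[?j := x] ! ?k) ?y"
  proof (cases "?k = ?j")
    case False
    then show ?thesis using kj not_asc_before_bump[of ?k x r] asc_mixed(2)[OF _ xy] by simp
  qed (use xy b in simp)
  have o: "asc (r[?j := x] ! l) (s ! l)" if "l < length s" for l
  proof (cases "l = ?j")
    case True
    then have "asc ?y (s ! l)" using d that unfolding dominates_def by auto
    then show ?thesis using True b asc_trans[OF xy] by simp
  next
    case False
    then show ?thesis using d that unfolding dominates_def by auto
  qed
  show ?thesis
  proof (cases "?k < length s")
    case True
    have "asc (r[?j := x] ! l) (s[?k := ?y] ! l)" if "l < length s" for l
      using k o[OF that] True that by (cases "l = ?k") simp_all
    then show ?thesis using True b d by (auto simp: row_insert_def dominates_def)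
  next
    case False
    then have "?k = length s" using bump_le[of ?y s] by simp
    then show ?thesis using k o False b kj by (auto simp: row_insert_def dominates_def nth_append less_Suc_eq)
  qed
qed

lemma dominates_Nil: "dominates r []" by (simp add: dominates_def)

lemma dominates_append: "dominates r s \<Longrightarrow> dominates (r @ t) s"
  by (auto simp: dominates_def nth_append)

definition pt_rows :: "rat list list \<Rightarrow> bool" where
  "pt_rows rs \<longleftrightarrow> (\<forall>r\<in>set rs. r \<noteq> [] \<and> rowsorted r) \<and> sorted_wrt dominates rs"

lemma pt_rows_simps:
  "pt_rows []" "pt_rows [r] \<longleftrightarrow> r \<noteq> [] \<and> rowsorted r"
  "pt_rows (r # s # rs) \<longleftrightarrow> r \<noteq> [] \<and> rowsorted r \<and> dominates r s \<and> pt_rows (s # rs)"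
  using sorted_wrt2[OF transp_dominates] by (auto simp: pt_rows_def)

lemma row_insert_Nil: "row_insert x [] = [x]" "row_insert x r \<noteq> []"
  by (auto simp: row_insert_def)

lemma pt_rows_insert:
  assumes "pt_rows rs" shows "pt_rows (insert_rows x rs)"
  using assms
proof (induction rs arbitrary: x)
  case Nil then show ?case by (simp add: pt_rows_simps)
next
  case (Cons r rs)
  have r: "rowsorted r" and rs: "pt_rows rs" using Cons.prems by (auto simp: pt_rows_def)
  have ri: "row_insert x r \<noteq> []" "rowsorted (row_insert x r)"
    using row_insert_Nil rowsorted_row_insert[OF r] by auto
  show ?case
  proof (cases "bump x r < length r")
    case True
    let ?y = "r ! bump x r"
    note IH = Cons.IH[OF rs, of ?y]
    have "dominates (row_insert x r) (hd (insert_rows ?y rs))"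
    proof (cases rs)
      case Nil
      then show ?thesis using dominates_row_insert[OF dominates_Nil r True] by (simp add: row_insert_Nil)
    next
      case (Cons s rs')
      then have "dominates r s" using Cons.prems by (simp add: pt_rows_simps)
      then show ?thesis using dominates_row_insert[OF _ r True] Cons by simp
    qed
    then show ?thesis using IH True ri
      by (cases "insert_rows ?y rs") (auto simp: pt_rows_simps)
  next
    case False
    then have "row_insert x r = r @ [x]" by (simp add: row_insert_def)
    then show ?thesis using Cons.prems False ri
      by (cases rs) (auto simp: pt_rows_simps dominates_append)
  qed
qed

lemma word_equiv_context:
  assumes "word_equiv m v w" "x \<in> lists (letters m)" "y \<in> lists (letters m)"
  shows "word_equiv m (x @ v @ y) (x @ w @ y)"
  using word_equiv_append[OF word_equiv_refl[OF assms(2)] word_equiv_append[OF assms(1) word_equiv_refl[OF assms(3)]]]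
  by simp

text \<open>Each step exchanges \<open>x\<close> with its right neighbour \<open>c\<close>, and the
  letter after \<open>c\<close> witnesses the Knuth relation. The final \<open>b\<close> is not
  passed; it is the witness for the last step.\<close>

lemma move_right_small:
  assumes "x \<in> letters m" "b \<in> letters m" "S \<in> lists (letters m)"
    "sorted_wrt (\<lambda>c d. \<not> asc c d) (S @ [b])" "\<forall>c\<in>set (S @ [b]). asc x c"
    "\<forall>c\<in>set S. \<not> asc c x"
  shows "word_equiv m (x # S @ [b]) (S @ [x, b])"
  using assms
proof (induction S)
  case Nil then show ?case by (auto intro: word_equiv_refl)
next
  case (Cons c S)
  obtain d t where dt: "S @ [b] = d # t" by (cases "S @ [b]") auto
  have "S @ [b] \<in> lists (letters m)" using Cons.prems by simp
  then have d: "d \<in> set (S @ [b])" "t \<in> lists (letters m)" unfolding dt by simp_all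
  then have "d \<in> letters m" "\<not> asc c x" "asc x d" "\<not> asc c d" using Cons.prems by auto
  then have "word_equiv m [c, x, d] [x, c, d]"
    using word_equiv_knuth3[of c m x d] Cons.prems by simp
  from word_equiv_context[OF word_equiv_sym[OF this], of "[]" t]
  have "word_equiv m (x # c # S @ [b]) (c # x # S @ [b])" using dt d by simp
  also have "word_equiv m (x # S @ [b]) (S @ [x, b])" using Cons by simp
  then have "word_equiv m (c # x # S @ [b]) (c # S @ [x, b])"
    using word_equiv_context[of m _ _ "[c]" "[]"] Cons.prems by fastforce
  finally show ?case by simp
qed

text \<open>Here the witness stands on the left: \<open>b\<close> passes \<open>l\<close> thanks to
  the letter preceding \<open>b\<close>, and \<open>l\<close> then takes over this role.\<close>

lemma move_right_big:
  assumes "x \<in> letters m" "b \<in> letters m" "M \<in> lists (letters m)"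
    "sorted_wrt (\<lambda>c d. \<not> asc c d) (x # M)" "asc x b"
  shows "word_equiv m (x # b # M) (x # M @ [b])"
  using assms
proof (induction M arbitrary: x)
  case Nil then show ?case by (auto intro: word_equiv_refl)
next
  case (Cons l M)
  have l: "asc l b" "\<not> asc x l" "l \<in> letters m" using Cons.prems asc_mixed(2)[of x l b] by auto
  then have "word_equiv m [x, l, b] [x, b, l]"
    using word_equiv_knuth3[of x m l b] Cons.prems by simp
  from word_equiv_context[OF word_equiv_sym[OF this], of "[]" M]
  have "word_equiv m (x # b # l # M) (x # l # b # M)" using Cons.prems by simp
  also have "word_equiv m (l # b # M) (l # M @ [b])" using Cons l by simp
  then have "word_equiv m (x # l # b # M) (x # l # M @ [b])"
    using word_equiv_context[of m _ _ "[x]" "[]"] Cons.prems by fastforce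
  finally show ?case by simp
qed

text \<open>Cut the row at the displaced entry \<open>y\<close> into \<open>L\<close>,
  \<open>y\<close>, \<open>R\<close>. In the reversed row \<open>x\<close> first moves right past
  \<open>R\<close>, up to \<open>y\<close>; then \<open>y\<close> moves past \<open>L\<close> to the
  end, where it is ready for insertion into the next row.\<close>

lemma word_equiv_row_insert:
  assumes r: "rowsorted r" "r \<in> lists (letters m)" "x \<in> letters m" and b: "bump x r < length r"
  shows "word_equiv m (x # rev r) (rev (row_insert x r) @ [r ! bump x r])"
proof -
  let ?j = "bump x r" let ?y = "r ! ?j"
  define L R where "L = take ?j r" and "R = drop (Suc ?j) r"
  have rr: "r = L @ ?y # R" unfolding L_def R_def using b by (simp add: id_take_nth_drop)
  have ins: "row_insert x r = L @ x # R" unfolding L_def R_def row_insert_def using b by (simp add: upd_conv_take_nth_drop)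
  have lets: "L \<in> lists (letters m)" "R \<in> lists (letters m)" "?y \<in> letters m"
    using r(2) by (subst (asm) rr, simp)+
  have aR: "asc x c" if "c \<in> set (rev R @ [?y])" for c
  proof -
    from that have "c \<in> set (drop ?j r)" unfolding R_def using b by (auto simp flip: Cons_nth_drop_Suc)
    then obtain k where "k < length r - ?j" "c = r ! (?j + k)" by (auto simp: in_set_conv_nth)
    then show ?thesis using asc_after_bump[OF r(1), of x "?j + k"] by simp
  qed
  have aL: "\<not> asc x l" if "l \<in> set L" for l
    using that not_asc_before_bump[of _ x r] b unfolding L_def by (auto simp: in_set_conv_nth)
  have "rowsorted (L @ x # R)" using rowsorted_row_insert[OF r(1), of x] ins by simp
  then have cx: "\<forall>c\<in>set (rev R). \<not> asc c x" and xL: "sorted_wrt (\<lambda>c d. \<not> asc c d) (x # rev L)"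
    using aL by (auto simp: sorted_wrt_append sorted_wrt_rev)
  have "rowsorted (?y # R)" using r(1) by (subst (asm) rr) (simp add: sorted_wrt_append)
  then have "sorted_wrt (\<lambda>c d. \<not> asc c d) (rev R @ [?y])" by (auto simp: sorted_wrt_append sorted_wrt_rev)
  from move_right_small[OF r(3) lets(3) _ this _ cx] aR lets(2)
  have "word_equiv m (x # rev R @ [?y]) (rev R @ [x, ?y])" by simp
  from word_equiv_context[OF this, of "[]" "rev L"]
  have "word_equiv m (x # rev r) (rev R @ x # ?y # rev L)" using lets by (subst rr) simp
  also have "word_equiv m (x # ?y # rev L) (x # rev L @ [?y])"
    using move_right_big[OF r(3) lets(3) _ xL asc_bump[OF b]] lets by simp
  from word_equiv_context[OF this, of "rev R" "[]"]
  have "word_equiv m (rev R @ x # ?y # rev L) (rev R @ x # rev L @ [?y])" using lets by simp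
  finally show ?thesis unfolding ins by simp
qed

lemma word_equiv_insert_rows:
  assumes "pt_rows rs" "concat rs \<in> lists (letters m)" "x \<in> letters m"
  shows "word_equiv m (x # concat (map rev rs)) (concat (map rev (insert_rows x rs)))"
  using assms
proof (induction rs arbitrary: x)
  case Nil then show ?case by (auto intro: word_equiv_refl)
next
  case (Cons r rs)
  have r: "rowsorted r" "r \<in> lists (letters m)" and rs: "pt_rows rs" "concat rs \<in> lists (letters m)"
    using Cons.prems by (auto simp: pt_rows_def)
  have rs': "concat (map rev rs) \<in> lists (letters m)" using rs(2) by auto
  show ?case
  proof (cases "bump x r < length r")
    case True
    let ?y = "r ! bump x r"
    have y: "?y \<in> letters m" using r True by auto
    from word_equiv_context[OF word_equiv_row_insert[OF r Cons.prems(3) True], of "[]" "concat (map rev rs)"] rs'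
    have "word_equiv m (x # rev r @ concat (map rev rs)) (rev (row_insert x r) @ ?y # concat (map rev rs))" by simp
    also have "rev (row_insert x r) \<in> lists (letters m)"
      using word_equiv_letters[OF word_equiv_row_insert[OF r Cons.prems(3) True]] by auto
    from word_equiv_context[OF Cons.IH[OF rs y] this, of "[]"]
    have "word_equiv m (rev (row_insert x r) @ ?y # concat (map rev rs))
      (rev (row_insert x r) @ concat (map rev (insert_rows ?y rs)))" by simp
    finally show ?thesis using True by simp
  next
    case False
    then show ?thesis using word_equiv_refl[of "x # rev r @ concat (map rev rs)"] Cons.prems(3) r rs'
      by (simp add: row_insert_def)
  qed
qed

theorem word_equiv_pt_rows:
  assumes "w \<in> lists (letters m)"
  shows "\<exists>rs. pt_rows rs \<and> concat rs \<in> lists (letters m) \<and> word_equiv m w (concat (map rev rs))"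
  using assms
proof (induction w)
  case Nil
  show ?case using word_equiv_refl[of "[]" m] by (intro exI[of _ "[]"]) (simp add: pt_rows_simps)
next
  case (Cons x w)
  then obtain rs where rs: "pt_rows rs" "concat rs \<in> lists (letters m)" "word_equiv m w (concat (map rev rs))" by auto
  have x: "x \<in> letters m" using Cons by simp
  have "word_equiv m (x # w) (x # concat (map rev rs))"
    using word_equiv_context[OF rs(3), of "[x]" "[]"] x by simp
  also note word_equiv_insert_rows[OF rs(1,2) x]
  finally have eq: "word_equiv m (x # w) (concat (map rev (insert_rows x rs)))" .
  then have "concat (insert_rows x rs) \<in> lists (letters m)" using word_equiv_letters by fastforce
  then show ?case using pt_rows_insert[OF rs(1)] eq by blast
qed

section \<open>Tableaux as fillings of a list of cells\<close>

type_synonym cell = "nat \<times> nat"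

text \<open>The order in which the reading word visits the cells.\<close>

definition before :: "cell \<Rightarrow> cell \<Rightarrow> bool" where
  "before p q \<longleftrightarrow> fst p < fst q \<or> fst p = fst q \<and> snd q < snd p"

text \<open>The order of the cells in the standardization of the filling \<open>T\<close>.\<close>

definition rk :: "(cell \<Rightarrow> rat) \<Rightarrow> cell \<Rightarrow> cell \<Rightarrow> bool" where
  "rk T p q \<longleftrightarrow> T p < T q \<or> T p = T q \<and> (if T p \<in> \<int> then before q p else before p q)"

lemma before_irrefl [simp]: "\<not> before p p" by (simp add: before_def)

lemma before_asym: "before p q \<Longrightarrow> \<not> before q p" by (auto simp: before_def)

lemma before_trans: "before p q \<Longrightarrow> before q r \<Longrightarrow> before p r" by (auto simp: before_def)

lemma before_total: "p \<noteq> q \<Longrightarrow> before p q \<or> before q p"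
  by (cases p; cases q) (auto simp: before_def)

lemma rk_irrefl [simp]: "\<not> rk T p p" by (simp add: rk_def)

lemma rk_trans: "rk T p q \<Longrightarrow> rk T q r \<Longrightarrow> rk T p r"
  unfolding rk_def using before_trans[of p q r] before_trans[of r q p] by (auto split: if_splits)

lemma rk_total: "p \<noteq> q \<Longrightarrow> rk T p q \<or> rk T q p"
  unfolding rk_def using before_total[of p q] by auto

lemma rk_asym: "rk T p q \<Longrightarrow> \<not> rk T q p"
  using rk_trans[of T p q p] by auto

section \<open>Tableau conditions as comparisons of cells\<close>

definition cells :: "shape \<Rightarrow> cell list" where
  "cells s = concat (map (\<lambda>r. rev (map (Pair r) [row_start s r ..< row_start s r + row_length s r]))
     [0 ..< num_rows s])"

lemma reading_word_cells: "reading_word s T = map T (cells s)"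
  by (simp add: reading_word_def cells_def map_concat rev_map o_def)

lemma set_cells: "set (cells s) = diagram s"
  by (auto simp: cells_def diagram_def)

lemma sorted_wrt_concat_map:
  assumes "\<And>x. x \<in> set xs \<Longrightarrow> sorted_wrt P (f x)"
    "sorted_wrt (\<lambda>x y. \<forall>a\<in>set (f x). \<forall>b\<in>set (f y). P a b) xs"
  shows "sorted_wrt P (concat (map f xs))"
  using assms by (induction xs) (auto simp: sorted_wrt_append)

lemma sorted_cells: "sorted_wrt before (cells s)"
proof -
  have "sorted_wrt before (rev (map (Pair r) [a..<b]))" for r a b
    by (auto simp: sorted_wrt_rev sorted_wrt_map before_def intro!: sorted_wrt_mono_rel[OF _ sorted_wrt_upt])
  then show ?thesis unfolding cells_def
    by (intro sorted_wrt_concat_map) (auto simp: before_def intro!: sorted_wrt_mono_rel[OF _ sorted_wrt_upt])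
qed

lemma sorted_before_distinct: "sorted_wrt before cs \<Longrightarrow> distinct cs"
  by (induction cs) auto

lemma distinct_cells: "distinct (cells s)"
  using sorted_before_distinct sorted_cells by blast

text \<open>These are the pairs on which semistandardness imposes a condition. The last alternative
  encodes the rule for the joint, so that rows, columns and joint are treated uniformly.\<close>

definition linked :: "shape \<Rightarrow> (cell \<times> cell) set" where
  "linked s = {(p, q). p \<in> diagram s \<and> q \<in> diagram s \<and>
     (fst p = fst q \<and> snd p < snd q \<or> snd p = snd q \<and> fst p < fst q \<or>
      snd s \<noteq> [] \<and> p \<in> body s \<and> q = joint s)}"

text \<open>Compared with \<open>shapes\<close>, a body without a tail may have any number of rows.
  Row insertion produces such shapes, and the closure results are to cover them as well.\<close>

definition ok_shape :: "nat \<Rightarrow> shape \<Rightarrow> bool" where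
  "ok_shape m s \<longleftrightarrow> sorted_wrt (\<ge>) (fst s) \<and> (\<forall>a\<in>set (snd s). a > 0) \<and>
     (snd s \<noteq> [] \<longrightarrow> length (fst s) = m \<and> (m > 0 \<longrightarrow> fst s ! (m - 1) \<noteq> 0))"

lemma shapes_ok: "s \<in> shapes m \<Longrightarrow> ok_shape m s"
  by (auto simp: shapes_def ok_shape_def)

lemma body_cell: "r < length (fst s) \<Longrightarrow> (r, c) \<in> diagram s \<longleftrightarrow> c < fst s ! r"
  by (auto simp: diagram_def row_start_def row_length_def num_rows_def nth_append)

lemma body_iff: "(r, c) \<in> body s \<longleftrightarrow> r < length (fst s) \<and> c < fst s ! r"
  using body_cell[of r s c] by (auto simp: body_def)

lemma ok_shape_down:
  assumes "ok_shape m s" "r' < length (fst s)" "(r', c') \<in> diagram s" "r \<le> r'" "c \<le> c'"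
  shows "(r, c) \<in> diagram s"
proof -
  have "fst s ! r' \<le> fst s ! r"
  proof (cases "r = r'")
    case False
    then show ?thesis using assms sorted_wrt_nth_less[of "(\<ge>)" "fst s" r r'] by (auto simp: ok_shape_def)
  qed simp
  then show ?thesis using assms body_cell[of r s c] body_cell[of r' s c'] by simp
qed

lemma joint_diagram:
  assumes "ok_shape m s" "snd s \<noteq> []"
  shows "joint s \<in> diagram s" "length (fst s) = m" "k < m \<Longrightarrow> (k, 0) \<in> diagram s"
proof -
  show m: "length (fst s) = m" using assms by (simp add: ok_shape_def)
  show "joint s \<in> diagram s" using assms
    by (cases "snd s") (auto simp: joint_def diagram_def row_start_def row_length_def num_rows_def nth_append ok_shape_def)
  assume k: "k < m"
  then have "fst s ! (m - 1) > 0" using assms by (simp add: ok_shape_def)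
  then have "(m - 1, 0) \<in> diagram s" using body_cell[of "m - 1" s 0] k m by simp
  then show "(k, 0) \<in> diagram s" using ok_shape_down[OF assms(1), of "m - 1" 0 k 0] k m by simp
qed

section \<open>Positivity of the entries from row \<open>m\<close> on\<close>

lemma letter_ge: "x \<in> letters m \<Longrightarrow> x > 0 \<or> x \<ge> - of_nat m"
proof -
  assume "x \<in> letters m"
  then consider k :: int where "x = of_int k" "- int m \<le> k" | k :: int where "x = of_int k + 1/2" "k \<ge> 0"
    unfolding letters_iff by blast
  then show ?thesis
  proof cases
    case (1 k)
    then have "of_int (- int m) \<le> x" using of_int_le_iff by blast
    then show ?thesis by simp
  next
    case (2 k)
    then have "0 \<le> (of_int k :: rat)" by simp
    then have "x > 0" using 2(1) by linarith
    then show ?thesis ..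
  qed
qed

lemma letter_nonzero: "x \<in> letters m \<Longrightarrow> x \<noteq> 0"
  using int_letter[of 0 m] by auto

lemma neg_letter_Ints: "x \<in> letters m \<Longrightarrow> x \<le> 0 \<Longrightarrow> x \<in> \<int>"
  using letter_half[of x m] by force

lemma Ints_less_imp_le: "x \<in> \<int> \<Longrightarrow> y \<in> \<int> \<Longrightarrow> x < y \<Longrightarrow> x + 1 \<le> (y :: rat)"
  by (auto elim!: Ints_cases)

text \<open>A column starts with at least -m, and as long as its entries are negative they are
  integers that increase strictly, hence by at least 1 per row. In row \<open>m\<close> only 0 would
  remain, which is not a letter.\<close>

lemma column_bound:
  assumes "\<And>k. k \<le> r \<Longrightarrow> T (k, c) \<in> letters m"
    "\<And>k. k < r \<Longrightarrow> T (k, c) < T (Suc k, c) \<or> T (k, c) = T (Suc k, c) \<and> T (k, c) \<notin> \<int>"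
  shows "T (r, c) > 0 \<or> T (r, c) \<ge> of_nat r - of_nat m"
  using assms
proof (induction r)
  case 0 then show ?case using letter_ge[of "T (0, c)" m] by auto
next
  case (Suc r)
  have IH: "T (r, c) > 0 \<or> T (r, c) \<ge> of_nat r - of_nat m" using Suc by simp
  show ?case
  proof (cases "T (Suc r, c) > 0")
    case False
    then have s: "T (Suc r, c) \<in> \<int>" using neg_letter_Ints[of "T (Suc r, c)" m] Suc.prems(1) by simp
    have le: "T (r, c) \<le> T (Suc r, c)" using Suc.prems(2)[of r] by auto
    then have n: "T (r, c) \<le> 0" using False by simp
    then have "T (r, c) \<in> \<int>" using neg_letter_Ints[of "T (r, c)" m] Suc.prems(1) by simp
    then have "T (r, c) < T (Suc r, c)" using Suc.prems(2)[of r] by auto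
    then have "T (r, c) + 1 \<le> T (Suc r, c)" using Ints_less_imp_le \<open>T (r, c) \<in> \<int>\<close> s by blast
    then show ?thesis using IH n by auto
  qed simp
qed

lemma column_bound_pos:
  assumes "\<And>k. k \<le> m \<Longrightarrow> T (k, c) \<in> letters m"
    "\<And>k. k < m \<Longrightarrow> T (k, c) < T (Suc k, c) \<or> T (k, c) = T (Suc k, c) \<and> T (k, c) \<notin> \<int>"
  shows "T (m, c) > 0"
  using column_bound[of m T c m] assms letter_nonzero[of "T (m, c)" m] by fastforce

lemma rk_row: "fst p = fst q \<Longrightarrow> snd p < snd q \<Longrightarrow> rk T p q \<longleftrightarrow> T p < T q \<or> T p = T q \<and> T p \<in> \<int>"
  by (auto simp: rk_def before_def)

lemma rk_col: "fst p < fst q \<Longrightarrow> rk T p q \<longleftrightarrow> asc (T p) (T q)"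
  by (auto simp: rk_def before_def asc_def)

text \<open>The conditions on the joint speak only of positive joint entries; by
  \<open>column_bound_pos\<close> this is always the case. All body cells are read before the joint,
  so an equality is compatible with \<open>rk\<close> exactly for odd letters, which separates the
  strict from the weak condition.\<close>

lemma tableaux_iff:
  assumes ok: "ok_shape m s"
  shows "T \<in> tableaux m s \<longleftrightarrow> T \<in> diagram s \<rightarrow>\<^sub>E letters m \<and> (\<forall>(p, q)\<in>linked s. rk T p q)"
proof
  assume T: "T \<in> tableaux m s"
  then have lets: "T \<in> diagram s \<rightarrow>\<^sub>E letters m"
    and row: "\<And>r c c'. (r, c) \<in> diagram s \<Longrightarrow> (r, c') \<in> diagram s \<Longrightarrow> c < c' \<Longrightarrow>
        T (r, c) \<le> T (r, c') \<and> (T (r, c) = T (r, c') \<longrightarrow> T (r, c) \<in> \<int>)"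
    and col: "\<And>r r' c. (r, c) \<in> diagram s \<Longrightarrow> (r', c) \<in> diagram s \<Longrightarrow> r < r' \<Longrightarrow>
        T (r, c) \<le> T (r', c) \<and> (T (r, c) = T (r', c) \<longrightarrow> T (r, c) \<notin> \<int>)"
    and j1: "\<And>x. snd s \<noteq> [] \<Longrightarrow> T (joint s) \<in> \<int> \<Longrightarrow> T (joint s) > 0 \<Longrightarrow> x \<in> body s \<Longrightarrow> T x < T (joint s)"
    and j2: "\<And>x. snd s \<noteq> [] \<Longrightarrow> T (joint s) \<in> pos_half_odds \<Longrightarrow> x \<in> body s \<Longrightarrow> T x \<le> T (joint s)"
    unfolding tableaux_def by blast+
  have "rk T p q" if pq: "(p, q) \<in> linked s" for p q
  proof -
    consider "fst p = fst q" "snd p < snd q" | "snd p = snd q" "fst p < fst q"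
      | "snd s \<noteq> []" "p \<in> body s" "q = joint s" using pq by (auto simp: linked_def)
    then show ?thesis
    proof cases
      case 1
      moreover have e: "(fst p, snd p) = p" "(fst p, snd q) = q" using 1(1) by (metis prod.collapse)+
      moreover have "(fst p, snd p) \<in> diagram s" "(fst p, snd q) \<in> diagram s"
        unfolding e using pq by (auto simp: linked_def)
      note row[OF this 1(2)]
      ultimately show ?thesis unfolding rk_row[OF 1] by (metis order_le_less)
    next
      case 2
      moreover have e: "(fst p, snd p) = p" "(fst q, snd p) = q" using 2(1) by (metis prod.collapse)+
      moreover have "(fst p, snd p) \<in> diagram s" "(fst q, snd p) \<in> diagram s"
        unfolding e using pq by (auto simp: linked_def)
      note col[OF this 2(2)]
      ultimately show ?thesis unfolding rk_col[OF 2(2)] asc_def by (metis order_le_less)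
    next
      case 3
      note J = joint_diagram[OF ok 3(1)]
      have d: "(k, 0) \<in> diagram s" if "k \<le> m" for k
        using J that by (cases "k = m") (auto simp: joint_def)
      have "T (m, 0) > 0"
      proof (rule column_bound_pos)
        show "T (k, 0) \<in> letters m" if "k \<le> m" for k using d[OF that] lets by auto
        show "T (k, 0) < T (Suc k, 0) \<or> T (k, 0) = T (Suc k, 0) \<and> T (k, 0) \<notin> \<int>" if "k < m" for k
          using col[of k 0 "Suc k"] d that by fastforce
      qed
      then have jp: "T (joint s) > 0" using J by (simp add: joint_def)
      have jl: "T (joint s) \<in> letters m" using J lets by auto
      have bq: "before p q" using 3 J by (cases p) (auto simp: body_def joint_def before_def)
      show ?thesis
      proof (cases "T (joint s) \<in> \<int>")
        case True then show ?thesis using j1[OF 3(1) True jp 3(2)] 3 by (simp add: rk_def)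
      next
        case False
        then obtain k :: int where k: "T (joint s) = of_int k + 1/2" "k \<ge> 0" using jl unfolding letters_iff by auto
        then have "T (joint s) = 1/2 + of_nat (nat k)" by simp
        then have "T (joint s) \<in> pos_half_odds" unfolding pos_half_odds_def by blast
        then have "T p \<le> T (joint s)" using j2 3 by blast
        then show ?thesis using False 3 bq by (auto simp: rk_def)
      qed
    qed
  qed
  then show "T \<in> diagram s \<rightarrow>\<^sub>E letters m \<and> (\<forall>(p, q)\<in>linked s. rk T p q)" using lets by blast
next
  assume R: "T \<in> diagram s \<rightarrow>\<^sub>E letters m \<and> (\<forall>(p, q)\<in>linked s. rk T p q)"
  show "T \<in> tableaux m s" unfolding tableaux_def
  proof (intro CollectI conjI allI impI ballI)
    show "T \<in> diagram s \<rightarrow>\<^sub>E letters m" using R by blast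
  next
    fix r c c' assume a: "(r, c) \<in> diagram s \<and> (r, c') \<in> diagram s \<and> c < c'"
    then have "rk T (r, c) (r, c')" using R by (auto simp: linked_def)
    then show "T (r, c) \<le> T (r, c')" "T (r, c) = T (r, c') \<Longrightarrow> T (r, c) \<in> \<int>"
      using a by (auto simp: rk_def before_def split: if_splits)
  next
    fix r r' c assume a: "(r, c) \<in> diagram s \<and> (r', c) \<in> diagram s \<and> r < r'"
    then have "rk T (r, c) (r', c)" using R by (auto simp: linked_def)
    then show "T (r, c) \<le> T (r', c)" "T (r, c) = T (r', c) \<Longrightarrow> T (r, c) \<notin> \<int>"
      using a by (auto simp: rk_def before_def split: if_splits)
  next
    fix x assume a: "snd s \<noteq> [] \<and> T (joint s) \<in> \<int> \<and> 0 < T (joint s)" "x \<in> body s"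
    then have "(x, joint s) \<in> linked s" using joint_diagram(1)[OF ok] by (auto simp: linked_def body_def)
    then have "rk T x (joint s)" using R by blast
    then show "T x < T (joint s)" using a by (cases x) (auto simp: rk_def before_def joint_def body_def split: if_splits)
  next
    fix x assume a: "snd s \<noteq> [] \<and> T (joint s) \<in> pos_half_odds" "x \<in> body s"
    then have "(x, joint s) \<in> linked s" using joint_diagram(1)[OF ok] by (auto simp: linked_def body_def)
    then have "rk T x (joint s)" using R by blast
    then show "T x \<le> T (joint s)" by (auto simp: rk_def)
  qed
qed

context
  fixes m s T assumes ok: "ok_shape m s" and T: "T \<in> tableaux m s"
begin

lemma tab_letter: "p \<in> diagram s \<Longrightarrow> T p \<in> letters m"
  using T unfolding tableaux_iff[OF ok] by auto

lemma tab_linked: "(p, q) \<in> linked s \<Longrightarrow> rk T p q"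
  using T unfolding tableaux_iff[OF ok] by auto

lemma tab_row: "(r, c) \<in> diagram s \<Longrightarrow> (r, c') \<in> diagram s \<Longrightarrow> c < c' \<Longrightarrow>
    T (r, c) < T (r, c') \<or> T (r, c) = T (r, c') \<and> T (r, c) \<in> \<int>"
  using tab_linked[of "(r, c)" "(r, c')"] by (auto simp: linked_def rk_row)

lemma tab_row_le: "(r, c) \<in> diagram s \<Longrightarrow> (r, c') \<in> diagram s \<Longrightarrow> c \<le> c' \<Longrightarrow> T (r, c) \<le> T (r, c')"
  using tab_row[of r c c'] by (cases "c = c'") auto

lemma tab_col: "(r, c) \<in> diagram s \<Longrightarrow> (r', c) \<in> diagram s \<Longrightarrow> r < r' \<Longrightarrow> asc (T (r, c)) (T (r', c))"
  using tab_linked[of "(r, c)" "(r', c)"] by (auto simp: linked_def rk_col)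

lemma tab_first_column_pos:
  assumes "\<And>k. k \<le> m \<Longrightarrow> (k, 0) \<in> diagram s"
  shows "T (m, 0) > 0"
proof (rule column_bound_pos)
  show "T (k, 0) \<in> letters m" if "k \<le> m" for k using assms[OF that] tab_letter by auto
  show "T (k, 0) < T (Suc k, 0) \<or> T (k, 0) = T (Suc k, 0) \<and> T (k, 0) \<notin> \<int>" if "k < m" for k
    using tab_col[of k 0 "Suc k"] assms that by (auto simp: asc_def)
qed

lemma tab_joint_pos: assumes "snd s \<noteq> []" shows "T (joint s) > 0"
proof -
  note J = joint_diagram[OF ok assms]
  have "(k, 0) \<in> diagram s" if "k \<le> m" for k using J that by (cases "k = m") (auto simp: joint_def)
  then show ?thesis using tab_first_column_pos J by (simp add: joint_def)
qed

lemma row_start_cell: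
  assumes "(r, c) \<in> diagram s" shows "(r, row_start s r) \<in> diagram s" "row_start s r \<le> c"
  using assms by (auto simp: diagram_def)

text \<open>Consecutive rows of the ribbon overlap in one column. Positivity of the row lengths
  makes the truncated \<open>- 1\<close> in \<open>row_start\<close> a true subtraction.\<close>

lemma tail_step:
  assumes "length (fst s) \<le> r" "(Suc r, c) \<in> diagram s"
  shows "(r, row_start s (Suc r)) \<in> diagram s"
proof -
  have pos: "snd s ! (r - length (fst s)) > 0"
  proof -
    have "r - length (fst s) < length (snd s)" using assms by (auto simp: diagram_def num_rows_def)
    then show ?thesis using ok nth_mem unfolding ok_shape_def by blast
  qed
  have "Suc r - length (fst s) = Suc (r - length (fst s))" using assms by simp
  then have "row_start s (Suc r) = row_start s r + (snd s ! (r - length (fst s)) - 1)"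
    by (simp add: row_start_def)
  then show ?thesis using assms pos
    by (auto simp: diagram_def row_length_def num_rows_def nth_append)
qed

lemma tab_tail_ge_joint:
  assumes "(r, c) \<in> diagram s" "r \<ge> length (fst s)"
  shows "T (r, c) \<ge> T (joint s)"
proof -
  have "T (r, row_start s r) \<ge> T (joint s)" using assms
  proof (induction "r - length (fst s)" arbitrary: r c)
    case 0
    then have "r = length (fst s)" by simp
    then show ?case by (simp add: joint_def row_start_def)
  next
    case (Suc n)
    then obtain r' where r': "r = Suc r'" "n = r' - length (fst s)" "r' \<ge> length (fst s)"
      by (cases r) auto
    have d: "(r', row_start s r) \<in> diagram s" using tail_step[OF r'(3)] Suc r' by blast
    have "T (joint s) \<le> T (r', row_start s r')" using Suc.hyps(1)[OF r'(2) d r'(3)] .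
    also have "\<dots> \<le> T (r', row_start s r)" using tab_row_le row_start_cell[OF d] d by blast
    also have "\<dots> \<le> T (r, row_start s r)"
      using tab_col[OF d, of r] row_start_cell(1)[OF Suc.prems(1)] r' by (auto simp: asc_def)
    finally show ?case .
  qed
  then show ?thesis using tab_row_le row_start_cell[OF assms(1)] assms(1) by (meson order.trans)
qed

lemma tab_tail_pos:
  assumes "(r, c) \<in> diagram s" "r \<ge> length (fst s)" shows "T (r, c) > 0"
proof -
  have "snd s \<noteq> []" using assms by (auto simp: diagram_def num_rows_def)
  then show ?thesis using tab_tail_ge_joint[OF assms] tab_joint_pos by simp
qed

end

section \<open>Closure of tableaux under the operators\<close>

text \<open>The counterpart of \<open>f_split\<close> for cells. It does not mention the letter in
  the cell, so raising and lowering are handled together.\<close>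

definition acted :: "nat \<Rightarrow> rat \<Rightarrow> (cell \<Rightarrow> rat) \<Rightarrow> cell list \<Rightarrow> cell \<Rightarrow> bool" where
  "acted m i T cs c \<longleftrightarrow> (\<exists>A B. cs = A @ c # B \<and> clear_left m i (map T A) \<and> clear_right m i (map T B))"

lemma map_fun_upd_split:
  assumes "distinct (A @ c # B)"
  shows "map (T(c := v)) (A @ c # B) = map T A @ v # map T B"
  using assms by auto

lemma f_map:
  assumes i: "i \<in> index_set m" and cs: "distinct cs"
  shows "f_op (word_crystal m) i (map T cs) = Some w \<longleftrightarrow>
    (\<exists>c. acted m i T cs c \<and> T c = src i \<and> w = map (T(c := tgt i)) cs)"
proof
  assume "f_op (word_crystal m) i (map T cs) = Some w"
  then obtain u v where uv: "map T cs = u @ src i # v" "w = u @ tgt i # v" "clear_left m i u" "clear_right m i v"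
    unfolding f_split[OF i] by blast
  then obtain A c B where *: "cs = A @ c # B" "map T A = u" "T c = src i" "map T B = v"
    by (auto simp: map_eq_append_conv Cons_eq_map_conv map_eq_Cons_conv)
  have "acted m i T cs c" using * uv unfolding acted_def by blast
  moreover have "w = map (T(c := tgt i)) cs"
    using map_fun_upd_split[of A c B T "tgt i"] cs * uv by simp
  ultimately show "\<exists>c. acted m i T cs c \<and> T c = src i \<and> w = map (T(c := tgt i)) cs" using *(3) by blast
next
  assume "\<exists>c. acted m i T cs c \<and> T c = src i \<and> w = map (T(c := tgt i)) cs"
  then obtain c A B where "cs = A @ c # B" "clear_left m i (map T A)" "clear_right m i (map T B)"
    "T c = src i" "w = map (T(c := tgt i)) cs" unfolding acted_def by blast
  then show "f_op (word_crystal m) i (map T cs) = Some w"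
    unfolding f_split[OF i] using cs map_fun_upd_split[of A c B T] by auto
qed

lemma e_map:
  assumes i: "i \<in> index_set m" and cs: "distinct cs" and l: "\<And>c. c \<in> set cs \<Longrightarrow> T c \<in> letters m"
  shows "e_op (word_crystal m) i (map T cs) = Some w \<longleftrightarrow>
    (\<exists>c. acted m i T cs c \<and> T c = tgt i \<and> w = map (T(c := src i)) cs)"
proof -
  have W: "map T cs \<in> lists (letters m)" using l by auto
  show ?thesis
  proof
    assume "e_op (word_crystal m) i (map T cs) = Some w"
    then obtain u v where uv: "map T cs = u @ tgt i # v" "w = u @ src i # v" "clear_left m i u" "clear_right m i v"
      unfolding e_split[OF i W] by blast
    then obtain A c B where *: "cs = A @ c # B" "map T A = u" "T c = tgt i" "map T B = v"
      by (auto simp: map_eq_append_conv Cons_eq_map_conv map_eq_Cons_conv)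
    have "acted m i T cs c" using * uv unfolding acted_def by blast
    moreover have "w = map (T(c := src i)) cs"
      using map_fun_upd_split[of A c B T "src i"] cs * uv by simp
    ultimately show "\<exists>c. acted m i T cs c \<and> T c = tgt i \<and> w = map (T(c := src i)) cs" using *(3) by blast
  next
    assume "\<exists>c. acted m i T cs c \<and> T c = tgt i \<and> w = map (T(c := src i)) cs"
    then obtain c A B where "cs = A @ c # B" "clear_left m i (map T A)" "clear_right m i (map T B)"
      "T c = tgt i" "w = map (T(c := src i)) cs" unfolding acted_def by blast
    then show "e_op (word_crystal m) i (map T cs) = Some w"
      unfolding e_split[OF i W] using cs map_fun_upd_split[of A c B T] by auto
  qed
qed

lemma acted_mem: "acted m i T cs c \<Longrightarrow> c \<in> set cs"
  by (auto simp: acted_def)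

lemma acted_nonneg:
  assumes "acted m i T cs c" "sorted_wrt before cs" "i \<ge> 0" "d \<in> set cs" "d \<noteq> c"
    "T d = src i \<or> T d = tgt i"
  shows "i \<in> \<int> \<Longrightarrow> before c d" "i \<notin> \<int> \<Longrightarrow> before d c"
proof -
  obtain A B where cs: "cs = A @ c # B" "clear_left m i (map T A)" "clear_right m i (map T B)"
    using assms(1) unfolding acted_def by blast
  have A: "d \<notin> set A" if "i \<in> \<int>"
  proof
    assume "d \<in> set A"
    then have "T d \<in> set (map T A)" by simp
    then show False using cs(2) assms(3,6) that unfolding clear_left_def touches_def by auto
  qed
  have B: "d \<notin> set B" if "i \<notin> \<int>"
  proof
    assume "d \<in> set B"
    then have "T d \<in> set (map T B)" by simp
    then show False using cs(3) assms(3,6) that unfolding clear_right_def touches_def by auto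
  qed
  show "before c d" if "i \<in> \<int>" using A[OF that] assms(2,4,5) cs by (auto simp: sorted_wrt_append)
  show "before d c" if "i \<notin> \<int>" using B[OF that] assms(2,4,5) cs by (auto simp: sorted_wrt_append)
qed

lemma count_list_map_distinct:
  "distinct xs \<Longrightarrow> count_list (map T xs) v = card {d \<in> set xs. T d = v}"
proof (induction xs)
  case (Cons x xs)
  have "{d \<in> set (x # xs). T d = v} = (if T x = v then insert x {d \<in> set xs. T d = v} else {d \<in> set xs. T d = v})"
    by auto
  then show ?case using Cons by auto
qed simp

text \<open>The sets are intervals of the reading order from \<open>q\<close> up to
  \<open>c\<close>, or from \<open>c\<close> up to \<open>q\<close>, without \<open>c\<close>
  itself. They form a suffix of the part read before \<open>c\<close> or a prefix of the part read
  after it, so \<open>phi_0_suffix\<close> and \<open>eps_0_prefix\<close> apply.\<close>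

lemma acted_neg:
  assumes i: "i \<in> index_set m" "i < 0" and a: "acted m i T cs c" and s: "sorted_wrt before cs"
    and q: "q \<in> set cs"
  shows "before q c \<Longrightarrow> card {d \<in> set cs. \<not> before d q \<and> before d c \<and> T d = src i}
      \<le> card {d \<in> set cs. \<not> before d q \<and> before d c \<and> T d = tgt i}"
    and "before c q \<Longrightarrow> card {d \<in> set cs. before c d \<and> \<not> before q d \<and> T d = tgt i}
      \<le> card {d \<in> set cs. before c d \<and> \<not> before q d \<and> T d = src i}"
proof -
  obtain A B where cs: "cs = A @ c # B" "phi (word_crystal m) i (map T A) = 0" "eps (word_crystal m) i (map T B) = 0"
    using a i unfolding acted_def clear_left_def clear_right_def by auto
  have d: "distinct cs" using s sorted_before_distinct by blast
  { assume "before q c"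
    then have "q \<in> set A" using q s cs by (auto simp: sorted_wrt_append dest: before_asym)
    then obtain A1 A2 where A: "A = A1 @ q # A2" by (meson split_list)
    have eq: "{d \<in> set cs. \<not> before d q \<and> before d c \<and> T d = v} = {d \<in> set (q # A2). T d = v}" for v
      using s unfolding cs A by (auto simp: sorted_wrt_append dest: before_asym)
    have "phi (word_crystal m) i (map T A1 @ map T (q # A2)) = 0" using cs(2) A by simp
    from phi_0_suffix[OF i this]
    show "card {d \<in> set cs. \<not> before d q \<and> before d c \<and> T d = src i}
        \<le> card {d \<in> set cs. \<not> before d q \<and> before d c \<and> T d = tgt i}"
      unfolding eq using d cs A count_list_map_distinct[of "q # A2" T] by simp }
  { assume "before c q"
    then have "q \<in> set B" using q s cs by (auto simp: sorted_wrt_append dest: before_asym)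
    then obtain B1 B2 where B: "B = B1 @ q # B2" by (meson split_list)
    have eq: "{d \<in> set cs. before c d \<and> \<not> before q d \<and> T d = v} = {d \<in> set (B1 @ [q]). T d = v}" for v
      using s unfolding cs B by (auto simp: sorted_wrt_append dest: before_asym)
    have "eps (word_crystal m) i (map T (B1 @ [q]) @ map T B2) = 0" using cs(3) B by simp
    from eps_0_prefix[OF i this]
    show "card {d \<in> set cs. before c d \<and> \<not> before q d \<and> T d = tgt i}
        \<le> card {d \<in> set cs. before c d \<and> \<not> before q d \<and> T d = src i}"
      unfolding eq using d cs B count_list_map_distinct[of "B1 @ [q]" T] by simp }
qed

text \<open>For an integer i the cell \<open>c\<close> is the first with letter \<open>src i\<close>
  or \<open>tgt i\<close>. Since \<open>src i\<close> is even and \<open>tgt i\<close> odd,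
  \<open>c\<close> would rank last among the cells with \<open>src i\<close> and first among those
  with \<open>tgt i\<close>, so its place in the standardization is the same with either letter. For
  the other i the parities and the end of the word are both reversed.\<close>

lemma rk_upd_nonneg:
  assumes i: "i \<in> index_set m" "i \<ge> 0" and a: "acted m i T cs c" and s: "sorted_wrt before cs"
    and l: "\<And>d. d \<in> set cs \<Longrightarrow> T d \<in> letters m"
    and tv: "T c = src i \<and> v = tgt i \<or> T c = tgt i \<and> v = src i"
    and pq: "p \<in> set cs" "q \<in> set cs" "rk T p q"
  shows "rk (T(c := v)) p q"
proof -
  have par: "src i \<in> \<int> \<longleftrightarrow> i \<in> \<int>" "tgt i \<in> \<int> \<longleftrightarrow> i \<notin> \<int>"
    using src_parity[OF i(1)] tgt_parity[OF i(1)] i(2) by auto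
  note st = src_less_tgt[OF i(1)]
  have ne: "p \<noteq> q" using pq(3) by auto
  note N = acted_nonneg[OF a s i(2)]
  consider "p = c" | "q = c" | "p \<noteq> c" "q \<noteq> c" by blast
  then show ?thesis
  proof cases
    case 1
    note g = letter_gap[OF i(1) l[OF pq(2)]]
    have N': "T q = src i \<or> T q = tgt i \<Longrightarrow> i \<in> \<int> \<Longrightarrow> before p q"
      "T q = src i \<or> T q = tgt i \<Longrightarrow> i \<notin> \<int> \<Longrightarrow> before q p" using N[OF pq(2)] ne 1 by auto
    show ?thesis using tv
    proof
      assume h: "T c = src i \<and> v = tgt i"
      have "T q \<noteq> src i" using pq(3) h 1 N' par by (cases "i \<in> \<int>") (auto simp: rk_def dest: before_asym)
      then have "tgt i \<le> T q" using g pq(3) h 1 by (auto simp: rk_def)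
      then show ?thesis using h 1 ne par N' by (auto simp: rk_def)
    next
      assume h: "T c = tgt i \<and> v = src i"
      then show ?thesis using pq(3) 1 ne st by (auto simp: rk_def)
    qed
  next
    case 2
    note g = letter_gap[OF i(1) l[OF pq(1)]]
    have N': "T p = src i \<or> T p = tgt i \<Longrightarrow> i \<in> \<int> \<Longrightarrow> before q p"
      "T p = src i \<or> T p = tgt i \<Longrightarrow> i \<notin> \<int> \<Longrightarrow> before p q" using N[OF pq(1)] ne 2 by auto
    show ?thesis using tv
    proof
      assume h: "T c = src i \<and> v = tgt i"
      then show ?thesis using pq(3) 2 ne st by (auto simp: rk_def)
    next
      assume h: "T c = tgt i \<and> v = src i"
      have "T p \<noteq> tgt i" using pq(3) h 2 N' par by (cases "i \<in> \<int>") (auto simp: rk_def dest: before_asym)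
      then have "T p \<le> src i" using g pq(3) h 2 by (auto simp: rk_def)
      then show ?thesis using h 2 ne par N' by (auto simp: rk_def)
    qed
  next
    case 3
    then show ?thesis using pq(3) by (simp add: rk_def)
  qed
qed

context
  fixes m s T i c assumes ok: "ok_shape m s" and T: "T \<in> tableaux m s"
    and i: "i \<in> index_set m" "i < 0" and a: "acted m i T (cells s) c"
begin

lemma src_tgt_neg_Ints: "src i \<in> \<int>" "tgt i \<in> \<int>" "tgt i < 0" "src i < 0"
  using src_parity[OF i(1)] tgt_parity[OF i(1)] neg_index_Ints[OF i] i(2) src_less_tgt[OF i(1)]
  by (auto simp: tgt_def)

lemma acted_cell: "c \<in> diagram s"
  using acted_mem[OF a] set_cells by simp

lemma neg_in_body:
  assumes "(r, y) \<in> diagram s" "T (r, y) < 0" shows "r < length (fst s)"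
  using tab_tail_pos[OF ok T assms(1)] assms(2) by force

lemma less_tgt_iff: "x \<in> letters m \<Longrightarrow> x < tgt i \<longleftrightarrow> x \<le> src i" "x \<in> letters m \<Longrightarrow> src i < x \<longleftrightarrow> tgt i \<le> x"
  using letter_gap[OF i(1), of x] src_less_tgt[OF i(1)] by auto

text \<open>The interval from \<open>(r, y)\<close> up to \<open>c\<close> lies in one row, where
  the entries are at most \<open>src i\<close>. It contains a \<open>src i\<close> and no
  \<open>tgt i\<close>, against the ballot inequality.\<close>

lemma no_src_right:
  assumes "c = (r, j)" "T c = src i" "(r, y) \<in> diagram s" "j < y"
  shows "T (r, y) \<noteq> src i"
proof
  assume eq: "T (r, y) = src i"
  have b: "before (r, y) c" using assms by (simp add: before_def)
  have emp: "{d \<in> set (cells s). \<not> before d (r, y) \<and> before d c \<and> T d = tgt i} = {}"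
  proof -
    have "T d \<noteq> tgt i" if d: "d \<in> diagram s" "\<not> before d (r, y)" "before d c" for d
    proof -
      have "fst d = r" "snd d \<le> y" using d(2,3) assms by (auto simp: before_def)
      then have "T d \<le> T (r, y)" using tab_row_le[OF ok T, of r "snd d" y] d(1) assms(3) by (cases d) auto
      then show ?thesis using eq src_less_tgt[OF i(1)] by simp
    qed
    then show ?thesis unfolding set_cells by blast
  qed
  have c0: "card {d \<in> set (cells s). \<not> before d (r, y) \<and> before d c \<and> T d = tgt i} = 0" unfolding emp by simp
  have "(r, y) \<in> {d \<in> set (cells s). \<not> before d (r, y) \<and> before d c \<and> T d = src i}"
    using assms eq b set_cells by auto
  then have cpos: "card {d \<in> set (cells s). \<not> before d (r, y) \<and> before d c \<and> T d = src i} > 0"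
    by (intro card_gt_0_iff[THEN iffD2] conjI) (blast, simp)
  have qd: "(r, y) \<in> set (cells s)" using assms(3) set_cells by simp
  show False using acted_neg(1)[OF i a sorted_cells qd b] c0 cpos by linarith
qed

text \<open>The mirror image of \<open>no_src_right\<close>, on the interval read after
  \<open>c\<close>.\<close>

lemma no_tgt_left:
  assumes "c = (r, j)" "T c = tgt i" "(r, y) \<in> diagram s" "y < j"
  shows "T (r, y) \<noteq> tgt i"
proof
  assume eq: "T (r, y) = tgt i"
  have b: "before c (r, y)" using assms by (simp add: before_def)
  have emp: "{d \<in> set (cells s). before c d \<and> \<not> before (r, y) d \<and> T d = src i} = {}"
  proof -
    have "T d \<noteq> src i" if d: "d \<in> diagram s" "\<not> before (r, y) d" "before c d" for d
    proof -
      have "fst d = r" "y \<le> snd d" using d(2,3) assms by (auto simp: before_def)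
      then have "T d \<ge> T (r, y)" using tab_row_le[OF ok T, of r y "snd d"] d(1) assms(3) by (cases d) auto
      then show ?thesis using eq src_less_tgt[OF i(1)] by simp
    qed
    then show ?thesis unfolding set_cells by blast
  qed
  have c0: "card {d \<in> set (cells s). before c d \<and> \<not> before (r, y) d \<and> T d = src i} = 0" unfolding emp by simp
  have "(r, y) \<in> {d \<in> set (cells s). before c d \<and> \<not> before (r, y) d \<and> T d = tgt i}"
    using assms eq b set_cells by auto
  then have cpos: "card {d \<in> set (cells s). before c d \<and> \<not> before (r, y) d \<and> T d = tgt i} > 0"
    by (intro card_gt_0_iff[THEN iffD2] conjI) (blast, simp)
  have qd: "(r, y) \<in> set (cells s)" using assms(3) set_cells by simp
  show False using acted_neg(2)[OF i a sorted_cells qd b] c0 cpos by linarith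
qed

text \<open>In row \<open>r\<close>, the cells with letter \<open>src i\<close> to the left of \<open>c\<close> are matched with the cells below
  them, which leaves no partner for the cell below \<open>c\<close>.\<close>

lemma no_tgt_below:
  assumes c: "c = (r, j)" "T c = src i" and q: "(r', j) \<in> diagram s" "r < r'"
  shows "T (r', j) \<noteq> tgt i"
proof
  assume eq: "T (r', j) = tgt i"
  have cd: "(r, j) \<in> diagram s" using acted_cell c by simp
  have r'b: "r' < length (fst s)" using neg_in_body[OF q(1)] eq src_tgt_neg_Ints by simp
  have r1: "(Suc r, j) \<in> diagram s" using ok_shape_down[OF ok r'b q(1)] q(2) by simp
  have "asc (src i) (T (Suc r, j))" using tab_col[OF ok T cd r1] c by simp
  then have ge: "tgt i \<le> T (Suc r, j)" using src_tgt_neg_Ints(1) less_tgt_iff(2)[OF tab_letter[OF ok T r1]] by (auto simp: asc_def)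
  have r': "r' = Suc r"
  proof (rule ccontr)
    assume "r' \<noteq> Suc r"
    then have "asc (T (Suc r, j)) (tgt i)" using tab_col[OF ok T r1 q(1)] q(2) eq by simp
    then show False using ge src_tgt_neg_Ints(2) by (auto simp: asc_def)
  qed
  define j0 where "j0 = (LEAST y. (r, y) \<in> diagram s \<and> T (r, y) = src i)"
  have j0: "(r, j0) \<in> diagram s" "T (r, j0) = src i" "j0 \<le> j"
    using LeastI[of "\<lambda>y. (r, y) \<in> diagram s \<and> T (r, y) = src i" j]
      Least_le[of "\<lambda>y. (r, y) \<in> diagram s \<and> T (r, y) = src i" j] cd c unfolding j0_def by auto
  have j0min: "j0 \<le> y" if "(r, y) \<in> diagram s" "T (r, y) = src i" for y
    unfolding j0_def by (rule Least_le) (use that in simp)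
  have dn: "(Suc r, y) \<in> diagram s \<and> (r, y) \<in> diagram s" if "y \<le> j" for y
    using ok_shape_down[OF ok r'b q(1), of "Suc r" y] ok_shape_down[OF ok r'b q(1), of r y] that q(2) by simp
  have mid: "T (Suc r, y) = tgt i" if y: "j0 \<le> y" "y \<le> j" for y
  proof -
    have "T (r, y) = src i" using tab_row_le[OF ok T, of r j0 y] tab_row_le[OF ok T, of r y j] j0 dn[OF y(2)] y cd c by auto
    then have "asc (src i) (T (Suc r, y))" using tab_col[OF ok T, of r y "Suc r"] dn[OF y(2)] by simp
    then have "tgt i \<le> T (Suc r, y)" using src_tgt_neg_Ints(1) less_tgt_iff(2)[OF tab_letter[OF ok T]] dn[OF y(2)] by (auto simp: asc_def)
    moreover have "T (Suc r, y) \<le> tgt i" using tab_row_le[OF ok T, of "Suc r" y j] dn y r1 eq r' by simp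
    ultimately show ?thesis by simp
  qed
  let ?q = "(Suc r, j0)"
  have b: "before c ?q" using c by (simp add: before_def)
  have qd: "?q \<in> set (cells s)" using dn j0 set_cells by simp
  have "{d \<in> set (cells s). before c d \<and> \<not> before ?q d \<and> T d = src i} \<subseteq> Pair r ` {j0..<j}"
  proof
    fix d assume d: "d \<in> {d \<in> set (cells s). before c d \<and> \<not> before ?q d \<and> T d = src i}"
    obtain x y where xy: "d = (x, y)" by (cases d)
    have "x = r \<and> y < j \<or> x = Suc r \<and> j0 \<le> y" using d c xy by (auto simp: before_def)
    moreover have "\<not> (x = Suc r \<and> j0 \<le> y)"
    proof
      assume h: "x = Suc r \<and> j0 \<le> y"
      then have "T (Suc r, y) \<ge> T (Suc r, j0)" using tab_row_le[OF ok T, of "Suc r" j0 y] d xy qd set_cells by auto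
      then show False using mid[of j0] j0(3) d xy h src_less_tgt[OF i(1)] by simp
    qed
    ultimately show "d \<in> Pair r ` {j0..<j}" using j0min[of y] d xy set_cells by auto
  qed
  then have "card {d \<in> set (cells s). before c d \<and> \<not> before ?q d \<and> T d = src i} \<le> card (Pair r ` {j0..<j})"
    by (intro card_mono) auto
  also have "\<dots> = j - j0" by (subst card_image) (auto simp: inj_on_def)
  finally have 1: "card {d \<in> set (cells s). before c d \<and> \<not> before ?q d \<and> T d = src i} \<le> j - j0" .
  have "Pair (Suc r) ` {j0..j} \<subseteq> {d \<in> set (cells s). before c d \<and> \<not> before ?q d \<and> T d = tgt i}"
    using dn mid c set_cells by (auto simp: before_def)
  then have "card (Pair (Suc r) ` {j0..j}) \<le> card {d \<in> set (cells s). before c d \<and> \<not> before ?q d \<and> T d = tgt i}"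
    by (intro card_mono) auto
  moreover have "card (Pair (Suc r) ` {j0..j}) = Suc j - j0" by (subst card_image) (auto simp: inj_on_def)
  ultimately show False using 1 acted_neg(2)[OF i a sorted_cells qd b] j0(3) by simp
qed

text \<open>Dual to \<open>no_tgt_below\<close>: the cells of row \<open>r\<close> with letter
  \<open>tgt i\<close> to the right of \<open>c\<close> are matched with the cells above them, all
  of which contain \<open>src i\<close>. The cell above \<open>c\<close> is one too many.\<close>

lemma no_src_above:
  assumes c: "c = (r, j)" "T c = tgt i" and q: "(r', j) \<in> diagram s" "r' < r"
  shows "T (r', j) \<noteq> src i"
proof
  assume eq: "T (r', j) = src i"
  have cd: "(r, j) \<in> diagram s" using acted_cell c by simp
  have rb: "r < length (fst s)" using neg_in_body[OF cd] c src_tgt_neg_Ints by simp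
  define p where "p = r - 1"
  have rp: "r = Suc p" using q p_def by simp
  have r1: "(p, j) \<in> diagram s" using ok_shape_down[OF ok rb cd, of p j] rp by simp
  have "asc (T (p, j)) (tgt i)" using tab_col[OF ok T r1 cd] c rp by simp
  then have le: "T (p, j) \<le> src i" using src_tgt_neg_Ints(2) less_tgt_iff(1)[OF tab_letter[OF ok T r1]] by (auto simp: asc_def)
  have r': "r' = p"
  proof (rule ccontr)
    assume "r' \<noteq> p"
    then have "asc (src i) (T (p, j))" using tab_col[OF ok T q(1) r1] q(2) eq rp by simp
    then show False using le src_tgt_neg_Ints(1) by (auto simp: asc_def)
  qed
  let ?S = "{y. (r, y) \<in> diagram s \<and> T (r, y) = tgt i}"
  have fin: "finite ?S"
  proof (rule finite_subset)
    show "?S \<subseteq> snd ` set (cells s)" by (force simp: set_cells)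
  qed simp
  define j1 where "j1 = Max ?S"
  have jS: "j \<in> ?S" using cd c by simp
  have j1: "(r, j1) \<in> diagram s" "T (r, j1) = tgt i" "j \<le> j1"
    using Max_in[OF fin] Max_ge[OF fin jS] jS unfolding j1_def by auto
  have j1max: "y \<le> j1" if "(r, y) \<in> diagram s" "T (r, y) = tgt i" for y
    unfolding j1_def using Max_ge[OF fin] that by simp
  have dn: "(p, y) \<in> diagram s \<and> (r, y) \<in> diagram s" if "y \<le> j1" for y
    using ok_shape_down[OF ok rb j1(1), of p y] ok_shape_down[OF ok rb j1(1), of r y] that rp by simp
  have mid: "T (p, y) = src i" if y: "j \<le> y" "y \<le> j1" for y
  proof -
    have "T (r, y) = tgt i" using tab_row_le[OF ok T, of r j y] tab_row_le[OF ok T, of r y j1] j1 dn[OF y(2)] y cd c by auto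
    then have "asc (T (p, y)) (tgt i)" using tab_col[OF ok T, of p y r] dn[OF y(2)] rp by simp
    then have "T (p, y) \<le> src i" using src_tgt_neg_Ints(2) less_tgt_iff(1)[OF tab_letter[OF ok T]] dn[OF y(2)] by (auto simp: asc_def)
    moreover have "src i \<le> T (p, y)" using tab_row_le[OF ok T, of p j y] dn y r1 eq r' by simp
    ultimately show ?thesis by simp
  qed
  let ?q = "(p, j1)"
  have b: "before ?q c" using c rp by (simp add: before_def)
  have qd: "?q \<in> set (cells s)" using dn j1 set_cells by simp
  have "{d \<in> set (cells s). \<not> before d ?q \<and> before d c \<and> T d = tgt i} \<subseteq> Pair r ` {Suc j..j1}"
  proof
    fix d assume d: "d \<in> {d \<in> set (cells s). \<not> before d ?q \<and> before d c \<and> T d = tgt i}"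
    obtain x y where xy: "d = (x, y)" by (cases d)
    have "x = r \<and> j < y \<or> x = p \<and> y \<le> j1" using d c xy rp by (auto simp: before_def)
    moreover have "\<not> (x = p \<and> y \<le> j1)"
    proof
      assume h: "x = p \<and> y \<le> j1"
      then have "T (p, y) \<le> T (p, j1)" using tab_row_le[OF ok T, of p y j1] d xy qd set_cells by auto
      then show False using mid[of j1] j1(3) d xy h src_less_tgt[OF i(1)] by simp
    qed
    ultimately show "d \<in> Pair r ` {Suc j..j1}" using j1max[of y] d xy set_cells by auto
  qed
  then have "card {d \<in> set (cells s). \<not> before d ?q \<and> before d c \<and> T d = tgt i} \<le> card (Pair r ` {Suc j..j1})"
    by (intro card_mono) auto
  also have "\<dots> = j1 - j" by (subst card_image) (auto simp: inj_on_def)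
  finally have 1: "card {d \<in> set (cells s). \<not> before d ?q \<and> before d c \<and> T d = tgt i} \<le> j1 - j" .
  have "Pair p ` {j..j1} \<subseteq> {d \<in> set (cells s). \<not> before d ?q \<and> before d c \<and> T d = src i}"
    using dn mid c set_cells rp by (auto simp: before_def)
  then have "card (Pair p ` {j..j1}) \<le> card {d \<in> set (cells s). \<not> before d ?q \<and> before d c \<and> T d = src i}"
    by (intro card_mono) auto
  moreover have "card (Pair p ` {j..j1}) = Suc j1 - j" by (subst card_image) (auto simp: inj_on_def)
  ultimately show False using 1 acted_neg(1)[OF i a sorted_cells qd b] j1(3) by simp
qed

text \<open>The standardization may change here, so only linked pairs are considered. Within rows
  and columns a violation needs an adjacent letter in a position excluded by the preceding lemmas;
  the joint is positive and hence larger than both \<open>src i\<close> and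
  \<open>tgt i\<close>.\<close>

lemma rk_upd_neg:
  assumes tv: "T c = src i \<and> v = tgt i \<or> T c = tgt i \<and> v = src i" and pq: "(p, q) \<in> linked s"
  shows "rk (T(c := v)) p q"
proof -
  have R: "rk T p q" using tab_linked[OF ok T pq] .
  have d: "p \<in> diagram s" "q \<in> diagram s" using pq by (auto simp: linked_def)
  note st = src_less_tgt[OF i(1)]
  have cneg: "T c < 0" using tv src_tgt_neg_Ints by auto
  have vint: "v \<in> \<int>" using tv src_tgt_neg_Ints by auto
  have ne: "p \<noteq> q" using R by auto
  consider (row) r x y where "p = (r, x)" "q = (r, y)" "x < y" | (col) r r' x where "p = (r, x)" "q = (r', x)" "r < r'"
    | (joint) "snd s \<noteq> []" "q = joint s" "p \<in> body s"
    using pq by (cases p; cases q) (auto simp: linked_def)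
  note kinds = this
  have jp: "T q > 0" if "snd s \<noteq> []" "q = joint s" using tab_joint_pos[OF ok T that(1)] that by simp
  consider "p = c" | "q = c" | "p \<noteq> c" "q \<noteq> c" by blast
  then show ?thesis
  proof cases
    case 1
    note lq = less_tgt_iff[OF tab_letter[OF ok T d(2)]]
    show ?thesis using tv
    proof
      assume h: "T c = src i \<and> v = tgt i"
      have le: "src i \<le> T q" using R h 1 by (auto simp: rk_def)
      show ?thesis using kinds
      proof cases
        case (row r x y)
        then have "T q \<noteq> src i" using no_src_right[of r x y] h 1 d(2) by auto
        then have "tgt i \<le> T q" using le lq by auto
        then show ?thesis using row h 1 ne vint by (auto simp: rk_def before_def)
      next
        case (col r r' x)
        then have "asc (src i) (T q)" using R h 1 by (simp add: rk_col)
        then have "tgt i \<le> T q" using lq(2) src_tgt_neg_Ints(1) by (auto simp: asc_def)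
        moreover have "T q \<noteq> tgt i" using no_tgt_below[of r x r'] col h 1 d(2) by auto
        ultimately show ?thesis using h 1 ne by (auto simp: rk_def)
      next
        case joint
        then show ?thesis using jp h 1 ne src_tgt_neg_Ints by (auto simp: rk_def)
      qed
    next
      assume h: "T c = tgt i \<and> v = src i"
      then show ?thesis using R 1 ne st by (auto simp: rk_def)
    qed
  next
    case 2
    note lp = less_tgt_iff[OF tab_letter[OF ok T d(1)]]
    show ?thesis using tv
    proof
      assume h: "T c = src i \<and> v = tgt i"
      then show ?thesis using R 2 ne st by (auto simp: rk_def)
    next
      assume h: "T c = tgt i \<and> v = src i"
      have le: "T p \<le> tgt i" using R h 2 by (auto simp: rk_def)
      show ?thesis using kinds
      proof cases
        case (row r x y)
        then have "T p \<noteq> tgt i" using no_tgt_left[of r y x] h 2 d(1) by auto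
        then have "T p \<le> src i" using le lp by auto
        then show ?thesis using row h 2 ne vint by (cases "T p = src i") (auto simp: rk_def before_def)
      next
        case (col r r' x)
        then have "asc (T p) (tgt i)" using R h 2 by (simp add: rk_col)
        then have "T p \<le> src i" using lp(1) src_tgt_neg_Ints(2) by (auto simp: asc_def)
        moreover have "T p \<noteq> src i" using no_src_above[of r' x r] col h 2 d(1) by auto
        ultimately show ?thesis using h 2 ne by (auto simp: rk_def)
      next
        case joint
        then show ?thesis using jp 2 cneg by auto
      qed
    qed
  next
    case 3
    then show ?thesis using R by (simp add: rk_def)
  qed
qed

end

lemma tableaux_upd:
  assumes ok: "ok_shape m s" and T: "T \<in> tableaux m s" and i: "i \<in> index_set m"
    and a: "acted m i T (cells s) c" and tv: "T c = src i \<and> v = tgt i \<or> T c = tgt i \<and> v = src i"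
  shows "T(c := v) \<in> tableaux m s"
proof -
  have c: "c \<in> diagram s" using acted_mem[OF a] set_cells by simp
  have v: "v \<in> letters m" using tv src_letter[OF i] tgt_letter[OF i] by auto
  have "T(c := v) \<in> diagram s \<rightarrow>\<^sub>E letters m"
    using T c v unfolding tableaux_iff[OF ok] by (auto simp: PiE_def extensional_def)
  moreover have "rk (T(c := v)) p q" if pq: "(p, q) \<in> linked s" for p q
  proof (cases "i < 0")
    case True
    show ?thesis by (rule rk_upd_neg[OF ok T i True a tv pq])
  next
    case False
    show ?thesis
      by (rule rk_upd_nonneg[OF i _ a sorted_cells _ tv])
        (use False tab_letter[OF ok T] tab_linked[OF ok T pq] pq set_cells in \<open>auto simp: linked_def\<close>)
  qed
  ultimately show ?thesis unfolding tableaux_iff[OF ok] by blast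
qed

lemma reading_word_closed:
  assumes ok: "ok_shape m s" and T: "T \<in> tableaux m s" and i: "i \<in> index_set m"
  shows "f_op (word_crystal m) i (reading_word s T) = Some w \<Longrightarrow> \<exists>T'\<in>tableaux m s. w = reading_word s T'"
    and "e_op (word_crystal m) i (reading_word s T) = Some w \<Longrightarrow> \<exists>T'\<in>tableaux m s. w = reading_word s T'"
proof -
  show "\<exists>T'\<in>tableaux m s. w = reading_word s T'" if "f_op (word_crystal m) i (reading_word s T) = Some w"
    using that tableaux_upd[OF ok T i] unfolding reading_word_cells f_map[OF i distinct_cells] by blast
  have l: "T c \<in> letters m" if "c \<in> set (cells s)" for c using tab_letter[OF ok T] that set_cells by simp
  show "\<exists>T'\<in>tableaux m s. w = reading_word s T'" if "e_op (word_crystal m) i (reading_word s T) = Some w"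
    using that tableaux_upd[OF ok T i] e_map[OF i distinct_cells, of s T w] l
    unfolding reading_word_cells by blast
qed

section \<open>The tableau crystal compared with the crystal of words\<close>

lemma reading_word_inject:
  assumes "T \<in> tableaux m s" "T' \<in> tableaux m s" "reading_word s T = reading_word s T'"
  shows "T = T'"
proof (rule PiE_ext)
  show "T \<in> diagram s \<rightarrow>\<^sub>E letters m" "T' \<in> diagram s \<rightarrow>\<^sub>E letters m"
    using assms by (auto simp: tableaux_def)
  show "T p = T' p" if "p \<in> diagram s" for p
    using assms(3) that unfolding reading_word_cells map_eq_conv set_cells by blast
qed

lemma tableau_op_iff:
  "tableau_op m s opf T = Some T' \<longleftrightarrow>
    T' \<in> tableaux m s \<and> opf (reading_word s T) = Some (reading_word s T')"
proof -
  have "(THE U. U \<in> tableaux m s \<and> opf (reading_word s T) = Some (reading_word s U)) = V"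
    if "V \<in> tableaux m s" "opf (reading_word s T) = Some (reading_word s V)" for V
    using that by (intro the_equality) (auto intro: reading_word_inject)
  then show ?thesis unfolding tableau_op_def
    by (auto split: if_splits intro: reading_word_inject reading_word_inject[OF _ _ sym])
qed

lemma tableau_crystal_simps [simp]:
  "elts (tableau_crystal m s) = tableaux m s"
  "wt (tableau_crystal m s) T = wt (word_crystal m) (reading_word s T)"
  "eps (tableau_crystal m s) i T = eps (word_crystal m) i (reading_word s T)"
  "phi (tableau_crystal m s) i T = phi (word_crystal m) i (reading_word s T)"
  "e_op (tableau_crystal m s) i = tableau_op m s (e_op (word_crystal m) i)"
  "f_op (tableau_crystal m s) i = tableau_op m s (f_op (word_crystal m) i)"
  by (simp_all add: tableau_crystal_def)

lemma reading_word_letters: "T \<in> tableaux m s \<Longrightarrow> reading_word s T \<in> lists (letters m)"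
  unfolding reading_word_cells by (auto simp: tableaux_def set_cells)

text \<open>By \<open>reading_word_closed\<close> an operator that is defined on a reading word
  leads to another reading word of the same shape, so \<open>tableau_op\<close> yields
  \<open>None\<close> only where the operator on words does.\<close>

lemma reading_word_bisim:
  assumes ok: "ok_shape m s"
  shows "bisim m (word_crystal m) (tableau_crystal m s) {(reading_word s T, T) | T. T \<in> tableaux m s}"
    (is "bisim m ?W ?B ?R")
  unfolding bisim_def[of _ _ _ ?R]
proof (intro conjI allI impI ballI)
  show "?R \<subseteq> elts ?W \<times> elts ?B"
    unfolding elts_word tableau_crystal_simps using reading_word_letters[of _ m s] by blast
  show "x = x' \<longleftrightarrow> y = y'" if "(x, y) \<in> ?R" "(x', y') \<in> ?R" for x y x' y'
    using that reading_word_inject by blast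
next
  fix x T assume "(x, T) \<in> ?R"
  then have x: "x = reading_word s T" and T: "T \<in> tableaux m s" by blast+
  show "wt ?W x = wt ?B T" using x by simp
  fix i assume i: "i \<in> index_set m"
  show "eps ?W i x = eps ?B i T" "phi ?W i x = phi ?B i T" using x by simp_all
  note C = reading_word_closed[OF ok T i]
  show "\<exists>y'. f_op ?B i T = Some y' \<and> (x', y') \<in> ?R" if "f_op ?W i x = Some x'" for x'
    using that C(1) x by (fastforce simp: tableau_op_iff)
  show "\<exists>y'. e_op ?B i T = Some y' \<and> (x', y') \<in> ?R" if "e_op ?W i x = Some x'" for x'
    using that C(2) x by (fastforce simp: tableau_op_iff)
  show "\<exists>x'. f_op ?W i x = Some x' \<and> (x', y') \<in> ?R" if "f_op ?B i T = Some y'" for y'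
    using that x by (auto simp: tableau_op_iff)
  show "\<exists>x'. e_op ?W i x = Some x' \<and> (x', y') \<in> ?R" if "e_op ?B i T = Some y'" for y'
    using that x by (auto simp: tableau_op_iff)
qed

lemma ef_inverse_tableau: "ef_inverse m (tableau_crystal m s)"
  unfolding ef_inverse_def using e_iff_f reading_word_letters by (auto simp: tableau_op_iff)

lemma word_equiv_tableau:
  assumes "word_equiv m w (reading_word s T)" "T \<in> tableaux m s" "ok_shape m s"
  shows "crystal_equiv m (word_crystal m) w (tableau_crystal m s) T"
proof -
  obtain R where R: "bisim m (word_crystal m) (word_crystal m) R" "(w, reading_word s T) \<in> R"
    using assms(1) unfolding word_equiv_def by blast
  show ?thesis
    by (rule bisim_crystal_equiv[OF bisim_comp[OF R(1) reading_word_bisim[OF assms(3)]] ef_inverse_word ef_inverse_tableau])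
      (use R(2) assms(2) in blast)
qed

section \<open>Highest weight tableaux\<close>

definition row_list :: "shape \<Rightarrow> (cell \<Rightarrow> rat) \<Rightarrow> nat \<Rightarrow> rat list" where
  "row_list s T r = map (\<lambda>c. T (r, c)) [row_start s r ..< row_start s r + row_length s r]"

definition tail_rows :: "shape \<Rightarrow> (cell \<Rightarrow> rat) \<Rightarrow> rat list list" where
  "tail_rows s T = map (row_list s T) [length (fst s) ..< num_rows s]"

lemma set_row_list: "set (row_list s T r) = {T (r, c) | c. row_start s r \<le> c \<and> c < row_start s r + row_length s r}"
  by (auto simp: row_list_def image_iff)

text \<open>On the way along the ribbon the horizontal steps do not descend, and each passage to the
  next row is one vertical step, which ascends.\<close>

lemma tab_tail_asc:
  assumes ok: "ok_shape m s" and T: "T \<in> tableaux m s"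
    and d: "(r, c) \<in> diagram s" "(r', c') \<in> diagram s" "length (fst s) \<le> r" "r < r'"
  shows "asc (T (r, c)) (T (r', c'))"
proof -
  have base: "asc (T (r, c)) (T (Suc r, row_start s (Suc r)))"
    if d: "(r, c) \<in> diagram s" "(Suc r, c') \<in> diagram s" "length (fst s) \<le> r" for r c c'
  proof -
    let ?l = "row_start s (Suc r)"
    have "Suc r - length (fst s) = Suc (r - length (fst s))" using d by simp
    then have "?l = row_start s r + (snd s ! (r - length (fst s)) - 1)" by (simp add: row_start_def)
    moreover have "c < row_start s r + snd s ! (r - length (fst s))"
      using d by (auto simp: diagram_def row_length_def nth_append)
    ultimately have cl: "c \<le> ?l" by linarith
    have l: "(r, ?l) \<in> diagram s" using tail_step[OF ok T d(3,2)] .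
    have a: "asc (T (r, ?l)) (T (Suc r, ?l))" using tab_col[OF ok T l] row_start_cell(1)[OF ok T d(2)] by simp
    show ?thesis
    proof (cases "c = ?l")
      case False
      then have "\<not> asc (T (r, ?l)) (T (r, c))" using tab_row[OF ok T d(1) l] cl by (auto simp: asc_def)
      then show ?thesis using asc_mixed(2) a by blast
    qed (use a in simp)
  qed
  have "asc (T (r, c)) (T (r', row_start s r'))" using d(2,4)
  proof (induction r' arbitrary: c')
    case (Suc r0)
    show ?case
    proof (cases "r0 = r")
      case True then show ?thesis using base[OF d(1) _ d(3)] Suc.prems by blast
    next
      case False
      have d0: "(r0, row_start s (Suc r0)) \<in> diagram s" using tail_step[OF ok T _ Suc.prems(1)] d(3) Suc.prems(2) by simp
      then have "asc (T (r, c)) (T (r0, row_start s r0))" using Suc False by simp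
      moreover have "asc (T (r0, row_start s r0)) (T (Suc r0, row_start s (Suc r0)))"
        using base[OF row_start_cell(1)[OF ok T d0] Suc.prems(1)] d(3) Suc.prems(2) by simp
      ultimately show ?thesis using asc_trans by blast
    qed
  qed simp
  moreover have "\<not> asc (T (r', c')) (T (r', row_start s r'))" if "c' \<noteq> row_start s r'"
    using tab_row[OF ok T row_start_cell(1)[OF ok T d(2)] d(2)] row_start_cell(2)[OF ok T d(2)] that
    by (auto simp: asc_def)
  ultimately show ?thesis using asc_mixed(1) by (cases "c' = row_start s r'") blast+
qed

context
  fixes m s T assumes s: "s \<in> shapes m" and T: "T \<in> tableaux m s"
    and hw: "\<And>i. i \<in> index_set m \<Longrightarrow> e_op (word_crystal m) i (reading_word s T) = None"
begin

lemma length_body: "length (fst s) = m"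
  using s by (auto simp: shapes_def)

lemmas highest_ok = shapes_ok[OF s]

lemma highest_src_exists:
  assumes i: "i \<in> index_set m" and p: "p \<in> diagram s" "T p = tgt i"
  shows "\<exists>q\<in>diagram s. T q = src i \<and> (if i \<in> \<int> then before q p else before p q)"
proof -
  obtain A B where cs: "cells s = A @ p # B" using p set_cells split_list by metis
  have "reading_word s T = map T A @ tgt i # map T B" unfolding reading_word_cells cs using p by simp
  from e_None_src[OF i reading_word_letters[OF T] hw[OF i] this]
  have e: "if i \<in> \<int> then src i \<in> T ` set A else src i \<in> T ` set B"
    by (simp only: set_map)
  have srt: "sorted_wrt before (A @ p # B)" using sorted_cells[of s] cs by simp
  have sub: "set A \<union> set B \<subseteq> diagram s" using set_cells[of s] cs by auto
  show ?thesis
  proof (cases "i \<in> \<int>")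
    case True
    then obtain q where "q \<in> set A" "T q = src i" using e by auto
    then show ?thesis using True srt sub by (intro bexI[of _ q]) (auto simp: sorted_wrt_append)
  next
    case False
    then obtain q where "q \<in> set B" "T q = src i" using e by auto
    then show ?thesis using False srt sub by (intro bexI[of _ q]) (auto simp: sorted_wrt_append)
  qed
qed

text \<open>Consider the first offending cell in the reading order. Its entry x exceeds the bound
  \<open>of_nat r - of_nat m\<close> of \<open>column_bound\<close>, so x - 1 must have been read
  before, in a cell that obeys the formula and therefore lies in row \<open>r\<close> or below.
  Being read earlier, that cell stands in row \<open>r\<close> to the right, where entries are at
  least x.\<close>

lemma highest_neg_letter:
  assumes "p \<in> diagram s" "T p < 0"
  shows "T p = of_nat (fst p) - of_nat m"
proof (rule ccontr)
  let ?P = "\<lambda>p. T p < 0 \<and> T p \<noteq> of_nat (fst p) - of_nat m"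
  assume "T p \<noteq> of_nat (fst p) - of_nat m"
  then have "\<exists>p\<in>set (cells s). ?P p" using assms set_cells by blast
  from split_list_first_prop[OF this] obtain A p B where
    cs: "cells s = A @ p # B" "?P p" "\<forall>q\<in>set A. \<not> ?P q" by blast
  obtain r c where p: "p = (r, c)" by (cases p)
  let ?x = "T (r, c)"
  have pd: "(r, c) \<in> diagram s" using cs p set_cells[of s] by auto
  have rm: "r < m" using tab_tail_pos[OF highest_ok T pd] cs(2) p length_body by force
  have col: "(k, c) \<in> diagram s" if "k \<le> r" for k using ok_shape_down[OF highest_ok _ pd that] rm length_body by simp
  have lx: "?x \<in> letters m" using tab_letter[OF highest_ok T pd] .
  have "?x > 0 \<or> ?x \<ge> of_nat r - of_nat m"
  proof (rule column_bound)
    show "T (k, c) \<in> letters m" if "k \<le> r" for k using tab_letter[OF highest_ok T col[OF that]] .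
    show "T (k, c) < T (Suc k, c) \<or> T (k, c) = T (Suc k, c) \<and> T (k, c) \<notin> \<int>" if "k < r" for k
      using tab_col[OF highest_ok T col col, of k "Suc k"] that by (auto simp: asc_def)
  qed
  then have gt: "?x > of_nat r - of_nat m" using cs(2) p by auto
  have xi: "?x \<in> \<int>" "?x < 0" using neg_letter_Ints[OF lx] cs(2) p by auto
  have "of_nat r - of_nat m \<in> (\<int> :: rat set)" by simp
  then have ge: "of_nat r - of_nat m + 1 \<le> ?x" using Ints_less_imp_le xi gt by blast
  have "?x \<noteq> - of_nat m"
  proof
    assume "?x = - of_nat m"
    then have "(of_nat r :: rat) + 1 \<le> 0" using ge by simp
    moreover have "(0::rat) \<le> of_nat r" by simp
    ultimately show False by linarith
  qed
  note I = neg_letter_index[OF lx xi(2) this]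
  obtain q where q: "q \<in> diagram s" "T q = ?x - 1" "before q (r, c)"
    using highest_src_exists[OF I(1) pd] I xi by auto
  have "q \<in> set A"
  proof -
    have "sorted_wrt before (A @ p # B)" using sorted_cells[of s] cs(1) by simp
    moreover have "q \<in> set (A @ p # B)" using q(1) set_cells[of s] cs(1) by simp
    ultimately show ?thesis using q(3) p by (auto simp: sorted_wrt_append dest: before_asym)
  qed
  then have fq: "?x - 1 = of_nat (fst q) - of_nat m" using cs(3) q xi by auto
  have fr: "fst q \<le> r" using q(3) by (auto simp: before_def)
  have "(of_nat r :: rat) \<le> of_nat (fst q)" using fq ge by linarith
  then have "fst q = r" using fr by simp
  then have "T q \<ge> ?x" using tab_row_le[OF highest_ok T pd, of "snd q"] q by (cases q) (auto simp: before_def)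
  then show False using q by simp
qed

text \<open>Take the least positive letter of the body. If it is 1/2, then -1 must be read earlier;
  all -1 stand in row \<open>m - 1\<close>, hence to its right in the same row. Otherwise its
  predecessor occurs only in the tail, although by the joint condition no tail entry is smaller than
  a body entry.\<close>

lemma highest_body_neg:
  assumes "(r, c) \<in> body s" shows "T (r, c) < 0"
proof (rule ccontr)
  assume "\<not> T (r, c) < 0"
  let ?S = "{T p | p. p \<in> body s \<and> T p > 0}"
  have bd: "body s \<subseteq> diagram s" by (auto simp: body_def)
  have "T (r, c) \<noteq> 0" using letter_nonzero[OF tab_letter[OF highest_ok T, of "(r, c)"]] assms bd by auto
  then have "T (r, c) \<in> ?S" using assms \<open>\<not> T (r, c) < 0\<close> by force
  moreover have fin: "finite ?S"
  proof (rule finite_subset)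
    show "?S \<subseteq> T ` set (cells s)" using bd set_cells by auto
  qed simp
  ultimately have "Min ?S \<in> ?S" using Min_in by blast
  then obtain p where p: "p \<in> body s" "T p > 0" "T p = Min ?S" by auto
  have min: "T p \<le> T q" if "q \<in> body s" "T q > 0" for q
    unfolding p(3) by (rule Min_le[OF fin]) (use that in blast)
  have pd: "p \<in> diagram s" using p bd by auto
  have pm: "fst p < m" using p(1) length_body by (auto simp: body_def)
  note lp = tab_letter[OF highest_ok T pd]
  show False
  proof (cases "T p = 1/2")
    case True
    have 0: "0 \<in> index_set m" using pm unfolding index_set_iff by (intro disjI1 exI[of _ 0]) auto
    obtain q where q: "q \<in> diagram s" "T q = -1" "before q p"
      using highest_src_exists[OF 0 pd] True by (auto simp: tgt_def src_def)
    have "(of_nat (fst q) :: rat) = of_nat m - 1" using highest_neg_letter[OF q(1)] q(2) by simp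
    then have "of_nat (fst q + 1) = (of_nat m :: rat)" by simp
    then have "fst q + 1 = m" unfolding of_nat_eq_iff .
    then have e: "fst q = fst p" "snd p < snd q" using q(3) pm by (auto simp: before_def)
    have "T p \<le> T q" using tab_row_le[OF highest_ok T, of "fst p" "snd p" "snd q"] pd q(1) e
      by (metis less_imp_le prod.collapse)
    then show False using q True by simp
  next
    case False
    note I = letter_ge_one[OF lp p(2) False]
    obtain q where q: "q \<in> diagram s" "T q = T p - 1/2" "if T p - 1/2 \<in> \<int> then before q p else before p q"
      using highest_src_exists[OF I(1) pd] I by auto
    have nb: "q \<notin> body s" using min[of q] q I by auto
    have ql: "fst q \<ge> m" using nb q(1) length_body by (cases q) (auto simp: body_def)
    then have "T p - 1/2 \<notin> \<int>" using q(3) pm by (auto simp: before_def split: if_splits)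
    have ne: "snd s \<noteq> []" using q(1) ql length_body by (cases q) (auto simp: diagram_def num_rows_def)
    have "rk T p (joint s)"
      using tab_linked[OF highest_ok T, of p "joint s"] p(1) pd ne joint_diagram(1)[OF highest_ok ne] by (auto simp: linked_def)
    then have "T p \<le> T (joint s)" by (auto simp: rk_def)
    also have "\<dots> \<le> T q" using tab_tail_ge_joint[OF highest_ok T, of "fst q" "snd q"] q(1) ql length_body by simp
    finally show False using q(2) by simp
  qed
qed

lemma highest_body_letter: "(r, c) \<in> body s \<Longrightarrow> T (r, c) = of_nat r - of_nat m"
  using highest_body_neg[of r c] highest_neg_letter[of "(r, c)"] by (auto simp: body_def)

lemma highest_pos_iff_tail: "(r, c) \<in> diagram s \<Longrightarrow> T (r, c) > 0 \<longleftrightarrow> m \<le> r"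
  using highest_body_neg[of r c] tab_tail_pos[OF highest_ok T, of r c] length_body by (fastforce simp: body_def)

text \<open>An even entry needs its predecessor later in the reading, but after the first cell of a
  row come only later rows, whose entries are not smaller. An odd entry further right needs its
  predecessor earlier: in its own row the entries read earlier are too large, and an earlier row
  would have to ascend to the first entry of this row, which is at most that predecessor. Equality
  would require an odd letter, while the predecessor is even.\<close>

lemma highest_tail_row_odd_iff:
  assumes d: "(r, c) \<in> diagram s" "m \<le> r"
  shows "T (r, c) \<notin> \<int> \<longleftrightarrow> c = row_start s r"
proof -
  let ?x = "T (r, c)"
  have xl: "?x \<in> letters m" "?x > 0" using tab_letter[OF highest_ok T d(1)] highest_pos_iff_tail[OF d(1)] d(2) by auto
  have src_cell: "\<exists>r' c'. (r', c') \<in> diagram s \<and> m \<le> r' \<and> T (r', c') = ?x - 1/2 \<and>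
    (if ?x - 1/2 \<in> \<int> then before (r', c') (r, c) else before (r, c) (r', c'))" if "?x \<noteq> 1/2"
  proof -
    note I = letter_ge_one[OF xl that]
    obtain q where q: "q \<in> diagram s" "T q = ?x - 1/2" "if ?x - 1/2 \<in> \<int> then before q (r, c) else before (r, c) q"
      using highest_src_exists[OF I(1) d(1)] I by auto
    then show ?thesis using highest_pos_iff_tail[of "fst q" "snd q"] I(4) by (intro exI[of _ "fst q"] exI[of _ "snd q"]) auto
  qed
  show ?thesis
  proof (cases "c = row_start s r")
    case True
    have "?x \<notin> \<int>"
    proof
      assume xi: "?x \<in> \<int>"
      have "1/2 \<notin> (\<int> :: rat set)" using half_notin_Ints[of 0] by simp
      then have "?x \<noteq> 1/2" using xi by metis
      from src_cell[OF this] obtain r' c' where q: "(r', c') \<in> diagram s" "m \<le> r'" "T (r', c') = ?x - 1/2"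
        "before (r, c) (r', c')" using half_letter_pred[OF xl(1)] xi by auto
      have "\<not> r' = r" using q(4) row_start_cell(2)[OF highest_ok T q(1)] True by (auto simp: before_def)
      then have "r < r'" using q(4) by (auto simp: before_def)
      then have "asc ?x (T (r', c'))" using tab_tail_asc[OF highest_ok T d(1) q(1)] d(2) length_body by simp
      then show False using q(3) by (auto simp: asc_def)
    qed
    then show ?thesis using True by simp
  next
    case False
    then have c: "row_start s r < c" using row_start_cell(2)[OF highest_ok T d(1)] by simp
    let ?y = "T (r, row_start s r)"
    have yd: "(r, row_start s r) \<in> diagram s" using row_start_cell(1)[OF highest_ok T d(1)] .
    have yx: "?y < ?x \<or> ?y = ?x \<and> ?x \<in> \<int>" using tab_row[OF highest_ok T yd d(1) c] by auto
    have yl: "?y \<in> letters m" "?y > 0" using tab_letter[OF highest_ok T yd] highest_pos_iff_tail[OF yd] d(2) by auto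
    have "?x \<in> \<int>"
    proof (rule ccontr)
      assume xi: "?x \<notin> \<int>"
      then have yx: "?y < ?x" using yx by auto
      have "?x \<noteq> 1/2" using yx yl letter_ge_one(4)[OF yl] by force
      note I = letter_ge_one[OF xl this]
      from src_cell[OF \<open>?x \<noteq> 1/2\<close>] obtain r' c' where q: "(r', c') \<in> diagram s" "m \<le> r'" "T (r', c') = ?x - 1/2"
        "before (r', c') (r, c)" using half_letter_pred[OF xl(1)] xi by auto
      have yle: "?y \<le> ?x - 1/2" using letter_gap[OF I(1) yl(1)] yx I by auto
      have "\<not> r' = r"
      proof
        assume "r' = r"
        then have "?x \<le> T (r', c')" using tab_row_le[OF highest_ok T d(1), of c'] q by (auto simp: before_def)
        then show False using q(3) by simp
      qed
      then have "r' < r" using q(4) by (auto simp: before_def)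
      then have "asc (T (r', c')) ?y" using tab_tail_asc[OF highest_ok T q(1) yd] q(2) length_body by simp
      then show False using q(3) yle half_letter_pred[OF xl(1)] xi by (auto simp: asc_def)
    qed
    then show ?thesis using False by simp
  qed
qed

lemma highest_tail_rows:
  "\<forall>r\<in>set (tail_rows s T). r \<noteq> [] \<and> hd r \<notin> \<int> \<and> set (tl r) \<subseteq> \<int>"
proof
  fix rw assume "rw \<in> set (tail_rows s T)"
  then obtain r where r: "m \<le> r" "r < num_rows s" "rw = row_list s T r" using length_body by (auto simp: tail_rows_def)
  have "r - m < length (snd s)" using r length_body by (auto simp: num_rows_def)
  then have len: "row_length s r > 0" using highest_ok r(1) length_body nth_mem unfolding ok_shape_def row_length_def
    by (auto simp: nth_append)
  then have eq: "rw = T (r, row_start s r) # map (\<lambda>c. T (r, c)) [Suc (row_start s r) ..< row_start s r + row_length s r]"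
    unfolding r row_list_def by (subst upt_conv_Cons) auto
  have d: "(r, c) \<in> diagram s \<longleftrightarrow> row_start s r \<le> c \<and> c < row_start s r + row_length s r" for c
    using r by (auto simp: diagram_def)
  have "T (r, row_start s r) \<notin> \<int>" using highest_tail_row_odd_iff[of r "row_start s r"] d r len by simp
  moreover have "T (r, c) \<in> \<int>" if "Suc (row_start s r) \<le> c" "c < row_start s r + row_length s r" for c
    using highest_tail_row_odd_iff[of r c] d r that by auto
  ultimately show "rw \<noteq> [] \<and> hd rw \<notin> \<int> \<and> set (tl rw) \<subseteq> \<int>" unfolding eq by auto
qed

lemma sorted_tail: "sorted (concat (tail_rows s T))"
  unfolding tail_rows_def
proof (rule sorted_wrt_concat_map)
  fix r assume r: "r \<in> set [length (fst s)..<num_rows s]"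
  have "T (r, a) \<le> T (r, b)" if "row_start s r \<le> a" "a < b" "b < row_start s r + row_length s r" for a b
    using tab_row_le[OF highest_ok T, of r a b] that r by (auto simp: diagram_def)
  then show "sorted (row_list s T r)" unfolding row_list_def by (auto simp: sorted_iff_nth_mono_less)
next
  have "\<forall>a\<in>set (row_list s T r). \<forall>b\<in>set (row_list s T r'). a \<le> b"
    if rr: "length (fst s) \<le> r" "r < r'" "r' < num_rows s" for r r'
  proof (intro ballI)
    fix a b assume "a \<in> set (row_list s T r)" "b \<in> set (row_list s T r')"
    then obtain c c' where c: "a = T (r, c)" "b = T (r', c')" "(r, c) \<in> diagram s" "(r', c') \<in> diagram s"
      using rr by (fastforce simp: set_row_list diagram_def)
    then show "a \<le> b" using tab_tail_asc[OF highest_ok T c(3,4) rr(1,2)] by (auto simp: asc_def)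
  qed
  then show "sorted_wrt (\<lambda>r r'. \<forall>a\<in>set (row_list s T r). \<forall>b\<in>set (row_list s T r'). a \<le> b) [length (fst s)..<num_rows s]"
    by (intro sorted_wrt_mono_rel[OF _ sorted_wrt_upt]) simp
qed

lemma mset_tail: "mset (concat (tail_rows s T)) = filter_mset (\<lambda>x. x > 0) (mset (reading_word s T))"
proof -
  have rw: "reading_word s T = concat (map (\<lambda>r. rev (row_list s T r)) ([0..<m] @ [m..<num_rows s]))"
  proof -
    have "[0..<m] @ [m..<num_rows s] = [0..<num_rows s]"
      using upt_add_eq_append[of 0 m "num_rows s - m"] length_body by (simp add: num_rows_def)
    then show ?thesis by (simp add: reading_word_def row_list_def)
  qed
  have 1: "filter (\<lambda>x. x > 0) (concat (map (\<lambda>r. rev (row_list s T r)) [0..<m])) = []"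
    unfolding filter_empty_conv
  proof
    fix x assume "x \<in> set (concat (map (\<lambda>r. rev (row_list s T r)) [0..<m]))"
    then obtain r c where "r < m" "row_start s r \<le> c" "c < row_start s r + row_length s r" "x = T (r, c)"
      by (auto simp: set_row_list)
    moreover then have "(r, c) \<in> body s" using length_body by (auto simp: body_def diagram_def num_rows_def)
    ultimately show "\<not> x > 0" using highest_body_neg[of r c] by simp
  qed
  have 2: "filter (\<lambda>x. x > 0) (concat (map (\<lambda>r. rev (row_list s T r)) [m..<num_rows s]))
      = concat (map (\<lambda>r. rev (row_list s T r)) [m..<num_rows s])"
    unfolding filter_id_conv
  proof
    fix x assume "x \<in> set (concat (map (\<lambda>r. rev (row_list s T r)) [m..<num_rows s]))"
    then obtain r c where "m \<le> r" "r < num_rows s" "row_start s r \<le> c" "c < row_start s r + row_length s r" "x = T (r, c)"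
      by (auto simp: set_row_list)
    then show "x > 0" using highest_pos_iff_tail[of r c] by (auto simp: diagram_def)
  qed
  have 3: "mset (concat (map (\<lambda>r. rev (row_list s T r)) xs)) = mset (concat (map (row_list s T) xs))" for xs
    by (induction xs) auto
  have "filter_mset (\<lambda>x. x > 0) (mset (reading_word s T)) = mset (filter (\<lambda>x. x > 0) (reading_word s T))" by simp
  also have "\<dots> = mset (concat (map (row_list s T) [m..<num_rows s]))"
    unfolding rw map_append concat_append filter_append 1 2 by (simp add: 3)
  finally show ?thesis by (simp add: tail_rows_def length_body)
qed

text \<open>The negative letter of row \<open>r\<close> fills the whole body row and occurs nowhere
  else, so the weight reveals the length of the row.\<close>

lemma body_count:
  assumes "r < m" shows "count (mset (reading_word s T)) (of_nat r - of_nat m) = fst s ! r"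
proof -
  have "{d \<in> diagram s. T d = of_nat r - of_nat m} = Pair r ` {0..<fst s ! r}"
  proof (intro equalityI subsetI)
    fix d assume d: "d \<in> {d \<in> diagram s. T d = of_nat r - of_nat m}"
    have "(of_nat r :: rat) < of_nat m" using assms by simp
    then have "T d < 0" using d by auto
    then have "T d = of_nat (fst d) - of_nat m" using highest_neg_letter d by blast
    then have "fst d = r" using d by simp
    then show "d \<in> Pair r ` {0..<fst s ! r}" using d assms length_body body_cell[of r s] by (cases d) auto
  next
    fix d assume "d \<in> Pair r ` {0..<fst s ! r}"
    then have "d \<in> body s" "fst d = r" using assms length_body by (auto simp: body_iff)
    then show "d \<in> {d \<in> diagram s. T d = of_nat r - of_nat m}" using highest_body_letter by (cases d) (auto simp: body_def)
  qed
  then show ?thesis unfolding reading_word_cells count_mset count_list_map_distinct[OF distinct_cells] set_cells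
    by (simp add: card_image inj_on_def)
qed

end

text \<open>The odd letters mark the beginnings of the rows, so the concatenation can be cut in only
  one way.\<close>

lemma odd_head_rows_unique:
  fixes xs ys :: "rat list list"
  assumes "\<forall>r\<in>set xs. r \<noteq> [] \<and> hd r \<notin> \<int> \<and> set (tl r) \<subseteq> \<int>"
    "\<forall>r\<in>set ys. r \<noteq> [] \<and> hd r \<notin> \<int> \<and> set (tl r) \<subseteq> \<int>" "concat xs = concat ys"
  shows "xs = ys"
  using assms
proof (induction xs arbitrary: ys)
  case Nil then show ?case by (cases ys) auto
next
  case (Cons x xs)
  have xn: "x \<noteq> []" using Cons.prems(1) by simp
  then have "concat ys \<noteq> []" using Cons.prems(3) by force
  then obtain y ys' where ys: "ys = y # ys'" by (cases ys) simp_all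
  have "y \<noteq> []" using Cons.prems(2) ys by simp
  then obtain b v where y: "y = b # v" by (cases y) simp_all
  obtain a u where x: "x = a # u" using xn by (cases x) simp_all
  have uv: "set u \<subseteq> \<int>" "set v \<subseteq> \<int>" using Cons.prems(1,2) ys x y by simp_all
  have no: "takeWhile (\<lambda>z. z \<in> \<int>) (concat zs) = []"
    if "\<forall>r\<in>set zs. r \<noteq> [] \<and> hd r \<notin> \<int> \<and> set (tl r) \<subseteq> \<int>" for zs :: "rat list list"
  proof (cases zs)
    case (Cons r rs) then show ?thesis using that by (cases r) auto
  qed simp
  have eq: "u @ concat xs = v @ concat ys'" "a = b" using Cons.prems(3) ys x y by simp_all
  have "u = takeWhile (\<lambda>z. z \<in> \<int>) (u @ concat xs)"
    using uv no[of xs] Cons.prems(1) by (subst takeWhile_append2) auto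
  moreover have "v = takeWhile (\<lambda>z. z \<in> \<int>) (v @ concat ys')"
    using uv no[of ys'] Cons.prems(2) ys by (subst takeWhile_append2) auto
  ultimately have "u = v" using eq by simp
  moreover have "xs = ys'" by (rule Cons.IH) (use Cons.prems(1,2) ys eq \<open>u = v\<close> in simp_all)
  ultimately show ?case using ys x y eq by simp
qed

lemma highest_weight_tableau_unique:
  assumes 1: "s \<in> shapes m" "T \<in> tableaux m s"
      "\<And>i. i \<in> index_set m \<Longrightarrow> e_op (word_crystal m) i (reading_word s T) = None"
    and 2: "s' \<in> shapes m" "T' \<in> tableaux m s'"
      "\<And>i. i \<in> index_set m \<Longrightarrow> e_op (word_crystal m) i (reading_word s' T') = None"
    and eq: "mset (reading_word s T) = mset (reading_word s' T')"
  shows "s = s' \<and> T = T'"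
proof -
  have len: "length (fst s) = m" "length (fst s') = m" using length_body[OF 1] length_body[OF 2] by auto
  have "concat (tail_rows s T) = concat (tail_rows s' T')"
  proof -
    have "mset (concat (tail_rows s T)) = mset (concat (tail_rows s' T'))"
      using mset_tail[OF 1] mset_tail[OF 2] eq by simp
    from properties_for_sort[OF this sorted_tail[OF 1]] show ?thesis
      using sorted_sort_id[OF sorted_tail[OF 2]] by simp
  qed
  then have rows: "tail_rows s T = tail_rows s' T'"
    using odd_head_rows_unique highest_tail_rows[OF 1] highest_tail_rows[OF 2] by blast
  have rl: "map length (tail_rows s T) = snd s" if "length (fst s) = m" for s T
    using that by (intro nth_equalityI) (auto simp: tail_rows_def row_list_def row_length_def num_rows_def nth_append)
  have "snd s = snd s'" using rl len rows by metis
  moreover have "fst s = fst s'"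
    using len body_count[OF 1] body_count[OF 2] eq by (intro nth_equalityI) auto
  ultimately have ss: "s = s'" by (simp add: prod_eq_iff)
  have "T = T'"
  proof (rule PiE_ext)
    show "T \<in> diagram s \<rightarrow>\<^sub>E letters m" "T' \<in> diagram s \<rightarrow>\<^sub>E letters m"
      using 1 2 ss by (auto simp: tableaux_def)
    fix p assume p: "p \<in> diagram s"
    obtain r c where rc: "p = (r, c)" by (cases p)
    show "T p = T' p"
    proof (cases "r < m")
      case True
      then have "(r, c) \<in> body s" using p rc len by (simp add: body_def)
      then show ?thesis using highest_body_letter[OF 1] highest_body_letter[OF 2] ss rc by simp
    next
      case False
      then have "row_list s T r = row_list s T' r"
        using rows p rc len ss by (auto simp: tail_rows_def diagram_def)
      then show ?thesis using p rc by (auto simp: row_list_def diagram_def)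
    qed
  qed
  then show ?thesis using ss by blast
qed

text \<open>A termination measure for raising: letters are at least -m, and a raising operator
  lowers one letter by 1/2 or more. Doubling turns this into a drop of at least 1.\<close>

definition word_height :: "nat \<Rightarrow> rat list \<Rightarrow> nat" where
  "word_height m w = sum_list (map (\<lambda>x. nat \<lfloor>2 * (x + of_nat m)\<rfloor>) w)"

lemma word_height_e:
  assumes i: "i \<in> index_set m" and w: "w \<in> lists (letters m)" and e: "e_op (word_crystal m) i w = Some w'"
  shows "word_height m w' < word_height m w"
proof -
  have "src i + 1/2 \<le> tgt i" by (auto simp: src_def tgt_def)
  then have "2 * (src i + of_nat m) + 1 \<le> 2 * (tgt i + of_nat m)" by simp
  then have "\<lfloor>2 * (src i + of_nat m) + 1\<rfloor> \<le> \<lfloor>2 * (tgt i + of_nat m)\<rfloor>" by (rule floor_mono)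
  moreover have "0 \<le> src i + of_nat m" using letter_ge[OF src_letter[OF i]] by auto
  then have "0 \<le> 2 * (src i + of_nat m)" by simp
  then have "0 \<le> \<lfloor>2 * (src i + of_nat m)\<rfloor>" by (simp only: zero_le_floor)
  ultimately have "nat \<lfloor>2 * (src i + of_nat m)\<rfloor> < nat \<lfloor>2 * (tgt i + of_nat m)\<rfloor>" by simp
  then show ?thesis using e unfolding e_split[OF i w] by (auto simp: word_height_def)
qed

text \<open>Both tableaux are raised along with the word. The raised ones coincide by induction, and
  applying the same \<open>f_op\<close> recovers the given ones. If nothing can be raised, both are
  highest weight tableaux of the same weight.\<close>

theorem tableau_unique:
  assumes "s \<in> shapes m" "crystal_equiv m (word_crystal m) w (tableau_crystal m s) T"
    and "s' \<in> shapes m" "crystal_equiv m (word_crystal m) w (tableau_crystal m s') T'"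
  shows "s = s' \<and> T = T'"
  using assms
proof (induction "word_height m w" arbitrary: w T T' rule: less_induct)
  case less
  note D = crystal_equivD[OF less.prems(2)] and D' = crystal_equivD[OF less.prems(4)]
  have w: "w \<in> lists (letters m)" using D(1) by simp
  show ?case
  proof (cases "\<exists>i\<in>index_set m. e_op (word_crystal m) i w \<noteq> None")
    case True
    then obtain i v where i: "i \<in> index_set m" and v: "e_op (word_crystal m) i w = Some v" by blast
    have vl: "v \<in> elts (word_crystal m)" using op_letters(2)[OF i w v] by simp
    obtain U where U: "f_op (tableau_crystal m s) i U = Some T" "crystal_equiv m (word_crystal m) v (tableau_crystal m s) U"
      using crystal_equiv_e_op[OF less.prems(2) ef_inverse_word i v vl] by blast
    obtain U' where U': "f_op (tableau_crystal m s') i U' = Some T'" "crystal_equiv m (word_crystal m) v (tableau_crystal m s') U'"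
      using crystal_equiv_e_op[OF less.prems(4) ef_inverse_word i v vl] by blast
    have "s = s' \<and> U = U'"
      using less.hyps[OF word_height_e[OF i w v] less.prems(1) U(2) less.prems(3) U'(2)] .
    then show ?thesis using U U' by simp
  next
    case False
    have "e_op (word_crystal m) i (reading_word s T) = None" if i: "i \<in> index_set m" for i
      using D(4)[OF i] False i eps_eq_0_iff[OF i, of w] eps_eq_0_iff[OF i, of "reading_word s T"] by auto
    moreover have "e_op (word_crystal m) i (reading_word s' T') = None" if i: "i \<in> index_set m" for i
      using D'(4)[OF i] False i eps_eq_0_iff[OF i, of w] eps_eq_0_iff[OF i, of "reading_word s' T'"] by auto
    moreover have "mset (reading_word s T) = mset (reading_word s' T')"
      using D(3) D'(3) count_list_wt by (metis tableau_crystal_simps(2))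
    ultimately show ?thesis
      using highest_weight_tableau_unique less.prems(1,3) D(2) D'(2) by simp
  qed
qed

section \<open>Tableaux from lists of rows\<close>

lemma asc_le: "asc x y \<Longrightarrow> y \<le> z \<Longrightarrow> asc x z" "x \<le> y \<Longrightarrow> asc y z \<Longrightarrow> asc x z"
  by (auto simp: asc_def)

text \<open>The conversion is used with an empty tail, for a body of \<open>m\<close> padded rows or
  of arbitrarily many rows, and with the ribbon obtained by sorting. The hypothesis
  \<open>cross\<close> yields both the joint condition and the columns that run from the body into
  the tail.\<close>

lemma tableau_of_rows:
  fixes rows :: "rat list list" and n :: nat
  defines "s \<equiv> (map length (take n rows), map length (drop n rows))"
  assumes n: "n \<le> length rows" and lets: "concat rows \<in> lists (letters m)"
    and rs: "\<And>r. r \<in> set rows \<Longrightarrow> rowsorted r"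
    and body: "sorted_wrt dominates (take n rows)"
    and tail: "sorted_wrt (\<lambda>r r'. \<forall>x\<in>set r. \<forall>y\<in>set r'. asc x y) (drop n rows)"
    and cross: "\<And>x y. x \<in> set (concat (take n rows)) \<Longrightarrow> y \<in> set (concat (drop n rows)) \<Longrightarrow> asc x y"
    and ok: "ok_shape m s"
  shows "\<exists>T\<in>tableaux m s. reading_word s T = concat (map rev rows)"
proof -
  have fs: "fst s @ snd s = map length rows" by (simp add: s_def flip: map_append)
  have len: "length (fst s) = n" using n by (simp add: s_def)
  have nr: "num_rows s = length rows" using fs unfolding num_rows_def by (metis length_append length_map)
  have rl: "row_length s r = length (rows ! r)" if "r < length rows" for r
    using that fs by (simp add: row_length_def)
  let ?st = "row_start s"
  have st0: "?st r = 0" if "r \<le> n" for r using that len by (simp add: row_start_def)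
  have dg: "(r, c) \<in> diagram s \<longleftrightarrow> r < length rows \<and> ?st r \<le> c \<and> c - ?st r < length (rows ! r)" for r c
    using nr rl by (auto simp: diagram_def)
  define T where "T = restrict (\<lambda>(r, c). rows ! r ! (c - ?st r)) (diagram s)"
  have Tv: "T (r, c) = rows ! r ! (c - ?st r)" if "(r, c) \<in> diagram s" for r c
    using that by (simp add: T_def)
  have Tm: "T (r, c) \<in> set (rows ! r)" if "(r, c) \<in> diagram s" for r c
    using that Tv dg by auto
  have rowmem: "rows ! r \<in> set (take n rows)" if "r < n" for r
    using that n by (auto simp: in_set_conv_nth intro!: exI[of _ r])
  have tailmem: "rows ! r \<in> set (drop n rows)" if "n \<le> r" "r < length rows" for r
    using that by (auto simp: in_set_conv_nth intro!: exI[of _ "r - n"])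
  have crossT: "asc (T (r, c)) (T (r', c'))" if "(r, c) \<in> diagram s" "(r', c') \<in> diagram s" "r < n" "n \<le> r'"
    for r c r' c'
    using cross[of "T (r, c)" "T (r', c')"] Tm[OF that(1)] Tm[OF that(2)] rowmem[of r] tailmem[of r'] that dg by auto
  have "T \<in> tableaux m s" unfolding tableaux_iff[OF ok]
  proof (intro conjI)
    have "T p \<in> letters m" if "p \<in> diagram s" for p
    proof -
      obtain r c where p: "p = (r, c)" by (cases p)
      then have "T p \<in> set (rows ! r)" "r < length rows" using Tm that dg by auto
      then have "T p \<in> set (concat rows)" by auto
      then show ?thesis using lets by auto
    qed
    then show "T \<in> diagram s \<rightarrow>\<^sub>E letters m" by (auto simp: T_def PiE_def extensional_def)
    have "rk T p q" if pq: "(p, q) \<in> linked s" for p q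
    proof -
      obtain r c r' c' where p: "p = (r, c)" and q: "q = (r', c')" by (cases p; cases q)
      have d: "(r, c) \<in> diagram s" "(r', c') \<in> diagram s" using pq p q by (auto simp: linked_def)
      consider (row) "r = r'" "c < c'" | (col) "c = c'" "r < r'" | (joint) "r < n" "r' = n"
        using pq p q len by (auto simp: linked_def joint_def body_def)
      then show ?thesis
      proof cases
        case row
        have "rowsorted (rows ! r)" using rs d dg by auto
        then have "\<not> asc (rows ! r ! (c' - ?st r)) (rows ! r ! (c - ?st r))"
          using row d dg by (auto simp: sorted_wrt_iff_nth_less)
        then have "\<not> asc (T q) (T p)" using Tv d row p q by simp
        then show ?thesis using rk_row[of p q T] row p q by (auto simp: asc_def)
      next
        case col
        have "asc (T p) (T q)"
        proof (cases "r' < n")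
          case True
          then have "dominates (rows ! r) (rows ! r')"
            using body col n by (auto simp: sorted_wrt_iff_nth_less)
          then show ?thesis using Tv d p q st0 True col dg unfolding dominates_def by auto
        next
          case F: False
          show ?thesis
          proof (cases "r < n")
            case True
            then show ?thesis using crossT[OF d True] F p q by simp
          next
            case False
            have "r - n < r' - n" "r' - n < length (drop n rows)"
              using False col(2) d(2) F unfolding dg by (auto intro: diff_less_mono)
            then have "\<forall>x\<in>set (drop n rows ! (r - n)). \<forall>y\<in>set (drop n rows ! (r' - n)). asc x y"
              using sorted_wrt_nth_less[OF tail, of "r - n" "r' - n"] by simp
            then have "\<forall>x\<in>set (rows ! r). \<forall>y\<in>set (rows ! r'). asc x y" using False F n d dg by simp
            then show ?thesis using Tm d p q by blast
          qed
        qed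
        then show ?thesis using rk_col[of p q T] col p q by simp
      next
        case joint
        then have "asc (T p) (T q)" using crossT[OF d] p q by simp
        then show ?thesis using rk_col[of p q T] joint p q by simp
      qed
    qed
    then show "\<forall>(p, q)\<in>linked s. rk T p q" by blast
  qed
  moreover have "reading_word s T = concat (map rev rows)"
  proof -
    have "map (\<lambda>c. T (r, c)) [?st r ..< ?st r + row_length s r] = rows ! r" if "r < length rows" for r
      using that rl dg Tv by (intro nth_equalityI) auto
    then have "map (\<lambda>r. rev (map (\<lambda>c. T (r, c)) [?st r ..< ?st r + row_length s r])) [0..<num_rows s]
        = map (\<lambda>r. rev (rows ! r)) [0..<length rows]" using nr by simp
    also have "\<dots> = map rev rows" by (intro nth_equalityI) auto
    finally show ?thesis unfolding reading_word_def by simp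
  qed
  ultimately show ?thesis by blast
qed

lemma exists_sorted_rk: "finite A \<Longrightarrow> \<exists>xs. set xs = A \<and> sorted_wrt (rk T) xs"
proof (induction A rule: finite_induct)
  case (insert x A)
  then obtain xs where xs: "set xs = A" "sorted_wrt (rk T) xs" by blast
  let ?ys = "filter (\<lambda>y. rk T y x) xs @ x # filter (\<lambda>y. rk T x y) xs"
  have "set ?ys = insert x A" using xs insert rk_total[of _ x T] by auto
  moreover have "sorted_wrt (rk T) ?ys"
    using xs(2) rk_trans[of T _ x] by (auto simp: sorted_wrt_append sorted_wrt_filter)
  ultimately show ?case by blast
qed simp

lemma exists_runs:
  fixes P :: "'a \<Rightarrow> 'a \<Rightarrow> bool"
  shows "\<exists>rs. concat rs = xs \<and> [] \<notin> set rs \<and> (\<forall>r\<in>set rs. successively P r) \<and>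
    successively (\<lambda>r r'. \<not> P (last r) (hd r')) rs"
proof (induction xs)
  case Nil show ?case by (intro exI[of _ "[]"]) simp
next
  case (Cons x xs)
  then obtain rs where rs: "concat rs = xs" "[] \<notin> set rs" "\<forall>r\<in>set rs. successively P r"
    "successively (\<lambda>r r'. \<not> P (last r) (hd r')) rs" by blast
  show ?case
  proof (cases rs)
    case Nil
    then show ?thesis using rs by (intro exI[of _ "[[x]]"]) simp
  next
    case rr: (Cons r rs')
    then have rn: "r \<noteq> []" using rs by auto
    show ?thesis
    proof (cases "P x (hd r)")
      case True
      then show ?thesis using rs rr rn
        by (intro exI[of _ "(x # r) # rs'"]) (cases r; cases rs'; auto)
    next
      case False
      then show ?thesis using rs rr rn by (intro exI[of _ "[x] # rs"]) auto
    qed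
  qed
qed

section \<open>Sorting the tail\<close>

text \<open>The cells \<open>D\<close> form the body; the remaining cells, listed in the order of their
  standardization, are cut into the runs \<open>rho\<close> which become the rows of the tail.\<close>

locale tail_sorting =
  fixes m :: nat and s :: shape and D :: "cell set" and rho :: "cell list list"
  assumes ok: "ok_shape m s" and no_tail: "snd s = []"
    and col: "\<And>k. k \<le> m \<Longrightarrow> (k, 0) \<in> diagram s"
    and D: "D \<subseteq> diagram s" "\<And>p. p \<in> D \<Longrightarrow> fst p < m"
    and rho_set: "set (concat rho) = diagram s - D" and rho_distinct: "distinct (concat rho)"
    and rho_hd: "\<exists>\<tau>. concat rho = (m, 0) # \<tau>"
    and rho_ne: "[] \<notin> set rho"
    and rho_run: "\<And>r. r \<in> set rho \<Longrightarrow> sorted_wrt (\<lambda>x y. before y x) r"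
    and rho_break: "successively (\<lambda>r r'. \<not> before (hd r') (last r)) rho"
begin

text \<open>The reading order of the future tableau, still expressed in the old cells. The runs list
  the rows of the tail from left to right, hence the reversal.\<close>

definition new_cells :: "cell list" where
  "new_cells = filter (\<lambda>p. p \<in> D) (cells s) @ concat (map rev rho)"

text \<open>The fillings for which the choice of \<open>D\<close> and \<open>rho\<close> remains
  correct. It is closed under the operators, so one fixed permutation of the cells serves all of
  them and gives a relation in the sense of \<open>bisim\<close>.\<close>

definition fillings :: "(cell \<Rightarrow> rat) set" where
  "fillings = {T \<in> tableaux m s. (\<forall>p\<in>D. rk T p (m, 0)) \<and> sorted_wrt (rk T) (concat rho)}"

lemma set_rev_rho: "set (concat (map rev rho)) = diagram s - D"
  using rho_set by auto

lemma set_new_cells: "set new_cells = diagram s"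
  unfolding new_cells_def set_append set_rev_rho using D set_cells by auto

lemma distinct_new_cells: "distinct new_cells"
proof -
  have "mset (concat (map rev rho)) = mset (concat rho)" by (induction rho) auto
  then have "distinct (concat (map rev rho))" using rho_distinct mset_eq_imp_distinct_iff by blast
  then show ?thesis unfolding new_cells_def distinct_append set_rev_rho using distinct_cells by auto
qed

lemma mset_new_cells: "mset new_cells = mset (cells s)"
  using distinct_new_cells distinct_cells set_new_cells set_cells set_eq_iff_mset_eq_distinct by metis

text \<open>Take for \<open>u\<close> the last cell of the run of \<open>x\<close> and for
  \<open>v\<close> the first cell of the next run. They are consecutive in the sorted tail and,
  since the run stops there, \<open>u\<close> is read before \<open>v\<close>.\<close>

lemma break_between:
  assumes "rho = P @ r # S" "x \<in> set r" "y \<in> set (concat S)"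
  obtains u v where "u \<in> set r" "x = u \<or> before u x" "v \<in> set (concat S)" "before u v"
    "\<And>T. sorted_wrt (rk T) (concat rho) \<Longrightarrow>
      (x = u \<or> rk T x u) \<and> rk T u v \<and> (v = y \<or> rk T v y)"
proof -
  obtain r' S' where S: "S = r' # S'" using assms(3) by (cases S) auto
  have ne: "r \<noteq> []" "r' \<noteq> []" using rho_ne assms(1) S by auto
  define r0 where "r0 = butlast r"
  define r1 where "r1 = tl r'"
  have r: "r = r0 @ [last r]" "r' = hd r' # r1" using ne by (simp_all add: r0_def r1_def)
  have nb: "\<not> before (hd r') (last r)"
    using rho_break unfolding assms(1) S by (simp add: successively_append_iff)
  have c: "concat rho = concat P @ r0 @ last r # hd r' # r1 @ concat S'"
    unfolding assms(1) S using r by (metis append.assoc append_Cons append_Nil concat.simps(2) concat_append)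
  have "last r \<noteq> hd r'" using rho_distinct unfolding c by auto
  then have b: "before (last r) (hd r')" using nb before_total by blast
  have xu: "x \<in> set r0 \<or> x = last r" using assms(2) r(1) by (metis Un_iff empty_iff insert_iff list.simps(15) set_append empty_set)
  have vy: "y = hd r' \<or> y \<in> set (r1 @ concat S')" using assms(3) r(2) S by (metis Un_iff concat.simps(2) set_ConsD set_append append_Cons)
  show ?thesis
  proof (rule that[of "last r" "hd r'"])
    show "last r \<in> set r" using ne by simp
    have "sorted_wrt (\<lambda>x y. before y x) (r0 @ [last r])" using rho_run[of r] assms(1) r(1) by simp
    then show "x = last r \<or> before (last r) x" using xu by (auto simp: sorted_wrt_append)
    show "hd r' \<in> set (concat S)" using S ne by simp
    show "before (last r) (hd r')" by (rule b)
  next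
    fix T assume "sorted_wrt (rk T) (concat rho)"
    then show "(x = last r \<or> rk T x (last r)) \<and> rk T (last r) (hd r') \<and> (hd r' = y \<or> rk T (hd r') y)"
      using xu vy unfolding c by (auto simp: sorted_wrt_append)
  qed
qed

text \<open>The possible reasons for x to precede y in the new order. The old order survives inside
  the body and inside a run; only the other two alternatives can reverse a pair.\<close>

definition listed :: "cell \<Rightarrow> cell \<Rightarrow> bool" where
  "listed x y \<longleftrightarrow> x \<in> D \<and> y \<in> D \<and> before x y \<or> x \<in> D \<and> y \<in> diagram s - D \<or>
     x \<in> diagram s - D \<and> y \<in> diagram s - D \<and> ((\<exists>r\<in>set rho. x \<in> set r \<and> y \<in> set r \<and> before x y) \<or>
       (\<exists>P r S. rho = P @ r # S \<and> x \<in> set r \<and> y \<in> set (concat S)))"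

lemma sorted_new_cells: "sorted_wrt listed new_cells"
  unfolding new_cells_def sorted_wrt_append set_rev_rho
proof (intro conjI ballI)
  have "sorted_wrt before (filter (\<lambda>p. p \<in> D) (cells s))" using sorted_cells sorted_wrt_filter by blast
  then show "sorted_wrt listed (filter (\<lambda>p. p \<in> D) (cells s))"
    by (rule sorted_wrt_mono_rel[rotated]) (auto simp: listed_def)
  have mem: "x \<in> diagram s - D" if "r \<in> set rho" "x \<in> set r" for r x using rho_set that by auto
  show "sorted_wrt listed (concat (map rev rho))"
  proof (rule sorted_wrt_concat_map)
    fix r assume r: "r \<in> set rho"
    have "sorted_wrt before (rev r)" using rho_run[OF r] by (simp add: sorted_wrt_rev)
    then show "sorted_wrt listed (rev r)"
      by (rule sorted_wrt_mono_rel[rotated]) (use r mem in \<open>auto simp: listed_def\<close>)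
  next
    have "\<forall>a\<in>set (rev (rho ! k)). \<forall>b\<in>set (rev (rho ! l)). listed a b" if kl: "k < l" "l < length rho" for k l
    proof (intro ballI)
      fix a b assume ab: "a \<in> set (rev (rho ! k))" "b \<in> set (rev (rho ! l))"
      have "rho = take k rho @ rho ! k # drop (Suc k) rho" using kl by (simp add: id_take_nth_drop)
      moreover have "rho ! l \<in> set (drop (Suc k) rho)"
        using kl by (auto simp: in_set_conv_nth intro!: exI[of _ "l - Suc k"])
      then have "b \<in> set (concat (drop (Suc k) rho))" using ab by auto
      moreover have "a \<in> diagram s - D" "b \<in> diagram s - D"
        using mem[of "rho ! k" a] mem[of "rho ! l" b] ab kl by auto
      ultimately show "listed a b" unfolding listed_def using ab(1) by (metis set_rev)
    qed
    then show "sorted_wrt (\<lambda>r r'. \<forall>a\<in>set (rev r). \<forall>b\<in>set (rev r'). listed a b) rho"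
      by (simp add: sorted_wrt_iff_nth_less)
  qed
next
  fix x y assume "x \<in> set (filter (\<lambda>p. p \<in> D) (cells s))" "y \<in> diagram s - D"
  then show "listed x y" by (simp add: listed_def)
qed

context
  fixes T assumes T: "T \<in> fillings"
begin

lemma fillings_facts: "T \<in> tableaux m s" "\<And>p. p \<in> D \<Longrightarrow> rk T p (m, 0)" "sorted_wrt (rk T) (concat rho)"
  using T by (auto simp: fillings_def)

lemma joint_le: "p \<in> diagram s - D \<Longrightarrow> p = (m, 0) \<or> rk T (m, 0) p"
proof -
  assume p: "p \<in> diagram s - D"
  obtain \<tau> where \<tau>: "concat rho = (m, 0) # \<tau>" using rho_hd by blast
  then have "p = (m, 0) \<or> p \<in> set \<tau>" using p rho_set by (metis set_ConsD)
  then show ?thesis using fillings_facts(3) \<tau> by auto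
qed

lemma joint_pos: "T (m, 0) > 0"
  using tab_first_column_pos[OF ok fillings_facts(1)] col by blast

lemma tail_pos: "p \<in> diagram s - D \<Longrightarrow> T p > 0"
  using joint_le[of p] joint_pos by (auto simp: rk_def)

lemma rk_le: "p = q \<or> rk T p q \<Longrightarrow> T p \<le> T q" by (auto simp: rk_def)

text \<open>Cells with negative letters all lie in \<open>D\<close>, where the reading order is
  unchanged, so the operators with \<open>i < 0\<close> meet the same subword in both
  orders.\<close>

lemma filter_neg_cells:
  assumes "\<And>p. P p \<Longrightarrow> T p \<le> 0"
  shows "filter P new_cells = filter P (cells s)"
proof -
  have 1: "filter P (concat (map rev rho)) = []"
    unfolding filter_empty_conv set_rev_rho using tail_pos assms by force
  have 2: "filter P (filter (\<lambda>p. p \<in> D) (cells s)) = filter P (cells s)"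
    unfolding filter_filter
  proof (rule filter_cong[OF refl])
    fix p assume "p \<in> set (cells s)"
    then show "(p \<in> D \<and> P p) = P p" using tail_pos[of p] assms[of p] set_cells[of s] by force
  qed
  show ?thesis unfolding new_cells_def filter_append 1 2 by simp
qed

text \<open>For \<open>i \<ge> 0\<close> the cell \<open>c\<close> has to stay first or last among
  the cells with letters \<open>src i\<close> and \<open>tgt i\<close>. A reversed pair of such
  cells is separated in the standardization by the joint or by a break between runs; the cells there
  also carry one of the two letters, and their reading order is not changed.\<close>

lemma acted_new_cells:
  assumes i: "i \<in> index_set m" and a: "acted m i T (cells s) c" and Tc: "T c = src i \<or> T c = tgt i"
  shows "acted m i T new_cells c"
proof -
  let ?P = "\<lambda>p. T p = src i \<or> T p = tgt i"
  have c: "c \<in> diagram s" using acted_mem[OF a] set_cells by simp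
  then obtain A' B' where n: "new_cells = A' @ c # B'" using set_new_cells split_list by metis
  obtain A B where o: "cells s = A @ c # B" "clear_left m i (map T A)" "clear_right m i (map T B)"
    using a unfolding acted_def by blast
  have lst: "sorted_wrt listed (A' @ c # B')" using sorted_new_cells n by simp
  have sub: "set A' \<subseteq> diagram s" "set B' \<subseteq> diagram s" using set_new_cells n by auto
  have dn: "c \<notin> set A'" "c \<notin> set B'" using distinct_new_cells n by auto
  have lets: "T p \<in> letters m" if "p \<in> diagram s" for p using tab_letter[OF ok fillings_facts(1) that] .
  have between: "?P q" if "q \<in> diagram s" "?P p" "?P p'" "p = q \<or> rk T p q" "q = p' \<or> rk T q p'" for p q p'
    using letter_gap[OF i lets[OF that(1)]] rk_le[OF that(4)] rk_le[OF that(5)] that(2,3) src_less_tgt[OF i] by auto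
  have m0: "(m, 0) \<in> diagram s" using col by simp
  have "clear_left m i (map T A') \<and> clear_right m i (map T B')"
  proof (cases "i < 0")
    case True
    have neg: "src i \<le> 0" "tgt i \<le> 0" using True by (auto simp: src_def tgt_def)
    have "filter ?P new_cells = filter ?P (cells s)"
      by (rule filter_neg_cells) (use neg in auto)
    then have "filter ?P (A' @ c # B') = filter ?P (A @ c # B)" using n o(1) by simp
    then have "filter ?P A' @ c # filter ?P B' = filter ?P A @ c # filter ?P B" using Tc by simp
    moreover have "c \<notin> set (filter ?P B')" using dn by simp
    moreover have "c \<notin> set (filter ?P A')" using dn by simp
    ultimately have f: "filter ?P A' = filter ?P A" "filter ?P B' = filter ?P B"
      using append_Cons_eq_iff[of c "filter ?P A'" "filter ?P B'" "filter ?P A" "filter ?P B"] by blast+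
    have g: "filter (\<lambda>x. x = src i \<or> x = tgt i) (map T xs) = map T (filter ?P xs)" for xs
      by (simp add: filter_map o_def)
    show ?thesis using o(2,3) True filter_neg[OF i True, of "map T A'"] filter_neg[OF i True, of "map T A"]
        filter_neg[OF i True, of "map T B'"] filter_neg[OF i True, of "map T B"]
      unfolding clear_left_def clear_right_def g f by auto
  next
    case False
    then have i0: "i \<ge> 0" by simp
    have par: "src i \<in> \<int> \<longleftrightarrow> i \<in> \<int>" "tgt i \<in> \<int> \<longleftrightarrow> i \<notin> \<int>"
      using src_parity[OF i] tgt_parity[OF i] False by auto
    note st = src_less_tgt[OF i]
    note acted = acted_nonneg[OF a sorted_cells i0, unfolded set_cells]
    show ?thesis
    proof (cases "i \<in> \<int>")
      case True
      have "\<not> ?P d" if d: "d \<in> set A'" for d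
      proof
        assume Pd: "?P d"
        have dd: "d \<in> diagram s" "d \<noteq> c" using d sub dn by auto
        have cd: "before c d" using acted(1)[OF dd Pd True] .
        have "listed d c" using lst d by (auto simp: sorted_wrt_append)
        then consider "before d c" | "d \<in> D" "c \<in> diagram s - D"
          | P r S where "rho = P @ r # S" "d \<in> set r" "c \<in> set (concat S)"
          unfolding listed_def by blast
        then show False
        proof cases
          case 1 then show False using cd before_asym by blast
        next
          \<comment> \<open>The joint ranks between \<open>d\<close> and \<open>c\<close>. Equal
            even letters rank from right to left, so the joint, read after \<open>d\<close>, cannot
            be \<open>src i\<close>; then it and \<open>c\<close> are equal odd letters, and
            \<open>c\<close> is not read before the joint, hence not before
            \<open>d\<close>.\<close>
          case 2
          have dj: "rk T d (m, 0)" using fillings_facts(2) 2 by blast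
          have jc: "(m, 0) = c \<or> rk T (m, 0) c" using joint_le[OF 2(2)] by auto
          have Pj: "?P (m, 0)" using between[OF m0 Pd Tc] dj jc by blast
          have bj: "before d (m, 0)" using D(2)[OF 2(1)] by (simp add: before_def)
          have "T (m, 0) \<noteq> src i"
          proof
            assume e: "T (m, 0) = src i"
            then have "T d = src i" using rk_le[of d "(m, 0)"] dj Pd st by auto
            then have "before (m, 0) d" using dj e par True by (auto simp: rk_def)
            then show False using bj before_asym by blast
          qed
          then have e: "T (m, 0) = tgt i" using Pj by blast
          have "T c = tgt i" using rk_le[of "(m, 0)" c] jc e Tc st by auto
          then have "c = (m, 0) \<or> before (m, 0) c" using jc e par True by (auto simp: rk_def)
          then show False using bj cd before_trans before_asym by blast
        next
          \<comment> \<open>The same argument with the break: \<open>v\<close> takes the role of the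
            joint. As \<open>u\<close> is read before \<open>v\<close>, the letter at
            \<open>v\<close> is \<open>tgt i\<close>, so \<open>c\<close> is \<open>v\<close> or
            read after it and therefore after \<open>u\<close>, which contradicts that
            \<open>c\<close> is the first relevant cell.\<close>
          case 3
          from break_between[OF 3] obtain u v where uv: "u \<in> set r" "d = u \<or> before u d" "v \<in> set (concat S)"
            "before u v" "(d = u \<or> rk T d u) \<and> rk T u v \<and> (v = c \<or> rk T v c)" using fillings_facts(3) by metis
          have mem: "u \<in> diagram s" "v \<in> diagram s" using uv(1,3) 3(1) rho_set by auto
          have Pv: "?P v" using between[OF mem(2) Pd Tc] uv(5) rk_trans by blast
          have Pu: "?P u" using between[OF mem(1) Pd Tc] uv(5) rk_trans by blast
          have "T v \<noteq> src i"
          proof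
            assume e: "T v = src i"
            then have "T u = src i" using rk_le[of u v] uv(5) Pu st by auto
            then have "before v u" using uv(5) e par True by (auto simp: rk_def)
            then show False using uv(4) before_asym by blast
          qed
          then have e: "T v = tgt i" using Pv by blast
          have "T c = tgt i" using rk_le[of v c] uv(5) e Tc st by auto
          then have vc: "v = c \<or> before v c" using uv(5) e par True by (auto simp: rk_def)
          have "u = c \<or> before c u" using acted(1)[OF mem(1) _ Pu True] by blast
          then show False using vc uv(4) before_trans before_asym before_irrefl by metis
        qed
      qed
      then have "\<not> touches i (map T A')" unfolding touches_def set_map image_iff by metis
      then show ?thesis using True False by (simp add: clear_left_def clear_right_def)
    next
      case iF: False
      have "\<not> ?P d" if d: "d \<in> set B'" for d
      proof
        assume Pd: "?P d"
        have dd: "d \<in> diagram s" "d \<noteq> c" using d sub dn by auto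
        have cd: "before d c" using acted(2)[OF dd Pd iF] .
        have "listed c d" using lst d by (auto simp: sorted_wrt_append)
        then consider "before c d" | "c \<in> D" "d \<in> diagram s - D"
          | P r S where "rho = P @ r # S" "c \<in> set r" "d \<in> set (concat S)"
          unfolding listed_def by blast
        then show False
        proof cases
          case 1 then show False using cd before_asym by blast
        next
          case 2
          have cj: "rk T c (m, 0)" using fillings_facts(2) 2 by blast
          have jd: "(m, 0) = d \<or> rk T (m, 0) d" using joint_le[OF 2(2)] by auto
          have Pj: "?P (m, 0)" using between[OF m0 Tc Pd] cj jd by blast
          have bj: "before c (m, 0)" using D(2)[OF 2(1)] by (simp add: before_def)
          then have "before (m, 0) c" using acted(2)[OF m0 _ Pj iF] by auto
          then show False using bj before_asym by blast
        next
          \<comment> \<open>Now \<open>tgt i\<close> is even, so \<open>u\<close>, read before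
            \<open>v\<close>, must carry the odd \<open>src i\<close>. Odd letters rank in reading
            order, which forces \<open>c = u\<close>; but then \<open>v\<close> is a relevant cell
            read after \<open>c\<close>.\<close>
          case 3
          from break_between[OF 3] obtain u v where uv: "u \<in> set r" "c = u \<or> before u c" "v \<in> set (concat S)"
            "before u v" "(c = u \<or> rk T c u) \<and> rk T u v \<and> (v = d \<or> rk T v d)" using fillings_facts(3) by metis
          have mem: "u \<in> diagram s" "v \<in> diagram s" using uv(1,3) 3(1) rho_set by auto
          have Pv: "?P v" using between[OF mem(2) Tc Pd] uv(5) rk_trans by blast
          have Pu: "?P u" using between[OF mem(1) Tc Pd] uv(5) rk_trans by blast
          have "T u \<noteq> tgt i"
          proof
            assume e: "T u = tgt i"
            then have "T v = tgt i" using rk_le[of u v] uv(5) Pv st by auto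
            then have "before v u" using uv(5) e par iF by (auto simp: rk_def)
            then show False using uv(4) before_asym by blast
          qed
          then have e: "T u = src i" using Pu by blast
          have "T c = src i" using rk_le[of c u] uv(5) e Tc st by auto
          then have "c = u \<or> before c u" using uv(5) e par iF by (auto simp: rk_def)
          then have "c = u" using uv(2) before_asym by blast
          moreover have "v = c \<or> before v c" using acted(2)[OF mem(2) _ Pv iF] by blast
          ultimately show False using uv(4) before_asym before_irrefl by metis
        qed
      qed
      then have "\<not> touches i (map T B')" unfolding touches_def set_map image_iff by metis
      then show ?thesis using iF False by (simp add: clear_left_def clear_right_def)
    qed
  qed
  then show ?thesis using n unfolding acted_def by blast
qed

text \<open>For \<open>i < 0\<close> the changed cell is negative before and after, so it lies in
  \<open>D\<close> and stays below the joint. For \<open>i \<ge> 0\<close> the whole order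
  \<open>rk\<close> is preserved.\<close>

lemma fillings_upd:
  assumes i: "i \<in> index_set m" and a: "acted m i T (cells s) c"
    and tv: "T c = src i \<and> v = tgt i \<or> T c = tgt i \<and> v = src i"
  shows "T(c := v) \<in> fillings"
proof -
  have tab: "T(c := v) \<in> tableaux m s" using tableaux_upd[OF ok fillings_facts(1) i a tv] .
  have m0: "(m, 0) \<in> diagram s" using col by simp
  show ?thesis
  proof (cases "i < 0")
    case True
    have neg: "T c < 0" "v < 0" using tv True src_less_tgt[OF i] by (auto simp: tgt_def)
    have cm: "c \<noteq> (m, 0)" using neg joint_pos by auto
    have ct: "c \<notin> set (concat rho)" using neg tail_pos[of c] unfolding rho_set by force
    have "rk (T(c := v)) p (m, 0)" if "p \<in> D" for p
      using fillings_facts(2)[OF that] neg joint_pos cm by (auto simp: rk_def)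
    moreover have "sorted_wrt (rk (T(c := v))) (concat rho)"
      by (rule sorted_wrt_mono_rel[OF _ fillings_facts(3)]) (use ct in \<open>auto simp: rk_def\<close>)
    ultimately show ?thesis using tab unfolding fillings_def by blast
  next
    case False
    then have i0: "i \<ge> 0" by simp
    have lets: "T p \<in> letters m" if "p \<in> set (cells s)" for p using tab_letter[OF ok fillings_facts(1)] that set_cells by simp
    note U = rk_upd_nonneg[OF i i0 a sorted_cells lets tv, unfolded set_cells]
    have "rk (T(c := v)) p (m, 0)" if "p \<in> D" for p
      using U[of p "(m, 0)"] fillings_facts(2)[OF that] D(1) that m0 by blast
    moreover have "sorted_wrt (rk (T(c := v))) (concat rho)"
      by (rule sorted_wrt_mono_rel[OF _ fillings_facts(3)]) (use U rho_set in blast)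
    ultimately show ?thesis using tab unfolding fillings_def by blast
  qed
qed

end

lemma word_equiv_new_cells:
  assumes "T \<in> fillings"
  shows "word_equiv m (map T (cells s)) (map T new_cells)"
proof -
  define R where "R = {(map T (cells s), map T new_cells) | T. T \<in> fillings}"
  have "bisim m (word_crystal m) (word_crystal m) R"
  proof (rule word_bisimI)
    fix x y assume "(x, y) \<in> R"
    then obtain T where T: "T \<in> fillings" "x = map T (cells s)" "y = map T new_cells" unfolding R_def by blast
    have "x \<in> lists (letters m)" using reading_word_letters[of T m s] fillings_facts(1)[OF T(1)] T(2) by (simp add: reading_word_cells)
    moreover have m: "mset x = mset y" using T mset_new_cells by (metis mset_map)
    moreover have "set x = set y" using m by (metis set_mset_mset)
    ultimately show "x \<in> lists (letters m) \<and> y \<in> lists (letters m) \<and> mset x = mset y"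
      by (simp add: in_lists_conv_set)
  next
    fix x y x' y' assume "(x, y) \<in> R" "(x', y') \<in> R"
    then obtain T T' where "x = map T (cells s)" "y = map T new_cells" "x' = map T' (cells s)" "y' = map T' new_cells"
      unfolding R_def by blast
    then show "x = x' \<longleftrightarrow> y = y'" unfolding map_eq_conv using set_cells set_new_cells by simp
  next
    fix x y i assume r: "(x, y) \<in> R" and i: "i \<in> index_set m"
    then obtain T where T: "T \<in> fillings" "x = map T (cells s)" "y = map T new_cells" unfolding R_def by blast
    have lets: "T p \<in> letters m" if "p \<in> diagram s" for p using tab_letter[OF ok fillings_facts(1)[OF T(1)] that] .
    show "eps (word_crystal m) i x = eps (word_crystal m) i y" if neg: "i < 0"
    proof -
      let ?P = "\<lambda>p. T p = src i \<or> T p = tgt i"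
      have neg0: "src i \<le> 0" "tgt i \<le> 0" using neg by (auto simp: src_def tgt_def)
      have g: "filter (\<lambda>x. x = src i \<or> x = tgt i) (map T xs) = map T (filter ?P xs)" for xs
        by (simp add: filter_map o_def)
      have "filter ?P new_cells = filter ?P (cells s)" by (rule filter_neg_cells[OF T(1)]) (use neg0 in auto)
      then show ?thesis
        using filter_neg(1)[OF i neg, of "map T (cells s)"] filter_neg(1)[OF i neg, of "map T new_cells"]
        unfolding T(2,3) g by simp
    qed
    show "\<exists>y'. f_op (word_crystal m) i y = Some y' \<and> (x', y') \<in> R" if fx: "f_op (word_crystal m) i x = Some x'" for x'
    proof -
      obtain c where c: "acted m i T (cells s) c" "T c = src i" "x' = map (T(c := tgt i)) (cells s)"
        using fx unfolding T(2) f_map[OF i distinct_cells] by blast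
      have "f_op (word_crystal m) i y = Some (map (T(c := tgt i)) new_cells)"
        unfolding T(3) f_map[OF i distinct_new_cells] using acted_new_cells[OF T(1) i c(1)] c(2) by blast
      then show ?thesis using fillings_upd[OF T(1) i c(1)] c unfolding R_def by blast
    qed
    show "\<exists>y'. e_op (word_crystal m) i y = Some y' \<and> (x', y') \<in> R" if ex: "e_op (word_crystal m) i x = Some x'" for x'
    proof -
      have E: "e_op (word_crystal m) i (map T cs) = Some w \<longleftrightarrow>
          (\<exists>c. acted m i T cs c \<and> T c = tgt i \<and> w = map (T(c := src i)) cs)"
        if "distinct cs" "set cs = diagram s" for cs w
        by (rule e_map[OF i that(1)]) (use lets that(2) in blast)
      obtain c where c: "acted m i T (cells s) c" "T c = tgt i" "x' = map (T(c := src i)) (cells s)"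
        using ex unfolding T(2) E[OF distinct_cells set_cells] by blast
      have "e_op (word_crystal m) i y = Some (map (T(c := src i)) new_cells)"
        unfolding T(3) E[OF distinct_new_cells set_new_cells] using acted_new_cells[OF T(1) i c(1)] c(2) by blast
      then show ?thesis using fillings_upd[OF T(1) i c(1)] c unfolding R_def by blast
    qed
  qed
  moreover have "(map T (cells s), map T new_cells) \<in> R" using assms unfolding R_def by blast
  ultimately show ?thesis unfolding word_equiv_def by blast
qed

end

section \<open>Existence of the tableau with body and tail\<close>

lemma filter_upt_less: "n \<le> k \<Longrightarrow> filter (\<lambda>c. c < n) [0..<k] = [0..<n]"
  by (induction k) (auto simp: le_Suc_eq)

lemma tableau_rk_or_eq:
  assumes "ok_shape m s" "T \<in> tableaux m s" "(r, c) \<in> diagram s" "(r', c') \<in> diagram s"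
    "r = r' \<and> c \<le> c' \<or> c = c' \<and> r \<le> r'"
  shows "(r, c) = (r', c') \<or> rk T (r, c) (r', c')"
proof (cases "(r, c) = (r', c')")
  case False
  then have "((r, c), (r', c')) \<in> linked s" using assms(3-5) by (auto simp: linked_def)
  then show ?thesis using tab_linked[OF assms(1,2)] by blast
qed simp

text \<open>The sorted tail is cut so that cells of consecutive rank keep their relative reading
  order: within a run the higher rank is read first, as in a row, and at a break it is read later,
  as in the next row of a ribbon.\<close>

lemma separate_tail:
  assumes ok: "ok_shape m s" and no_tail: "snd s = []" and len: "m < length (fst s)"
    and pos: "\<forall>a\<in>set (fst s). a > 0" and T: "T \<in> tableaux m s"
  shows "\<exists>s'\<in>shapes m. \<exists>T'\<in>tableaux m s'. word_equiv m (reading_word s T) (reading_word s' T')"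
proof -
  let ?j = "(m, 0)"
  have col: "(k, 0) \<in> diagram s" if "k \<le> m" for k
    using body_cell[of k s 0] that len pos by simp
  have jd: "?j \<in> diagram s" using col by simp
  \<comment> \<open>All cells that rank below the first cell of row \<open>m\<close>. Ranks increase
    along rows and columns, so \<open>D\<close> is closed to the left and upwards and lies above row
    \<open>m\<close>: it is a Young diagram.\<close>
  define D where "D = {p \<in> diagram s. rk T p ?j}"
  have Dsub: "D \<subseteq> diagram s" by (auto simp: D_def)
  have Dm: "fst p < m" if p: "p \<in> D" for p
  proof (rule ccontr)
    assume "\<not> fst p < m"
    then have pm: "m \<le> fst p" by simp
    obtain r c where rc: "p = (r, c)" by (cases p)
    have d: "(r, c) \<in> diagram s" "rk T (r, c) ?j" using p rc by (auto simp: D_def)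
    have rl: "r < length (fst s)" using d(1) no_tail by (simp add: diagram_def num_rows_def)
    have mc: "(m, c) \<in> diagram s" using ok_shape_down[OF ok rl d(1)] pm rc by simp
    have "?j = (m, c) \<or> rk T ?j (m, c)" using tableau_rk_or_eq[OF ok T jd mc] by simp
    moreover have "(m, c) = (r, c) \<or> rk T (m, c) (r, c)"
      using tableau_rk_or_eq[OF ok T mc d(1)] pm rc by simp
    ultimately have "?j = (r, c) \<or> rk T ?j (r, c)" using rk_trans by metis
    then show False using d(2) rk_asym by (metis rk_irrefl)
  qed
  have Ddown: "(r, c) \<in> D" if d: "(r', c') \<in> D" "r \<le> r'" "c \<le> c'" for r c r' c'
  proof -
    have d': "(r', c') \<in> diagram s" "rk T (r', c') ?j" using d by (auto simp: D_def)
    have rl: "r' < length (fst s)" using Dm[OF d(1)] len by simp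
    have "(r, c) \<in> diagram s" "(r, c') \<in> diagram s"
      using ok_shape_down[OF ok rl d'(1) d(2)] d(3) by auto
    then have "(r, c) = (r, c') \<or> rk T (r, c) (r, c')" "(r, c') = (r', c') \<or> rk T (r, c') (r', c')"
      using tableau_rk_or_eq[OF ok T, of r c r c'] tableau_rk_or_eq[OF ok T _ d'(1), of r c'] d(2,3) by blast+
    then have "rk T (r, c) ?j" using d'(2) rk_trans by metis
    then show ?thesis using \<open>(r, c) \<in> diagram s\<close> by (simp add: D_def)
  qed
  have "finite (diagram s - D)" using set_cells by (metis finite_Diff List.finite_set)
  then obtain \<tau> where tau: "set \<tau> = diagram s - D" "sorted_wrt (rk T) \<tau>" using exists_sorted_rk by blast
  \<comment> \<open>A row is read from right to left, so a run continues as long as the next cell in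
    rank is read before the current one.\<close>
  obtain rho where rho: "concat rho = \<tau>" "[] \<notin> set rho" "\<forall>r\<in>set rho. successively (\<lambda>x y. before y x) r"
    "successively (\<lambda>r r'. \<not> before (hd r') (last r)) rho"
    using exists_runs[of \<tau> "\<lambda>x y. before y x"] by blast
  have tr: "transp (\<lambda>x y. before y x)" unfolding transp_def using before_trans by blast
  have jt: "?j \<in> set \<tau>" using jd tau(1) by (simp add: D_def)
  have jhd: "\<exists>\<tau>'. \<tau> = ?j # \<tau>'"
  proof (cases \<tau>)
    case (Cons x xs)
    have "x = ?j"
    proof (rule ccontr)
      assume ne: "x \<noteq> ?j"
      then have "rk T x ?j" using jt Cons tau(2) by auto
      moreover have "x \<in> diagram s - D" using tau(1) Cons by auto
      ultimately show False by (simp add: D_def)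
    qed
    then show ?thesis using Cons by simp
  qed (use jt in simp)
  have "distinct \<tau>" using tau(2) by (induction \<tau>) auto
  interpret tail_sorting m s D rho
  proof
    show "\<And>r. r \<in> set rho \<Longrightarrow> sorted_wrt (\<lambda>x y. before y x) r"
      using rho(3) successively_conv_sorted_wrt[OF tr] by blast
  qed (use ok no_tail col Dsub Dm tau rho jhd \<open>distinct \<tau>\<close> in auto)
  have "\<forall>p\<in>D. rk T p ?j" by (simp add: D_def)
  then have TF: "T \<in> fillings" using T tau(2) rho(1) unfolding fillings_def by simp
  \<comment> \<open>As \<open>D\<close> is closed to the left, the first missing column is the
    length of row \<open>r\<close> of \<open>D\<close>.\<close>
  define mu where "mu r = (LEAST c. (r, c) \<notin> D)" for r
  have mu_ex: "(r, fst s ! r) \<notin> D" if "r < m" for r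
    using body_cell[of r s "fst s ! r"] that len Dsub by auto
  have Dmu: "(r, c) \<in> D \<longleftrightarrow> c < mu r" if r: "r < m" for r c
  proof
    assume c: "(r, c) \<in> D"
    have "(r, mu r) \<notin> D" unfolding mu_def using mu_ex[OF r] by (rule LeastI)
    then show "c < mu r" using Ddown[OF c, of r "mu r"] by (meson leI order.refl)
  next
    assume "c < mu r" then show "(r, c) \<in> D" unfolding mu_def using not_less_Least by blast
  qed
  have mu_le: "mu r \<le> fst s ! r" if "r < m" for r using mu_ex[OF that] unfolding mu_def by (rule Least_le)
  define brow where "brow r = map (Pair r) [0..<mu r]" for r
  have D_cells: "filter (\<lambda>p. p \<in> D) (cells s) = concat (map (\<lambda>r. rev (brow r)) [0..<m])"
  proof -
    have nr: "num_rows s = length (fst s)" using no_tail by (simp add: num_rows_def)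
    have st: "row_start s r = 0" "row_length s r = fst s ! r" if "r < length (fst s)" for r
      using that by (auto simp: row_start_def row_length_def nth_append)
    have "cells s = concat (map (\<lambda>r. rev (map (Pair r) [0..<fst s ! r])) [0..<length (fst s)])"
      unfolding cells_def nr using st by (intro arg_cong[where f = concat] map_cong) auto
    moreover have "[0..<length (fst s)] = [0..<m] @ [m..<length (fst s)]"
      using upt_add_eq_append[of 0 m "length (fst s) - m"] len by simp
    ultimately have c: "cells s = concat (map (\<lambda>r. rev (map (Pair r) [0..<fst s ! r])) [0..<m]) @
        concat (map (\<lambda>r. rev (map (Pair r) [0..<fst s ! r])) [m..<length (fst s)])" by simp
    have 1: "filter (\<lambda>p. p \<in> D) (concat (map (\<lambda>r. rev (map (Pair r) [0..<fst s ! r])) [m..<length (fst s)])) = []"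
      unfolding filter_empty_conv using Dm by fastforce
    have "filter (\<lambda>p. p \<in> D) (rev (map (Pair r) [0..<fst s ! r])) = rev (brow r)" if "r < m" for r
    proof -
      have "filter (\<lambda>p. p \<in> D) (map (Pair r) [0..<fst s ! r]) = map (Pair r) (filter (\<lambda>c. c < mu r) [0..<fst s ! r])"
        unfolding filter_map o_def using Dmu[OF that] by simp
      then show ?thesis unfolding brow_def filter_upt_less[OF mu_le[OF that]] by (simp add: rev_filter[symmetric])
    qed
    then have 2: "filter (\<lambda>p. p \<in> D) (concat (map (\<lambda>r. rev (map (Pair r) [0..<fst s ! r])) [0..<m]))
        = concat (map (\<lambda>r. rev (brow r)) [0..<m])"
      unfolding filter_concat map_map o_def by (intro arg_cong[where f = concat] map_cong) auto
    show ?thesis unfolding c filter_append 1 2 by simp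
  qed
  define rows where "rows = map (\<lambda>r. map T (brow r)) [0..<m] @ map (map T) rho"
  have take: "take m rows = map (\<lambda>r. map T (brow r)) [0..<m]" and drop: "drop m rows = map (map T) rho"
    by (simp_all add: rows_def)
  have word: "concat (map rev rows) = map T new_cells"
    unfolding new_cells_def D_cells rows_def by (simp add: map_concat rev_map o_def)
  define s' where "s' = (map length (take m rows), map length (drop m rows))"
  have fs: "fst s' = map mu [0..<m]" unfolding s'_def take by (simp add: brow_def o_def)
  have ss: "snd s' = map length rho" unfolding s'_def drop by (simp add: o_def)
  have mu_mono: "mu r' \<le> mu r" if "r \<le> r'" "r' < m" for r r'
  proof (rule ccontr)
    assume "\<not> mu r' \<le> mu r"
    then have "(r', mu r) \<in> D" using Dmu[OF that(2)] by simp
    then have "(r, mu r) \<in> D" using Ddown that(1) by blast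
    then show False using Dmu[of r "mu r"] that by simp
  qed
  have s': "s' \<in> shapes m"
  proof -
    have "sorted_wrt (\<ge>) (map mu [0..<m])" using mu_mono by (auto simp: sorted_wrt_iff_nth_less)
    moreover have "\<forall>a\<in>set (map length rho). a > 0" using rho(2) by (auto simp: in_set_conv_nth) 
    moreover have "map mu [0..<m] ! (m - 1) \<noteq> 0" if "m > 0"
    proof -
      \<comment> \<open>The cell above the future joint ranks below it, so the last body row is
        nonempty, as a shape with a tail demands.\<close>
      have "(m - 1, 0) \<in> D" using tab_linked[OF ok T, of "(m - 1, 0)" ?j] col[of "m - 1"] jd that
        by (simp add: D_def linked_def)
      then show ?thesis using Dmu[of "m - 1" 0] that by simp
    qed
    ultimately show ?thesis unfolding shapes_def using fs ss by (cases s') auto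
  qed
  have tau_ge: "T ?j \<le> T p" if "p \<in> set (concat rho)" for p
    using joint_le[OF TF, of p] that unfolding rho_set by (auto simp: rk_def)
  have "\<exists>T'\<in>tableaux m s'. reading_word s' T' = concat (map rev rows)"
    unfolding s'_def
  proof (rule tableau_of_rows)
    show "m \<le> length rows" by (simp add: rows_def)
    have "map T new_cells \<in> lists (letters m)"
      using word_equiv_letters[OF word_equiv_new_cells[OF TF]] by blast
    then show "concat rows \<in> lists (letters m)" unfolding word[symmetric] by (auto simp: in_lists_conv_set)
  next
    fix r assume "r \<in> set rows"
    then consider k where "k < m" "r = map T (brow k)" | \<rho> where "\<rho> \<in> set rho" "r = map T \<rho>"
      unfolding rows_def by auto
    then show "rowsorted r"
    proof cases
      case (1 k)
      have "\<not> asc (T (k, c')) (T (k, c))" if "c < c'" "c' < mu k" for c c'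
      proof -
        have "(k, c) \<in> diagram s" "(k, c') \<in> diagram s" using Dmu[OF 1(1)] that Dsub by auto
        from tab_row[OF ok T this that(1)] show ?thesis by (auto simp: asc_def)
      qed
      then show ?thesis unfolding 1 brow_def by (auto simp: sorted_wrt_iff_nth_less)
    next
      case (2 \<rho>)
      have a: "sorted_wrt (\<lambda>x y. before y x) \<rho>" using rho_run 2 by blast
      have "sorted_wrt (rk T) (concat rho)" using tau(2) rho(1) by simp
      then have b: "sorted_wrt (rk T) \<rho>" using 2(1) by (auto dest!: split_list simp: sorted_wrt_append)
      have "\<not> asc (T (\<rho> ! l)) (T (\<rho> ! k))" if "k < l" "l < length \<rho>" for k l
        using sorted_wrt_nth_less[OF a that] sorted_wrt_nth_less[OF b that]
        by (auto simp: rk_def asc_def split: if_splits dest: before_asym)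
      then show ?thesis unfolding 2 by (auto simp: sorted_wrt_iff_nth_less)
    qed
  next
    have "dominates (map T (brow r)) (map T (brow r'))" if rr: "r < r'" "r' < m" for r r'
    proof -
      have "asc (T (r, c)) (T (r', c))" if "c < mu r'" for c
      proof -
        have "(r', c) \<in> D" using Dmu[OF rr(2)] that by simp
        moreover then have "(r, c) \<in> D" using Ddown rr(1) by (meson less_imp_le order.refl)
        ultimately show ?thesis using tab_col[OF ok T _ _ rr(1)] Dsub by blast
      qed
      then show ?thesis using mu_mono[of r r'] rr by (auto simp: dominates_def brow_def)
    qed
    then show "sorted_wrt dominates (take m rows)" unfolding take by (auto simp: sorted_wrt_iff_nth_less)
  next
    have "\<forall>x\<in>set (map T (rho ! k)). \<forall>y\<in>set (map T (rho ! l)). asc x y" if kl: "k < l" "l < length rho" for k l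
    proof (intro ballI)
      fix a b assume "a \<in> set (map T (rho ! k))" "b \<in> set (map T (rho ! l))"
      then obtain x y where xy: "x \<in> set (rho ! k)" "a = T x" "y \<in> set (rho ! l)" "b = T y" by auto
      have sp: "rho = take k rho @ rho ! k # drop (Suc k) rho" using kl by (simp add: id_take_nth_drop)
      have "rho ! l \<in> set (drop (Suc k) rho)"
        using kl by (auto simp: in_set_conv_nth intro!: exI[of _ "l - Suc k"])
      then have "y \<in> set (concat (drop (Suc k) rho))" using xy by auto
      from break_between[OF sp xy(1) this] obtain u v where uv: "before u v"
        "(x = u \<or> rk T x u) \<and> rk T u v \<and> (v = y \<or> rk T v y)"
        using tau(2) rho(1) by metis
      have le: "T x \<le> T u" "T v \<le> T y" using uv(2) by (auto simp: rk_def)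
      \<comment> \<open>Of two equal letters the one read first ranks lower only if they are odd,
        which is just what \<open>asc\<close> admits.\<close>
      have "asc (T u) (T v)" using uv by (auto simp: rk_def asc_def split: if_splits dest: before_asym)
      then show "asc a b" using asc_le le xy by metis
    qed
    then show "sorted_wrt (\<lambda>r r'. \<forall>x\<in>set r. \<forall>y\<in>set r'. asc x y) (drop m rows)"
      unfolding drop by (auto simp: sorted_wrt_iff_nth_less)
  next
    fix x y assume x: "x \<in> set (concat (take m rows))" and y: "y \<in> set (concat (drop m rows))"
    obtain r c where r: "r < m" "c < mu r" "x = T (r, c)" using x unfolding take by (auto simp: brow_def)
    have "y \<in> T ` set (concat rho)" using y unfolding drop by auto
    then obtain q where q: "q \<in> set (concat rho)" "y = T q" by blast
    have "(r, c) \<in> D" using Dmu r by simp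
    then have "rk T (r, c) ?j" by (simp add: D_def)
    then have "asc (T (r, c)) (T ?j)" using rk_col[of "(r, c)" ?j T] r by simp
    then show "asc x y" using asc_le(1) tau_ge[OF q(1)] r q by simp
  next
    show "ok_shape m (map length (take m rows), map length (drop m rows))"
      using shapes_ok[OF s'] unfolding s'_def .
  qed
  then obtain T' where T': "T' \<in> tableaux m s'" "reading_word s' T' = map T new_cells" using word by metis
  have "word_equiv m (reading_word s T) (reading_word s' T')"
    using word_equiv_new_cells[OF TF] T'(2) by (simp add: reading_word_cells)
  then show ?thesis using s' T'(1) by blast
qed

theorem word_equiv_some_tableau:
  assumes w: "w \<in> lists (letters m)"
  shows "\<exists>s\<in>shapes m. \<exists>T\<in>tableaux m s. word_equiv m w (reading_word s T)"
proof -
  obtain rs where rs: "pt_rows rs" "concat rs \<in> lists (letters m)" "word_equiv m w (concat (map rev rs))"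
    using word_equiv_pt_rows[OF w] by blast
  have sr: "r \<noteq> [] \<and> rowsorted r" if "r \<in> set rs" for r using rs(1) that by (simp add: pt_rows_def)
  have dom: "sorted_wrt dominates rs" using rs(1) by (simp add: pt_rows_def)
  have len_dom: "sorted_wrt (\<ge>) (map length xs)" if "sorted_wrt dominates xs" for xs
    unfolding sorted_wrt_map by (rule sorted_wrt_mono_rel[OF _ that]) (simp add: dominates_def)
  show ?thesis
  proof (cases "length rs \<le> m")
    case True
    \<comment> \<open>Empty rows fill the body up to exactly \<open>m\<close> rows, the format
      required of a partition in \<open>shapes\<close>; the tail is empty.\<close>
    define rows where "rows = rs @ replicate (m - length rs) []"
    have len: "length rows = m" using True by (simp add: rows_def)
    have sd: "sorted_wrt dominates rows"
      using dom by (auto simp: rows_def sorted_wrt_append dominates_Nil sorted_wrt_iff_nth_less[of _ "replicate _ _"])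
    define s where "s = (map length (take m rows), map length (drop m rows))"
    have s: "s \<in> shapes m" using len len_dom[OF sd] by (simp add: s_def shapes_def)
    have "\<exists>T\<in>tableaux m s. reading_word s T = concat (map rev rows)"
      unfolding s_def
    proof (rule tableau_of_rows)
      show "concat rows \<in> lists (letters m)" using rs(2) by (simp add: rows_def)
      show "rowsorted r" if "r \<in> set rows" for r using that sr by (auto simp: rows_def)
      show "ok_shape m (map length (take m rows), map length (drop m rows))" using shapes_ok[OF s] unfolding s_def .
    qed (use len sd in simp_all)
    moreover have "concat (map rev rows) = concat (map rev rs)" by (simp add: rows_def)
    ultimately show ?thesis using s rs(3) by metis
  next
    case False
    define s where "s = (map length (take (length rs) rs), map length (drop (length rs) rs))"
    have ok: "ok_shape m s" using len_dom[OF dom] by (simp add: ok_shape_def s_def)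
    have "\<exists>T\<in>tableaux m s. reading_word s T = concat (map rev rs)"
      unfolding s_def by (rule tableau_of_rows) (use rs(2) dom sr ok[unfolded s_def] in simp_all)
    then obtain T where T: "T \<in> tableaux m s" "reading_word s T = concat (map rev rs)" by blast
    have "\<exists>s'\<in>shapes m. \<exists>T'\<in>tableaux m s'. word_equiv m (reading_word s T) (reading_word s' T')"
      by (rule separate_tail[OF ok _ _ _ T(1)]) (use False sr in \<open>auto simp: s_def\<close>)
    then show ?thesis using rs(3) T(2) word_equiv_trans by metis
  qed
qed

theorem corollary5p2:
  fixes m :: nat and w :: "rat list"
  assumes "w \<in> elts (word_crystal m)"
  shows "\<exists>!(s, T). (s, T) \<in> (SIGMA s : shapes m. elts (tableau_crystal m s)) \<and>
           crystal_equiv m (word_crystal m) w (tableau_crystal m s) T"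
proof -
  obtain s T where sT: "s \<in> shapes m" "T \<in> tableaux m s" "word_equiv m w (reading_word s T)"
    using word_equiv_some_tableau assms by (metis elts_word)
  have eq: "crystal_equiv m (word_crystal m) w (tableau_crystal m s) T"
    using word_equiv_tableau[OF sT(3,2) shapes_ok[OF sT(1)]] .
  show ?thesis
  proof (rule ex1I[of _ "(s, T)"])
    show "case (s, T) of (s, T) \<Rightarrow> (s, T) \<in> (SIGMA s : shapes m. elts (tableau_crystal m s)) \<and>
        crystal_equiv m (word_crystal m) w (tableau_crystal m s) T"
      using sT eq by simp
  next
    fix p assume "case p of (s, T) \<Rightarrow> (s, T) \<in> (SIGMA s : shapes m. elts (tableau_crystal m s)) \<and>
        crystal_equiv m (word_crystal m) w (tableau_crystal m s) T"
    then show "p = (s, T)" using tableau_unique[OF sT(1) eq] by (cases p) auto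
  qed
qed

end
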